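(* Let $A$ and $V$ be bounded self-adjoint operators on a separable Hilbert space $\mathfrak{H}$ and set $B=A+V$. Suppose that $\mathrm{spec}(A)=\sigma\cup\Sigma$, where $\Sigma=\mathrm{spec}(A)\setminus\sigma$ and $d:=\mathrm{dist}(\sigma,\Sigma)>0$. Suppose that $V$ is off-diagonal with respect to the decomposition $\mathfrak{H}=\mathrm{Ran}\,\mathsf{E}_A(\sigma)\oplus\mathrm{Ran}\,\mathsf{E}_A(\Sigma)$, i.e. $\mathsf{E}_A(\sigma)V\mathsf{E}_A(\sigma)=\mathsf{E}_A(\Sigma)V\mathsf{E}_A(\Sigma)=0$. Let $$\delta_V=\|V\|\tan\Big(\tfrac12\arctan\tfrac{2\|V\|}{d}\Big).$$ If $\|V\|<\frac{\sqrt3}{2}d$ (equivalently, $\delta_V<d/2$), then: (i) the spectrum of $B$ in the open $d/2$-neighborhood $\mathcal{O}_{d/2}(\sigma)$ of $\sigma$ is separated from the remainder of the spectrum of $B$; moreover, $$\mathrm{spec}(B)\cap\mathcal{O}_{d/2}(\sigma)=\mathrm{spec}(B)\cap\mathcal{U}_{\delta_V}(\sigma),$$ and this is a nonempty closed set; (ii) if in addition $\|V\|<c_\pi d$ with $c_\pi=\frac{3\pi-\sqrt{\pi^2+32}}{\pi^2-4}=0.503288\ldots$, then $$\big\|\mathsf{E}_A(\sigma)-\mathsf{E}_B(\mathcal{O}_{d/2}(\sigma))\big\|\le\frac{\pi}{2}\,\frac{\|V\|}{d-\delta_V}<1.$$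
   Context: For a self-adjoint operator $T$ and a Borel set $\Delta\subset\mathbb{R}$, $\mathsf{E}_T(\Delta)$ denotes the spectral projection of $T$ for $\Delta$. For a set $S\subset\mathbb{R}$ and $r>0$, $\mathcal{O}_r(S)=\{x\in\mathbb{R}:\mathrm{dist}(x,S)<r\}$ is the open $r$-neighborhood and $\mathcal{U}_r(S)=\{x\in\mathbb{R}:\mathrm{dist}(x,S)\le r\}$ is the closed $r$-neighborhood of $S$. *)

theory Defs
  imports "HOL-Analysis.Analysis"
begin

text \<open>Hilbert spaces are modelled as complete real inner product spaces
  (type class real_inner + complete_space); bounded operators as bounded operators on it.\<close>

definition self_adjoint :: "('a::real_inner \<Rightarrow>\<^sub>L 'a) \<Rightarrow> bool" where
  "self_adjoint T \<longleftrightarrow> (\<forall>x y. inner (T x) y = inner x (T y))"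

definition separable_space :: "'a::metric_space itself \<Rightarrow> bool" where
  "separable_space _ \<longleftrightarrow> (\<exists>D::'a set. countable D \<and> closure D = UNIV)"

text \<open>Spectrum of a bounded operator (real spectral parameter; for self-adjoint
  operators the spectrum is real). By the open mapping theorem bijectivity of
  T - lambda I is equivalent to bounded invertibility.\<close>
definition spec :: "('a::real_normed_vector \<Rightarrow>\<^sub>L 'a) \<Rightarrow> real set" where
  "spec T = {l. \<not> bij (\<lambda>x. T x - l *\<^sub>R x)}"

definition pvm_scalar_measure ::
  "(real set \<Rightarrow> ('a::real_inner \<Rightarrow>\<^sub>L 'a)) \<Rightarrow> 'a \<Rightarrow> real measure" where
  "pvm_scalar_measure E x = measure_of UNIV (sets borel) (\<lambda>D. ennreal (inner (E D x) x))"

definition is_spectral_measure ::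
  "('a::{real_inner,complete_space} \<Rightarrow>\<^sub>L 'a) \<Rightarrow> (real set \<Rightarrow> ('a \<Rightarrow>\<^sub>L 'a)) \<Rightarrow> bool" where
  "is_spectral_measure T E \<longleftrightarrow>
     (\<forall>D\<in>sets borel. self_adjoint (E D)) \<and>
     (\<forall>D\<in>sets borel. \<forall>G\<in>sets borel. E (D \<inter> G) = E D o\<^sub>L E G) \<and>
     E UNIV = id_blinfun \<and>
     (\<forall>F::nat \<Rightarrow> real set. (\<forall>n. F n \<in> sets borel) \<longrightarrow> disjoint_family F \<longrightarrow>
        (\<forall>x. (\<lambda>n. E (F n) x) sums (E (\<Union>n. F n) x))) \<and>
     (\<exists>c. E {t. c < \<bar>t\<bar>} = 0) \<and>
     (\<forall>x. inner (T x) x = integral\<^sup>L (pvm_scalar_measure E x) (\<lambda>t. t))"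

definition spectral_proj :: "('a::{real_inner,complete_space} \<Rightarrow>\<^sub>L 'a) \<Rightarrow> real set \<Rightarrow> ('a \<Rightarrow>\<^sub>L 'a)" where
  "spectral_proj T D = (SOME E. is_spectral_measure T E) D"

definition open_nbhd :: "real \<Rightarrow> real set \<Rightarrow> real set" where
  "open_nbhd r S = {x. infdist x S < r}"

definition closed_nbhd :: "real \<Rightarrow> real set \<Rightarrow> real set" where
  "closed_nbhd r S = {x. infdist x S \<le> r}"

end

theory Submission
  imports Defs "HOL-Computational_Algebra.Polynomial"
begin

text \<open>
  Write \<sigma>, \<Sigma> for the two parts of spec A and v for the norm of V, so that \<delta> (\<delta> + d) = v^2.

  For l at distance r > \<delta> from spec A, the operator A + V - l is tested against the reflection
  J = sgn (A - l). Only the blocks of V on one side of l survive in the form of J (A + V - l), and on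
  each side one of \<sigma>, \<Sigma> has distance at least r + d from l, so this form is bounded below by
  r - \<delta>. Hence spec B lies in the \<delta>-neighbourhood of spec A. If spec B did not meet the
  d/2-neighbourhood of \<sigma>, then moving along A + t V in steps shorter than d - 2 \<delta> would make
  \<sigma> disappear from spec A.

  For (ii), the norm of the difference of two projections P, Q is the larger of the norms of
  P (1 - Q) and (1 - P) Q, and spectral projections of A and B for sets at distance r satisfy
  norm (P Q) \<le> (\<pi>/2) v / r. After rounding both spectra to a lattice this is Bohr's inequality:
  a trigonometric polynomial with frequencies of modulus at least N is bounded by
  \<pi>/(2 N) times the supremum of its derivative, as comparison with a triangle wave shows.

  The spectral measure of a self-adjoint operator T comes from the projections onto the kernels of
  the positive parts of T - l, which give Stieltjes measures and, by Dynkin's lemma, projections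
  for all Borel sets.
\<close>

section \<open>Bohr's inequality\<close>

text \<open>The spectral measure is fixed only by \<open>SOME\<close>, and its definition ties it to
  the operator only through quadratic forms, so commutation with the operator and support on the
  spectrum have to be derived from these. The space is real: symmetry is what lets forms determine
  operators, and sine-cosine pairs replace the group exp(itA). The lattice makes all frequencies
  integers and all sums finite, so the function to be estimated is a trigonometric polynomial
  without low frequencies; the rounding error disappears as the mesh shrinks. \<sigma> and \<Sigma>
  may interlace, so an estimate for arbitrarily placed separated sets is required, which is where
  pi/2 enters. The number -\<delta> is the lower eigenvalue of the 2x2 matrix with diagonal 0, d and
  off-diagonal entries v. The bound v < sqrt 3 / 2 * d says v^2 < d/2 * (d/2 + d), that is \<delta>
  < d/2; and v < c_pi * d gives v^2 < w * (w + d) for w = d - pi/2 * v, that is pi/2 * v < d -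
  \<delta>.\<close>

lemma integral_periodic_shift:
  fixes f :: "real \<Rightarrow> real"
  assumes cont: "continuous_on UNIV f" and per: "\<And>x. f (x + p) = f x"
    and a: "0 \<le> a" "a \<le> p"
  shows "integral {0..p} (\<lambda>x. f (x + a)) = integral {0..p} f"
proof -
  have int: "f integrable_on {u..v}" for u v
    by (intro integrable_continuous_real continuous_on_subset[OF cont]) auto
  have "integral {0..p} (\<lambda>x. f (x + a)) = integral {0..p} (f \<circ> (+) a)"
    by (simp add: o_def add.commute)
  also have "\<dots> = integral {a..p + a} f"
    by (simp only: integral_shift_Icc_real) simp
  also have "\<dots> = integral {a..p} f + integral {p..p + a} f"
    using Henstock_Kurzweil_Integration.integral_combine[of a p "p + a" f] int a by simp
  also have "integral {p..p + a} f = integral {0..a} (f \<circ> (+) p)"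
    by (simp only: integral_shift_Icc_real) (simp add: add.commute)
  also have "f \<circ> (+) p = f"
    using per by (auto simp: o_def add.commute)
  also have "integral {a..p} f + integral {0..a} f = integral {0..p} f"
    using Henstock_Kurzweil_Integration.integral_combine[of 0 a p f] int a by simp
  finally show ?thesis .
qed

text \<open>The even zigzag with slopes -1 and 1, peak pi/2 at 0 and period 2 pi; rescaled, it is
  the comparison function in Bohr's inequality.\<close>

definition triangle_wave :: "real \<Rightarrow> real" where
  "triangle_wave u = arcsin (cos u)"

lemma continuous_on_triangle_wave: "continuous_on S triangle_wave"
  unfolding triangle_wave_def by (intro continuous_intros) auto

lemma triangle_wave_shift: "triangle_wave (u + pi) = - triangle_wave u"
  by (simp add: triangle_wave_def arcsin_minus)

lemma triangle_wave_minus: "triangle_wave (- u) = triangle_wave u"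
  by (simp add: triangle_wave_def)

lemma triangle_wave_shift_nat: "triangle_wave (u + real j * pi) = (-1) ^ j * triangle_wave u"
proof (induction j)
  case (Suc j)
  have "triangle_wave (u + real (Suc j) * pi) = triangle_wave ((u + real j * pi) + pi)"
    by (simp add: algebra_simps)
  then show ?case using Suc by (simp add: triangle_wave_shift)
qed simp

lemma triangle_wave_eq_0_pi: "0 \<le> u \<Longrightarrow> u \<le> pi \<Longrightarrow> triangle_wave u = pi / 2 - u"
proof -
  assume "0 \<le> u" "u \<le> pi"
  then have "arcsin (sin (pi / 2 - u)) = pi / 2 - u"
    by (intro arcsin_sin) auto
  then show ?thesis by (simp add: triangle_wave_def cos_sin_eq)
qed

lemma triangle_wave_eq:
  assumes "real j * pi \<le> u" "u \<le> (real j + 1) * pi"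
  shows "triangle_wave u = (-1) ^ j * (pi / 2 - (u - real j * pi))"
proof -
  have "triangle_wave u = (-1) ^ j * triangle_wave (u - real j * pi)"
    using triangle_wave_shift_nat[of "u - real j * pi" j] by simp
  also have "triangle_wave (u - real j * pi) = pi / 2 - (u - real j * pi)"
    using assms by (intro triangle_wave_eq_0_pi) (auto simp: algebra_simps)
  finally show ?thesis .
qed

text \<open>Shifting t by pi/N flips the wave and rotates the cosine by the angle \<theta> = k pi/N.
  The sine part of the rotated integrand integrates to 0 by parity, so the integral I satisfies I =
  - cos \<theta> * I, and \<theta> < pi excludes I \<noteq> 0.\<close>

lemma integral_triangle_wave_cos:
  assumes k: "k < N"
  shows "integral {0..2*pi} (\<lambda>t. triangle_wave (real N * t) * cos (real k * t)) = 0"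
proof -
  define C where "C = (\<lambda>t. triangle_wave (real N * t) * cos (real k * t))"
  define S where "S = (\<lambda>t. triangle_wave (real N * t) * sin (real k * t))"
  define \<theta> where "\<theta> = real k * pi / real N"
  have N: "real N > 0" using k by simp
  have cT: "continuous_on X (\<lambda>t. triangle_wave (real N * t))" for X
    by (rule continuous_on_compose2[OF continuous_on_triangle_wave[of UNIV]])
       (auto intro!: continuous_intros)
  have cC: "continuous_on X C" and cS: "continuous_on X S" for X
    unfolding C_def S_def by (intro continuous_intros cT)+
  have per: "triangle_wave (real N * (t + 2 * pi)) = triangle_wave (real N * t)" for t
    using triangle_wave_shift_nat[of "real N * t" "2 * N"] by (simp add: algebra_simps)
  have pc: "cos (real k * (t + 2 * pi)) = cos (real k * t)" for t
    using cos.plus_of_nat[of "real k * t" k] by (simp add: algebra_simps)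
  have ps: "sin (real k * (t + 2 * pi)) = sin (real k * t)" for t
    using sin.plus_of_nat[of "real k * t" k] by (simp add: algebra_simps)
  have perC: "C (t + 2 * pi) = C t" and perS: "S (t + 2 * pi) = S t" for t
    by (simp_all only: C_def S_def per pc ps)
  have iS: "integral {0..2*pi} S = 0"
  proof -
    have "integral {0..2*pi} S = integral {-(2*pi)..-0} (\<lambda>t. S (- t))"
      by (simp only: Henstock_Kurzweil_Integration.integral_reflect_real)
    also have "(\<lambda>t. S (- t)) = (\<lambda>t. - S t)"
      using triangle_wave_minus by (auto simp: S_def)
    also have "integral {-(2*pi)..-0} (\<lambda>t. - S t) = - integral {-(2*pi)..0} S"
      by simp
    also have "integral {-(2*pi)..0} S = integral {-(2*pi)..0} (S \<circ> (+) (2 * pi))"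
      using perS by (simp add: o_def add.commute)
    also have "\<dots> = integral {0..2*pi} S"
      by (simp only: integral_shift_Icc_real) simp
    finally show ?thesis by simp
  qed
  have "pi / real N \<le> 2 * pi" using k by (simp add: field_simps)
  then have "integral {0..2*pi} C = integral {0..2*pi} (\<lambda>t. C (t + pi / real N))"
    using integral_periodic_shift[of C "2 * pi" "pi / real N"] cC perC N by simp
  also have "(\<lambda>t. C (t + pi / real N)) = (\<lambda>t. (- cos \<theta>) * C t + sin \<theta> * S t)"
  proof
    fix t
    have 1: "real N * (t + pi / real N) = real N * t + pi"
      using N by (simp add: field_simps)
    have 2: "real k * (t + pi / real N) = real k * t + \<theta>"
      unfolding \<theta>_def by (simp add: field_simps)
    show "C (t + pi / real N) = (- cos \<theta>) * C t + sin \<theta> * S t"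
      unfolding C_def S_def 1 2 triangle_wave_shift cos_add by (simp add: algebra_simps)
  qed
  also have "integral {0..2*pi} \<dots> = (- cos \<theta>) * integral {0..2*pi} C + sin \<theta> * integral {0..2*pi} S"
    by (subst Henstock_Kurzweil_Integration.integral_add)
       (auto intro!: integrable_continuous_real continuous_intros cC cS)
  finally have "(1 + cos \<theta>) * integral {0..2*pi} C = 0"
    using iS by (simp add: algebra_simps)
  moreover have "1 + cos \<theta> > 0"
  proof -
    have "0 \<le> \<theta>" "\<theta> < pi"
      using k N by (auto simp: \<theta>_def field_simps)
    then have "cos pi < cos \<theta>" by (intro cos_monotone_0_pi) auto
    then show ?thesis by simp
  qed
  ultimately show ?thesis by (simp add: C_def)
qed

lemma integral_cos_nat:
  assumes "n \<noteq> 0"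
  shows "((\<lambda>t. cos (real n * t)) has_integral 0) {0..2*pi}"
proof -
  have "((\<lambda>t. cos (real n * t)) has_integral
      (sin (real n * (2 * pi)) / real n - sin (real n * 0) / real n)) {0..2*pi}"
    using assms
    by (intro fundamental_theorem_of_calculus)
       (auto intro!: derivative_eq_intros
          simp: has_real_derivative_iff_has_vector_derivative[symmetric])
  moreover have "sin (real n * (2 * pi)) = 0"
    using sin.plus_of_nat[of "0::real" n] by simp
  ultimately show ?thesis by simp
qed

lemma integral_cos_cos_nat:
  assumes "k < n"
  shows "((\<lambda>t. cos (real n * t) * cos (real k * t)) has_integral 0) {0..2*pi}"
proof -
  have "((\<lambda>t. (1/2) * (cos (real (n - k) * t) + cos (real (n + k) * t))) has_integral (1/2) * (0 + 0))
      {0..2*pi}"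
    using assms by (intro has_integral_mult_right has_integral_add integral_cos_nat) auto
  moreover have "(1/2) * (cos (real (n - k) * t) + cos (real (n + k) * t)) = cos (real n * t) * cos (real k * t)" for t
    using assms by (simp add: of_nat_diff left_diff_distrib distrib_right cos_add cos_diff)
  ultimately show ?thesis by simp
qed

text \<open>Each factor cos t moves the frequency k to k + 1 and k - 1, so m factors stay below N.
  The frequency has to vary in the induction on m.\<close>

lemma integral_cos_power_eq_0:
  fixes g :: "real \<Rightarrow> real"
  assumes cont: "continuous_on {0..2*pi} g"
    and orth: "\<And>k. k < N \<Longrightarrow> integral {0..2*pi} (\<lambda>t. g t * cos (real k * t)) = 0"
  shows "k + m < N \<Longrightarrow> integral {0..2*pi} (\<lambda>t. g t * cos (real k * t) * cos t ^ m) = 0"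
proof (induction m arbitrary: k)
  case 0
  then show ?case using orth by simp
next
  case (Suc m)
  have int: "(\<lambda>t. g t * cos (real j * t) * cos t ^ m) integrable_on {0..2*pi}" for j
    by (intro integrable_continuous_real continuous_intros cont)
  show ?case
  proof (cases k)
    case 0
    then have "(\<lambda>t. g t * cos (real k * t) * cos t ^ Suc m) = (\<lambda>t. g t * cos (real 1 * t) * cos t ^ m)"
      by auto
    then show ?thesis using Suc.IH[of 1] Suc.prems 0 by simp
  next
    case (Suc j)
    have "(\<lambda>t. g t * cos (real k * t) * cos t ^ Suc m) =
        (\<lambda>t. (1/2) * (g t * cos (real (Suc k) * t) * cos t ^ m + g t * cos (real j * t) * cos t ^ m))"
    proof
      fix t
      have "cos (real k * t) * cos t = (1/2) * (cos (real k * t + t) + cos (real k * t - t))"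
        by (simp add: cos_add cos_diff)
      also have "real k * t + t = real (Suc k) * t" by (simp add: algebra_simps)
      also have "real k * t - t = real j * t" using Suc by (simp add: algebra_simps)
      finally have e: "cos (real k * t) * cos t = (1/2) * (cos (real (Suc k) * t) + cos (real j * t))" .
      have "g t * cos (real k * t) * cos t ^ Suc m = g t * (cos (real k * t) * cos t) * cos t ^ m"
        by simp
      then show "g t * cos (real k * t) * cos t ^ Suc m =
        (1/2) * (g t * cos (real (Suc k) * t) * cos t ^ m + g t * cos (real j * t) * cos t ^ m)"
        unfolding e by (simp add: algebra_simps)
    qed
    then have "integral {0..2*pi} (\<lambda>t. g t * cos (real k * t) * cos t ^ Suc m) =
        (1/2) * (integral {0..2*pi} (\<lambda>t. g t * cos (real (Suc k) * t) * cos t ^ m) +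
          integral {0..2*pi} (\<lambda>t. g t * cos (real j * t) * cos t ^ m))"
      by (simp only: Henstock_Kurzweil_Integration.integral_mult_right
          Henstock_Kurzweil_Integration.integral_add[OF int int])
    then show ?thesis
      using Suc.IH[of "Suc k"] Suc.IH[of j] Suc.prems Suc by simp
  qed
qed

lemma integral_poly_cos_eq_0:
  fixes g :: "real \<Rightarrow> real"
  assumes cont: "continuous_on {0..2*pi} g"
    and orth: "\<And>k. k < N \<Longrightarrow> integral {0..2*pi} (\<lambda>t. g t * cos (real k * t)) = 0"
    and deg: "degree p < N"
  shows "integral {0..2*pi} (\<lambda>t. g t * poly p (cos t)) = 0"
proof -
  have "integral {0..2*pi} (\<lambda>t. g t * poly p (cos t)) =
     integral {0..2*pi} (\<lambda>t. \<Sum>m\<le>degree p. coeff p m * (g t * cos (real 0 * t) * cos t ^ m))"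
    by (simp add: poly_altdef sum_distrib_left algebra_simps)
  also have "\<dots> = (\<Sum>m\<le>degree p. integral {0..2*pi} (\<lambda>t. coeff p m * (g t * cos (real 0 * t) * cos t ^ m)))"
    by (intro integral_sum integrable_continuous_real continuous_intros cont) auto
  also have "\<dots> = 0"
    using integral_cos_power_eq_0[OF cont orth, of N 0] deg by (intro sum.neutral) auto
  finally show ?thesis .
qed

text \<open>A function that is monotone on each of n consecutive intervals changes sign at most once per
  interval, so a polynomial in the cosine of degree at most n can follow its sign.\<close>

lemma sign_matching_poly:
  fixes g :: "real \<Rightarrow> real" and \<tau> :: "nat \<Rightarrow> real"
  assumes cont: "continuous_on {0..pi} g"
    and tau: "mono \<tau>" "0 \<le> \<tau> 0"
    and first: "\<And>t. 0 \<le> t \<Longrightarrow> t \<le> \<tau> 0 \<Longrightarrow> 0 < g t"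
    and mon: "\<And>j. j < n \<Longrightarrow> mono_on {\<tau> j..\<tau> (Suc j)} g \<or> mono_on {\<tau> j..\<tau> (Suc j)} (\<lambda>t. - g t)"
  shows "\<tau> n \<le> pi \<Longrightarrow> \<exists>p s. p \<noteq> 0 \<and> degree p \<le> n \<and> (\<forall>t\<in>{\<tau> n..pi}. 0 \<le> poly p (cos t)) \<and>
     (\<forall>t\<in>{0..\<tau> n}. 0 \<le> s * g t * poly p (cos t)) \<and> 0 \<le> s * g (\<tau> n) \<and> (s = 1 \<or> s = - 1)"
  using mon
proof (induction n)
  case 0
  have "\<forall>t\<in>{0..\<tau> 0}. 0 \<le> 1 * g t * poly 1 (cos t)"
    using first by (auto intro: less_imp_le)
  moreover have "0 \<le> 1 * g (\<tau> 0)" using first[of "\<tau> 0"] tau by simp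
  ultimately show ?case
    by (intro exI[of _ "1 :: real poly"] exI[of _ "1::real"]) auto
next
  case (Suc n)
  have le: "\<tau> n \<le> \<tau> (Suc n)" "0 \<le> \<tau> n"
    using monoD[OF tau(1), of n "Suc n"] monoD[OF tau(1), of 0 n] tau(2) by auto
  then have "\<tau> n \<le> pi" using Suc.prems by simp
  with Suc.IH Suc.prems obtain p s where ps: "p \<noteq> 0" "degree p \<le> n"
     "\<forall>t\<in>{\<tau> n..pi}. 0 \<le> poly p (cos t)"
     "\<forall>t\<in>{0..\<tau> n}. 0 \<le> s * g t * poly p (cos t)" "0 \<le> s * g (\<tau> n)" "s = 1 \<or> s = - 1"
    by (metis less_SucI)
  define a b where "a = \<tau> n" and "b = \<tau> (Suc n)"
  have ab: "0 \<le> a" "a \<le> b" "b \<le> pi" using le Suc.prems by (auto simp: a_def b_def)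
  have mon: "mono_on {a..b} g \<or> mono_on {a..b} (\<lambda>t. - g t)"
    using Suc.prems(2)[of n] by (simp add: a_def b_def)
  have mon: "mono_on {a..b} (\<lambda>t. s * g t) \<or> mono_on {a..b} (\<lambda>t. - (s * g t))"
    using mon ps(6) by auto
  have pos: "0 \<le> poly p (cos t)" if "a \<le> t" "t \<le> pi" for t
    using ps(3) that by (auto simp: a_def)
  show ?case
  proof (cases "0 \<le> s * g b")
    case True
    have "0 \<le> s * g t" if "t \<in> {a..b}" for t
      using mon
    proof
      assume "mono_on {a..b} (\<lambda>t. s * g t)"
      from mono_onD[OF this, of a t] show ?thesis using that ps(5) ab by (auto simp: a_def)
    next
      assume "mono_on {a..b} (\<lambda>t. - (s * g t))"
      from mono_onD[OF this, of t b] show ?thesis using that True ab by auto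
    qed
    then have "0 \<le> s * g t * poly p (cos t)" if "0 \<le> t" "t \<le> b" for t
      using that ps(4) pos[of t] ab by (cases "t \<le> a") (auto simp: a_def)
    then show ?thesis using ps True pos ab
      by (intro exI[of _ p] exI[of _ s]) (auto simp: b_def[symmetric])
  next
    case False
    \<comment> \<open>The form \<open>s * g\<close> is nonnegative at a and negative at b, which
      rules out the increasing case.\<close>
    have dec: "mono_on {a..b} (\<lambda>t. - (s * g t))"
    proof (rule ccontr)
      assume "\<not> ?thesis"
      then have "mono_on {a..b} (\<lambda>t. s * g t)" using mon by blast
      from mono_onD[OF this, of a b] show False using ps(5) False ab by (auto simp: a_def)
    qed
    have "continuous_on {a..b} (\<lambda>t. s * g t)"
      using ab by (intro continuous_intros continuous_on_subset[OF cont]) auto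
    with IVT2'[of "\<lambda>t. s * g t" b 0 a] False ps(5) ab
    obtain z where z: "a \<le> z" "z \<le> b" "s * g z = 0"
      by (force simp: a_def)
    \<comment> \<open>The new factor cos z - cos t changes sign exactly at the zero z, because the
      cosine decreases on [0, pi]. It is nonnegative to the right of z, so the sign change is
      absorbed to the left of z by replacing s with -s.\<close>
    define q where "q = p * [:cos z, -1:]"
    have q: "poly q (cos t) = poly p (cos t) * (cos z - cos t)" for t
      by (simp add: q_def algebra_simps)
    have cz: "t \<le> z \<Longrightarrow> 0 \<le> t \<Longrightarrow> cos z - cos t \<le> 0"
             "z \<le> t \<Longrightarrow> t \<le> pi \<Longrightarrow> 0 \<le> cos z - cos t" for t
      using z ab cos_monotone_0_pi_le[of t z] cos_monotone_0_pi_le[of z t] by auto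
    have "[:cos z, -1:] \<noteq> (0 :: real poly)" by simp
    then have "q \<noteq> 0" using ps(1) by (simp only: q_def mult_eq_0_iff) simp
    moreover have "degree q \<le> Suc n"
      using ps(2) degree_mult_le[of p "[:cos z, -1:]"] by (simp only: q_def) simp
    moreover have "0 \<le> poly q (cos t)" if "b \<le> t" "t \<le> pi" for t
      using that pos[of t] cz(2)[of t] z ab by (simp add: q)
    moreover have "0 \<le> (- s) * g t * poly q (cos t)" if t: "0 \<le> t" "t \<le> b" for t
    proof (cases "t \<le> z")
      case True
      have "0 \<le> s * g t * poly p (cos t)"
      proof (cases "t \<le> a")
        case True
        then show ?thesis using ps(4) t by (auto simp: a_def)
      next
        case False
        then have "0 \<le> s * g t"
          using mono_onD[OF dec, of t z] True z t by auto
        then show ?thesis using pos[of t] False t ab by auto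
      qed
      then have "s * g t * poly p (cos t) * (cos z - cos t) \<le> 0"
        using cz(1)[of t] True t by (simp add: mult_nonneg_nonpos)
      then show ?thesis by (simp add: q mult_ac)
    next
      case False
      then have "s * g t \<le> 0"
        using mono_onD[OF dec, of z t] z t by auto
      moreover have "0 \<le> poly p (cos t) * (cos z - cos t)"
        using pos[of t] cz(2)[of t] False t z ab by auto
      ultimately show ?thesis by (simp add: q mult_nonpos_nonneg)
    qed
    moreover have "0 \<le> (- s) * g b" using False by auto
    ultimately show ?thesis using ps(6)
      by (intro exI[of _ q] exI[of _ "- s"]) (auto simp: b_def[symmetric])
  qed
qed

text \<open>The left side is f 0. If it exceeded the peak of the wave with slopes M and -M, the
  difference g would be positive at 0; as f' is bounded by M, g is monotone on every half-wave. A
  polynomial in the cosine of degree below N then follows the sign of g, although g is orthogonal to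
  all of these.\<close>

lemma bohr_inequality_aux:
  fixes c :: "'k \<Rightarrow> real" and w :: "'k \<Rightarrow> nat"
  assumes fin: "finite K" and N: "0 < N" and freq: "\<And>k. k \<in> K \<Longrightarrow> N \<le> w k"
    and bound: "\<And>t. \<bar>\<Sum>k\<in>K. c k * real (w k) * sin (real (w k) * t)\<bar> < M"
  shows "(\<Sum>k\<in>K. c k) \<le> pi / 2 * (M / real N)"
proof (rule ccontr)
  assume *: "\<not> ?thesis"
  define f where "f = (\<lambda>t. \<Sum>k\<in>K. c k * cos (real (w k) * t))"
  define f' where "f' = (\<lambda>t. - (\<Sum>k\<in>K. c k * real (w k) * sin (real (w k) * t)))"
  define g where "g = (\<lambda>t. f t - M / real N * triangle_wave (real N * t))"
  have M: "M > 0" using bound[of 0] by simp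
  have f: "(f has_real_derivative f' t) (at t)" for t
    unfolding f_def f'_def
    by (auto intro!: derivative_eq_intros simp: sum_negf[symmetric] intro!: sum.cong)
  have f': "\<bar>f' t\<bar> < M" for t using bound[of t] by (simp add: f'_def)
  have contf: "continuous_on X f" for X
    by (intro continuous_at_imp_continuous_on ballI DERIV_isCont[OF f])
  have contT: "continuous_on X (\<lambda>t. triangle_wave (real N * t))" for X
    by (rule continuous_on_compose2[OF continuous_on_triangle_wave[of UNIV]])
       (auto intro!: continuous_intros)
  have contg: "continuous_on X g" for X
    unfolding g_def by (intro continuous_intros contf contT)
  have lip: "\<bar>f y - f x\<bar> \<le> M * (y - x)" if "x \<le> y" for x y
  proof (cases "x = y")
    case False
    then have "x < y" using that by simp
    then obtain z where "f y - f x = (y - x) * f' z"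
      using MVT2[of x y f f'] f by auto
    moreover have "\<bar>(y - x) * f' z\<bar> \<le> (y - x) * M"
      using that f'[of z] by (simp add: abs_mult mult_left_mono)
    ultimately show ?thesis by (simp add: mult.commute)
  qed simp
  \<comment> \<open>The half-wave from 0 to \<open>\<tau> 0\<close> is kept apart: g is increasing
    and positive there. Only N - 1 half-waves up to pi can contain a sign change, which brings the
    degree below N.\<close>
  define \<tau> where "\<tau> = (\<lambda>j. real (Suc j) * pi / real N)"
  have piece: "M / real N * triangle_wave (real N * t) = (-1) ^ j * M * (pi / (2 * real N) - (t - real j * pi / real N))"
    if "real j * pi / real N \<le> t" "t \<le> real (Suc j) * pi / real N" for t j
  proof -
    have "real j * pi \<le> real N * t" "real N * t \<le> (real j + 1) * pi"
      using that N by (auto simp: field_simps)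
    then have "M / real N * triangle_wave (real N * t) =
        M / real N * ((-1) ^ j * (pi / 2 - (real N * t - real j * pi)))"
      by (simp only: triangle_wave_eq)
    then show ?thesis using N by (simp add: field_simps)
  qed
  have incr: "g x \<le> g y" if "even j" "real j * pi / real N \<le> x" "x \<le> y" "y \<le> real (Suc j) * pi / real N" for x y j
  proof -
    have "g y - g x = f y - f x + M * (y - x)"
      using piece[of j x] piece[of j y] that by (simp add: g_def algebra_simps)
    then show ?thesis using lip[of x y] that by auto
  qed
  have decr: "g y \<le> g x" if "odd j" "real j * pi / real N \<le> x" "x \<le> y" "y \<le> real (Suc j) * pi / real N" for x y j
  proof -
    have "g y - g x = f y - f x - M * (y - x)"
      using piece[of j x] piece[of j y] that by (simp add: g_def algebra_simps)
    then show ?thesis using lip[of x y] that by auto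
  qed
  have g0: "g 0 > 0"
    using * by (simp add: g_def f_def triangle_wave_def mult.commute)
  have first: "0 < g t" if "0 \<le> t" "t \<le> \<tau> 0" for t
    using incr[of 0 0 t] that g0 by (simp add: \<tau>_def)
  have mon: "mono_on {\<tau> j..\<tau> (Suc j)} g \<or> mono_on {\<tau> j..\<tau> (Suc j)} (\<lambda>t. - g t)" for j
  proof (cases "even (Suc j)")
    case True
    then show ?thesis
      by (intro disjI1 mono_onI incr[of "Suc j"]) (auto simp: \<tau>_def)
  next
    case False
    have "- g x \<le> - g y" if "x \<in> {\<tau> j..\<tau> (Suc j)}" "y \<in> {\<tau> j..\<tau> (Suc j)}" "x \<le> y" for x y
      using decr[of "Suc j" x y] that False by (auto simp: \<tau>_def)
    then show ?thesis
      by (intro disjI2 mono_onI)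
  qed
  have "mono \<tau>" unfolding \<tau>_def by (intro monoI divide_right_mono mult_right_mono) auto
  moreover have "0 \<le> \<tau> 0" by (simp add: \<tau>_def)
  moreover have tN: "\<tau> (N - 1) = pi" using N by (simp add: \<tau>_def)
  ultimately have "\<exists>p s. p \<noteq> 0 \<and> degree p \<le> N - 1 \<and> (\<forall>t\<in>{\<tau> (N - 1)..pi}. 0 \<le> poly p (cos t)) \<and>
     (\<forall>t\<in>{0..\<tau> (N - 1)}. 0 \<le> s * g t * poly p (cos t)) \<and> 0 \<le> s * g (\<tau> (N - 1)) \<and> (s = 1 \<or> s = - 1)"
    by (intro sign_matching_poly contg first mon) simp_all
  then obtain p s where p: "p \<noteq> 0" "degree p \<le> N - 1"
     and sgn': "\<forall>t\<in>{0..pi}. 0 \<le> s * g t * poly p (cos t)" and s: "s = 1 \<or> s = (-1::real)"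
    unfolding tN by blast
  have sgn: "0 \<le> s * g t * poly p (cos t)" if "0 \<le> t" "t \<le> pi" for t
    using sgn' that by simp
  \<comment> \<open>This symmetry carries the sign information from [0, pi] to the full
    period.\<close>
  have refl: "g (2 * pi - t) = g t" for t
  proof -
    have a: "cos (real n * (2 * pi - t)) = cos (real n * t)" for n
      using cos.plus_of_nat[of "- real n * t" n] by (simp add: algebra_simps)
    show ?thesis by (simp only: g_def f_def triangle_wave_def a)
  qed
  have sgn2: "0 \<le> s * (g t * poly p (cos t))" if "t \<in> {0..2*pi}" for t
  proof (cases "t \<le> pi")
    case True
    then show ?thesis using sgn[of t] that by (simp add: mult_ac)
  next
    case False
    have "cos (2 * pi - t) = cos t" by (simp add: cos_diff)
    then show ?thesis using sgn[of "2 * pi - t"] that False refl[of t] by (simp add: mult_ac)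
  qed
  have orth: "integral {0..2*pi} (\<lambda>t. g t * cos (real k * t)) = 0" if "k < N" for k
  proof -
    have "((\<lambda>t. \<Sum>i\<in>K. c i * (cos (real (w i) * t) * cos (real k * t))) has_integral (\<Sum>i\<in>K. c i * 0)) {0..2*pi}"
      using that freq by (intro has_integral_sum fin has_integral_mult_right integral_cos_cos_nat)
        (auto intro: less_le_trans)
    then have 1: "integral {0..2*pi} (\<lambda>t. f t * cos (real k * t)) = 0"
      by (simp add: f_def sum_distrib_right mult.assoc integral_unique)
    have "integral {0..2*pi} (\<lambda>t. g t * cos (real k * t)) =
       integral {0..2*pi} (\<lambda>t. f t * cos (real k * t) - M / real N * (triangle_wave (real N * t) * cos (real k * t)))"
      by (simp add: g_def algebra_simps)
    also have "\<dots> = integral {0..2*pi} (\<lambda>t. f t * cos (real k * t)) -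
        integral {0..2*pi} (\<lambda>t. M / real N * (triangle_wave (real N * t) * cos (real k * t)))"
      by (intro Henstock_Kurzweil_Integration.integral_diff integrable_continuous_real continuous_intros contf contT)
    also have "\<dots> = 0"
      using 1 integral_triangle_wave_cos[OF that] by simp
    finally show ?thesis .
  qed
  have "degree p < N" using p(2) N by simp
  from integral_poly_cos_eq_0[OF contg orth this]
  have "integral {0..2*pi} (\<lambda>t. s * (g t * poly p (cos t))) = 0" by simp
  moreover have "continuous_on {0..2*pi} (\<lambda>t. s * (g t * poly p (cos t)))"
    by (intro continuous_intros contg)
  ultimately have zero: "\<forall>t\<in>{0..2*pi}. s * (g t * poly p (cos t)) = 0"
    using integral_eq_0_iff[of 0 "2 * pi" "\<lambda>t. s * (g t * poly p (cos t))"] sgn2 by auto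
  have "\<tau> 0 > 0" "\<tau> 0 \<le> pi" using N by (auto simp: \<tau>_def field_simps)
  \<comment> \<open>A nonnegative continuous integrand with integral 0 vanishes; where g is
    positive, this makes p vanish on infinitely many values of the cosine.\<close>
  have "poly p (cos t) = 0" if "t \<in> {0..\<tau> 0}" for t
  proof -
    have "s * (g t * poly p (cos t)) = 0" "g t > 0"
      using bspec[OF zero, of t] that \<open>\<tau> 0 \<le> pi\<close> first[of t] by auto
    then show ?thesis using s by auto
  qed
  then have "cos ` {0..\<tau> 0} \<subseteq> {x. poly p x = 0}" by auto
  moreover have "infinite (cos ` {0..\<tau> 0})"
  proof -
    have "inj_on cos {0..\<tau> 0}"
      by (rule inj_onI, rule cos_inj_pi) (use \<open>\<tau> 0 \<le> pi\<close> in auto)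
    moreover have "infinite {0..\<tau> 0}" using \<open>\<tau> 0 > 0\<close> by (simp add: infinite_Icc)
    ultimately show ?thesis using finite_imageD by blast
  qed
  ultimately show False using poly_roots_finite[OF p(1)] finite_subset by blast
qed

lemma bohr_inequality:
  fixes c :: "'k \<Rightarrow> real" and w :: "'k \<Rightarrow> nat"
  assumes "finite K" and "0 < N" and "\<And>k. k \<in> K \<Longrightarrow> N \<le> w k"
    and bound: "\<And>t. \<bar>\<Sum>k\<in>K. c k * real (w k) * sin (real (w k) * t)\<bar> \<le> M"
  shows "(\<Sum>k\<in>K. c k) \<le> pi / 2 * (M / real N)"
proof (rule field_le_epsilon)
  fix e :: real assume "e > 0"
  \<comment> \<open>The solution of pi/2 * (r/N) = e.\<close>
  define r where "r = 2 * real N * e / pi"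
  have "r > 0" using \<open>e > 0\<close> \<open>0 < N\<close> by (simp add: r_def)
  then have "\<bar>\<Sum>k\<in>K. c k * real (w k) * sin (real (w k) * t)\<bar> < M + r" for t
    using bound[of t] by simp
  from bohr_inequality_aux[OF assms(1-3) this]
  have "(\<Sum>k\<in>K. c k) \<le> pi / 2 * ((M + r) / real N)" by simp
  also have "\<dots> = pi / 2 * (M / real N) + e"
    using \<open>0 < N\<close> by (simp add: r_def field_simps)
  finally show "(\<Sum>k\<in>K. c k) \<le> pi / 2 * (M / real N) + e" .
qed

section \<open>Self-adjoint operators\<close>

lemma self_adjointD: "self_adjoint T \<Longrightarrow> inner (blinfun_apply T x) y = inner x (blinfun_apply T y)"
  by (simp add: self_adjoint_def)

lemma self_adjoint_0 [simp]: "self_adjoint 0"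
  and self_adjoint_id [simp]: "self_adjoint id_blinfun"
  by (simp_all add: self_adjoint_def)

lemma self_adjoint_add: "self_adjoint S \<Longrightarrow> self_adjoint T \<Longrightarrow> self_adjoint (S + T)"
  and self_adjoint_diff: "self_adjoint S \<Longrightarrow> self_adjoint T \<Longrightarrow> self_adjoint (S - T)"
  and self_adjoint_scaleR: "self_adjoint S \<Longrightarrow> self_adjoint (c *\<^sub>R S)"
  by (simp_all add: self_adjoint_def blinfun.bilinear_simps inner_add_left inner_add_right
      inner_diff_left inner_diff_right)

lemma self_adjoint_sum: "(\<And>i. i \<in> I \<Longrightarrow> self_adjoint (f i)) \<Longrightarrow> self_adjoint (\<Sum>i\<in>I. f i)"
  by (induction I rule: infinite_finite_induct) (auto intro: self_adjoint_add)

lemma self_adjoint_square: "self_adjoint S \<Longrightarrow> self_adjoint (S o\<^sub>L S)"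
  by (simp add: self_adjoint_def)

lemma self_adjoint_commute:
  "self_adjoint S \<Longrightarrow> self_adjoint T \<Longrightarrow> S o\<^sub>L T = T o\<^sub>L S \<Longrightarrow> self_adjoint (S o\<^sub>L T)"
  unfolding self_adjoint_def by (metis blinfun_apply_blinfun_compose)

text \<open>By symmetry, polarization recovers \<open>inner (T x) y\<close> from the form at x + y
  and x - y, and the parallelogram law adds up the two bounds.\<close>

lemma self_adjoint_norm_le:
  fixes T :: "'a::real_inner \<Rightarrow>\<^sub>L 'a"
  assumes sa: "self_adjoint T" and c: "0 \<le> c"
    and bound: "\<And>x. \<bar>inner (T x) x\<bar> \<le> c * (norm x)\<^sup>2"
  shows "norm T \<le> c"
proof (rule norm_blinfun_bound[OF c])
  fix x
  show "norm (T x) \<le> c * norm x"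
  proof (cases "T x = 0 \<or> x = 0")
    case True
    then show ?thesis using c by (auto simp: blinfun.zero_right)
  next
    case False
    then have nz: "norm (T x) > 0" "norm x > 0" by auto
    \<comment> \<open>The direction of T x with the length of x: the inner product of T x with y is
      then norm x * norm (T x).\<close>
    define y where "y = (norm x / norm (T x)) *\<^sub>R T x"
    have ny: "norm y = norm x" using nz by (simp add: y_def)
    have "4 * inner (T x) y = inner (T (x + y)) (x + y) - inner (T (x - y)) (x - y)"
      using self_adjointD[OF sa, of y x]
      by (simp add: blinfun.bilinear_simps inner_add_left inner_add_right inner_diff_left
          inner_diff_right inner_commute)
    also have "\<dots> \<le> c * (norm (x + y))\<^sup>2 + c * (norm (x - y))\<^sup>2"
      using bound[of "x + y"] bound[of "x - y"] by linarith
    also have "\<dots> = c * (2 * (norm x)\<^sup>2 + 2 * (norm y)\<^sup>2)"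
      by (simp add: power2_norm_eq_inner inner_add_left inner_add_right inner_diff_left
          inner_diff_right algebra_simps inner_commute)
    finally have "inner (T x) y \<le> c * (norm x)\<^sup>2" by (simp add: ny)
    moreover have "inner (T x) y = norm x * norm (T x)"
      using nz by (simp add: y_def power2_norm_eq_inner[symmetric] power2_eq_square)
    ultimately have "norm x * norm (T x) \<le> norm x * (c * norm x)"
      by (simp add: power2_eq_square algebra_simps)
    then show ?thesis using nz by simp
  qed
qed

text \<open>Lets operator identities be checked on quadratic forms. Symmetry matters in a real
  space: a rotation by a right angle has zero form.\<close>

lemma self_adjoint_eqI:
  fixes S T :: "'a::real_inner \<Rightarrow>\<^sub>L 'a"
  assumes "self_adjoint S" "self_adjoint T" "\<And>x. inner (S x) x = inner (T x) x"
  shows "S = T"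
proof -
  have "norm (S - T) \<le> 0"
    using assms
    by (intro self_adjoint_norm_le self_adjoint_diff)
       (auto simp: blinfun.bilinear_simps inner_diff_left)
  then show ?thesis by simp
qed

definition pos_op :: "('a::real_inner \<Rightarrow>\<^sub>L 'a) \<Rightarrow> bool" where
  "pos_op T \<longleftrightarrow> self_adjoint T \<and> (\<forall>x. 0 \<le> inner (T x) x)"

text \<open>Positivity of the form at x - (1/c) T x, where 1/c is the best step length for the bound
  c. It turns smallness of the form into smallness of the vector T x.\<close>

lemma pos_op_norm_sq_le:
  fixes T :: "'a::real_inner \<Rightarrow>\<^sub>L 'a"
  assumes pos: "pos_op T" and c: "norm T \<le> c"
  shows "(norm (T x))\<^sup>2 \<le> c * inner (T x) x"
proof (cases "c = 0")
  case True
  then show ?thesis using c by simp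
next
  case False
  then have c0: "c > 0" using c norm_ge_zero[of T] by linarith
  have sa: "self_adjoint T" using pos by (simp add: pos_op_def)
  define s where "s = 1 / c"
  have "0 \<le> inner (T (x - s *\<^sub>R T x)) (x - s *\<^sub>R T x)"
    using pos by (simp add: pos_op_def)
  also have "\<dots> = inner (T x) x - 2 * s * (norm (T x))\<^sup>2 + s\<^sup>2 * inner (T (T x)) (T x)"
    using self_adjointD[OF sa, of "T x" x]
    by (simp add: blinfun.bilinear_simps inner_diff_left inner_diff_right power2_norm_eq_inner
        algebra_simps power2_eq_square[of s])
  also have "inner (T (T x)) (T x) \<le> c * (norm (T x))\<^sup>2"
  proof -
    have "inner (T (T x)) (T x) \<le> norm (T (T x)) * norm (T x)" by (rule norm_cauchy_schwarz)
    also have "\<dots> \<le> (c * norm (T x)) * norm (T x)"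
      by (intro mult_right_mono order_trans[OF norm_blinfun] c) auto
    finally show ?thesis by (simp add: power2_eq_square)
  qed
  then have "s\<^sup>2 * inner (T (T x)) (T x) \<le> s\<^sup>2 * (c * (norm (T x))\<^sup>2)"
    by (intro mult_left_mono) auto
  finally have "0 \<le> inner (T x) x - s * (norm (T x))\<^sup>2"
    using c0 by (simp add: s_def power2_eq_square field_simps)
  then show ?thesis using c0 by (simp add: s_def field_simps)
qed

lemma pos_op_eq_0:
  fixes T :: "'a::real_inner \<Rightarrow>\<^sub>L 'a"
  shows "pos_op T \<Longrightarrow> inner (T x) x = 0 \<Longrightarrow> T x = 0"
  using pos_op_norm_sq_le[of T "norm T" x] by simp

lemma projection_norm_sq:
  fixes P :: "'a::real_inner \<Rightarrow>\<^sub>L 'a"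
  assumes "self_adjoint P" "P o\<^sub>L P = P"
  shows "inner (P x) x = (norm (P x))\<^sup>2"
proof -
  have "P (P x) = P x" using assms(2) by (metis blinfun_apply_blinfun_compose)
  then show ?thesis
    using self_adjointD[OF assms(1), of "P x" x] by (simp add: power2_norm_eq_inner)
qed

lemma projection_pythagoras:
  fixes P :: "'a::real_inner \<Rightarrow>\<^sub>L 'a"
  assumes "self_adjoint P" "P o\<^sub>L P = P"
  shows "(norm x)\<^sup>2 = (norm (P x))\<^sup>2 + (norm (x - P x))\<^sup>2"
  using projection_norm_sq[OF assms, of x]
  by (simp add: power2_norm_eq_inner inner_diff_left inner_diff_right inner_commute)

lemma projection_norm_le:
  fixes P :: "'a::real_inner \<Rightarrow>\<^sub>L 'a"
  assumes "self_adjoint P" "P o\<^sub>L P = P"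
  shows "norm (P x) \<le> norm x"
  using projection_pythagoras[OF assms, of x] by (simp add: norm_le_square power2_norm_eq_inner)

section \<open>Strong limits\<close>

lemma strong_limit_exists:
  fixes X :: "nat \<Rightarrow> 'a::real_normed_vector \<Rightarrow>\<^sub>L 'b::real_normed_vector"
  assumes conv: "\<And>x. convergent (\<lambda>n. X n x)" and bound: "\<And>n. norm (X n) \<le> C"
  obtains L :: "'a \<Rightarrow>\<^sub>L 'b" where "\<And>x. (\<lambda>n. X n x) \<longlonglongrightarrow> L x" "norm L \<le> C"
proof -
  define f where "f x = lim (\<lambda>n. X n x)" for x
  have f: "(\<lambda>n. X n x) \<longlonglongrightarrow> f x" for x
    using conv[of x] by (simp add: f_def convergent_LIMSEQ_iff)
  have C: "0 \<le> C" using bound[of 0] norm_ge_zero order_trans by blast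
  have fb: "norm (f x) \<le> C * norm x" for x
  proof (rule LIMSEQ_le_const2)
    show "(\<lambda>n. norm (X n x)) \<longlonglongrightarrow> norm (f x)" by (intro tendsto_norm f)
    show "\<exists>N. \<forall>n\<ge>N. norm (X n x) \<le> C * norm x"
      by (intro exI allI impI order_trans[OF norm_blinfun] mult_right_mono bound) auto
  qed
  have "bounded_linear f"
  proof (rule bounded_linear_intro)
    fix x y and r :: real
    show "f (x + y) = f x + f y"
      by (rule LIMSEQ_unique[OF f[of "x + y"]])
         (simp add: blinfun.add_right tendsto_add[OF f f])
    show "f (r *\<^sub>R x) = r *\<^sub>R f x"
      by (rule LIMSEQ_unique[OF f[of "r *\<^sub>R x"]])
         (simp add: blinfun.scaleR_right tendsto_scaleR[OF tendsto_const f])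
    show "norm (f x) \<le> norm x * C" using fb[of x] by (simp add: mult.commute)
  qed
  then have ap: "blinfun_apply (Blinfun f) = f" by (rule bounded_linear_Blinfun_apply)
  show ?thesis
  proof (rule that[of "Blinfun f"])
    show "norm (Blinfun f) \<le> C" by (rule norm_blinfun_bound) (auto simp: ap fb C)
  qed (simp add: ap f)
qed

lemma self_adjoint_strong_limit:
  fixes X :: "nat \<Rightarrow> 'a::real_inner \<Rightarrow>\<^sub>L 'a"
  assumes "\<And>x. (\<lambda>n. blinfun_apply (X n) x) \<longlonglongrightarrow> blinfun_apply L x" "\<And>n. self_adjoint (X n)"
  shows "self_adjoint L"
  unfolding self_adjoint_def
proof (intro allI)
  fix x y
  have "(\<lambda>n. inner (X n x) y) \<longlonglongrightarrow> inner (L x) y" by (intro tendsto_intros assms)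
  moreover have "(\<lambda>n. inner x (X n y)) \<longlonglongrightarrow> inner x (L y)" by (intro tendsto_intros assms)
  ultimately show "inner (L x) y = inner x (L y)"
    using assms(2) by (simp add: self_adjoint_def LIMSEQ_unique)
qed

lemma commute_strong_limit:
  fixes X :: "nat \<Rightarrow> 'a::real_normed_vector \<Rightarrow>\<^sub>L 'a" and C L :: "'a \<Rightarrow>\<^sub>L 'a"
  assumes "\<And>x. (\<lambda>n. blinfun_apply (X n) x) \<longlonglongrightarrow> L x" "\<And>n. C o\<^sub>L X n = X n o\<^sub>L C"
  shows "C o\<^sub>L L = L o\<^sub>L C"
proof (rule blinfun_eqI)
  fix x
  have c: "C (X n x) = X n (C x)" for n
    using assms(2)[of n] by (metis blinfun_apply_blinfun_compose)
  have "(\<lambda>n. C (X n x)) \<longlonglongrightarrow> C (L x)" by (intro blinfun.tendsto tendsto_const assms)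
  moreover have "(\<lambda>n. X n (C x)) \<longlonglongrightarrow> L (C x)" by (rule assms)
  ultimately show "(C o\<^sub>L L) x = (L o\<^sub>L C) x" by (simp add: c LIMSEQ_unique)
qed

text \<open>The differences are positive of norm at most 1, so the squared norm of their value at x
  is at most the increment of the form at x; these forms increase and are bounded, hence
  Cauchy.\<close>

lemma monotone_strong_limit:
  fixes X :: "nat \<Rightarrow> 'a::{real_inner,complete_space} \<Rightarrow>\<^sub>L 'a"
  assumes pos: "\<And>n. pos_op (X n)"
    and mono: "\<And>n x. inner (X n x) x \<le> inner (X (Suc n) x) x"
    and bound: "\<And>n x. inner (X n x) x \<le> (norm x)\<^sup>2"
  obtains L :: "'a \<Rightarrow>\<^sub>L 'a" where "\<And>x. (\<lambda>n. X n x) \<longlonglongrightarrow> L x" "self_adjoint L"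
proof -
  have sa: "self_adjoint (X n)" for n using pos by (simp add: pos_op_def)
  have inc: "m \<le> n \<Longrightarrow> inner (X m x) x \<le> inner (X n x) x" for m n x
    using lift_Suc_mono_le[of "\<lambda>n. inner (X n x) x"] mono by blast
  have pd: "pos_op (X n - X m)" if "m \<le> n" for m n
    using inc[OF that] sa by (auto simp: pos_op_def self_adjoint_diff blinfun.bilinear_simps inner_diff_left)
  have nd: "norm (X n - X m) \<le> 1" if "m \<le> n" for m n
  proof (rule self_adjoint_norm_le)
    show "self_adjoint (X n - X m)" by (simp add: sa self_adjoint_diff)
    fix x
    have "0 \<le> inner (X m x) x" using pos by (simp add: pos_op_def)
    then show "\<bar>inner ((X n - X m) x) x\<bar> \<le> 1 * (norm x)\<^sup>2"
      using inc[OF that, of x] bound[of n x] by (simp add: blinfun.bilinear_simps inner_diff_left)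
  qed simp
  have conv: "convergent (\<lambda>n. X n x)" for x
  proof (rule Cauchy_convergent, rule metric_CauchyI)
    fix e :: real assume e: "e > 0"
    have "incseq (\<lambda>n. inner (X n x) x)" using inc by (simp add: incseq_def)
    then obtain l where "(\<lambda>n. inner (X n x) x) \<longlonglongrightarrow> l"
      using incseq_convergent[of "\<lambda>n. inner (X n x) x" "(norm x)\<^sup>2"] bound by blast
    then have "convergent (\<lambda>n. inner (X n x) x)" by (rule convergentI)
    then have "Cauchy (\<lambda>n. inner (X n x) x)" by (rule convergent_Cauchy)
    then obtain M where M: "\<And>m n. m \<ge> M \<Longrightarrow> n \<ge> M \<Longrightarrow> dist (inner (X m x) x) (inner (X n x) x) < e\<^sup>2"
      using e metric_CauchyD[of "\<lambda>n. inner (X n x) x" "e\<^sup>2"] by auto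
    have lt: "dist (X m x) (X n x) < e" if "M \<le> m" "m \<le> n" for m n
    proof -
      have "(norm ((X n - X m) x))\<^sup>2 \<le> 1 * inner ((X n - X m) x) x"
        by (intro pos_op_norm_sq_le pd nd that)
      also have "\<dots> < e\<^sup>2"
        using M[of n m] that by (simp add: dist_real_def blinfun.bilinear_simps inner_diff_left)
      finally show ?thesis
        using e by (simp add: blinfun.bilinear_simps dist_norm norm_minus_commute power2_less_imp_less)
    qed
    show "\<exists>M. \<forall>m\<ge>M. \<forall>n\<ge>M. dist (X m x) (X n x) < e"
    proof (intro exI[of _ M] allI impI)
      fix m n assume "M \<le> m" "M \<le> n"
      then show "dist (X m x) (X n x) < e"
        using lt[of m n] lt[of n m] by (cases "m \<le> n") (auto simp: dist_commute)
    qed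
  qed
  have "norm (X n) \<le> 1" for n
  proof (rule self_adjoint_norm_le[OF sa])
    show "\<bar>inner (X n x) x\<bar> \<le> 1 * (norm x)\<^sup>2" for x
      using pos[of n] bound[of n x] by (simp add: pos_op_def)
  qed simp
  from strong_limit_exists[OF conv this] obtain L :: "'a \<Rightarrow>\<^sub>L 'a" where L: "\<And>x. (\<lambda>n. X n x) \<longlonglongrightarrow> L x" by blast
  show ?thesis by (rule that[OF L self_adjoint_strong_limit[OF L sa]])
qed

section \<open>Square roots and kernel projections\<close>

text \<open>The square root of 1 - R is 1 - X, where X is the fixed point of X = (R + X^2) / 2.
  The iteration started at 0 is dominated by the same iteration for the scalar R = 1.\<close>

lemma sqrt_op_exists:
  fixes R :: "'a::{real_inner,complete_space} \<Rightarrow>\<^sub>L 'a"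
  assumes sa: "self_adjoint R" and R: "norm R \<le> 1"
  obtains S :: "'a \<Rightarrow>\<^sub>L 'a" where "pos_op S" "S o\<^sub>L S = id_blinfun - R" "\<And>C. C o\<^sub>L R = R o\<^sub>L C \<Longrightarrow> C o\<^sub>L S = S o\<^sub>L C"
proof -
  define X where "X = rec_nat (0 :: 'a \<Rightarrow>\<^sub>L 'a) (\<lambda>_ Y. (1/2) *\<^sub>R (R + (Y o\<^sub>L Y)))"
  define s where "s = rec_nat (0 :: real) (\<lambda>_ y. (1/2) * (1 + y * y))"
  have X0: "X 0 = 0" and XS: "X (Suc n) = (1/2) *\<^sub>R (R + (X n o\<^sub>L X n))" for n by (simp_all add: X_def)
  have s0: "s 0 = 0" and sS: "s (Suc n) = (1/2) * (1 + s n * s n)" for n by (simp_all add: s_def)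
  have s01: "0 \<le> s n \<and> s n \<le> 1" for n
  proof (induction n)
    case (Suc n)
    then have "s n * s n \<le> 1" by (simp add: mult_le_one)
    then show ?case using Suc by (simp add: sS)
  qed (simp add: s0)
  \<comment> \<open>The increment is half of (1 - s n)^2.\<close>
  have sinc: "s n \<le> s (Suc n)" for n
  proof -
    have "0 \<le> (1 - s n)\<^sup>2" by simp
    then show ?thesis by (simp add: sS power2_eq_square algebra_simps)
  qed
  have nX: "norm (X n) \<le> s n" for n
  proof (induction n)
    case (Suc n)
    have "norm (R + (X n o\<^sub>L X n)) \<le> norm R + norm (X n) * norm (X n)"
      by (intro order_trans[OF norm_triangle_ineq] add_left_mono norm_blinfun_compose)
    also have "\<dots> \<le> 1 + s n * s n" using Suc R s01[of n] by (intro add_mono mult_mono) auto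
    finally show ?case by (simp add: XS sS)
  qed (simp add: X0 s0)
  have dX: "norm (X (Suc n) - X n) \<le> s (Suc n) - s n" for n
  proof (induction n)
    case 0
    then show ?case using R by (simp add: X0 XS s0 sS)
  next
    case (Suc n)
    \<comment> \<open>Writing Y^2 - Z^2 as Y (Y - Z) + (Y - Z) Z does not require the iterates to
      commute, and the scalar increments obey the same formula.\<close>
    have split: "X (Suc (Suc n)) - X (Suc n) =
        (1/2) *\<^sub>R ((X (Suc n) o\<^sub>L (X (Suc n) - X n)) + ((X (Suc n) - X n) o\<^sub>L X n))"
      unfolding XS[of "Suc n"] XS[of n]
      by (rule blinfun_eqI) (simp add: blinfun.bilinear_simps algebra_simps)
    have "norm ((X (Suc n) o\<^sub>L (X (Suc n) - X n)) + ((X (Suc n) - X n) o\<^sub>L X n)) \<le>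
        norm (X (Suc n)) * norm (X (Suc n) - X n) + norm (X (Suc n) - X n) * norm (X n)"
      by (intro order_trans[OF norm_triangle_ineq] add_mono norm_blinfun_compose)
    also have "\<dots> \<le> s (Suc n) * (s (Suc n) - s n) + (s (Suc n) - s n) * s n"
      using s01 sinc[of n] by (intro add_mono mult_mono nX Suc) auto
    finally have "norm (X (Suc (Suc n)) - X (Suc n)) \<le>
        (1/2) * (s (Suc n) * (s (Suc n) - s n) + (s (Suc n) - s n) * s n)"
      by (simp add: split)
    also have "\<dots> = s (Suc (Suc n)) - s (Suc n)"
      by (simp add: sS[of "Suc n"] sS[of n] algebra_simps)
    finally show ?case .
  qed
  have dXm: "norm (X n - X m) \<le> s n - s m" if "m \<le> n" for m n
    using that
  proof (induction n rule: dec_induct)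
    case (step n)
    have "norm (X (Suc n) - X m) \<le> norm (X (Suc n) - X n) + norm (X n - X m)"
      by (rule order_trans[OF _ norm_triangle_ineq]) simp
    then show ?case using step dX[of n] by simp
  qed simp
  have "incseq s" using sinc by (rule incseq_SucI)
  then obtain l where "s \<longlonglongrightarrow> l" using incseq_convergent[of s 1] s01 by blast
  then have "convergent s" by (rule convergentI)
  then have cs: "Cauchy s" by (rule convergent_Cauchy)
  have conv: "convergent (\<lambda>n. X n x)" for x
  proof (rule Cauchy_convergent, rule metric_CauchyI)
    fix e :: real assume e: "e > 0"
    define r where "r = e / (norm x + 1)"
    have nx: "norm x + 1 > 0" using norm_ge_zero[of x] by linarith
    have r: "r > 0" using e nx by (simp add: r_def)
    then obtain M where M: "\<And>m n. m \<ge> M \<Longrightarrow> n \<ge> M \<Longrightarrow> dist (s m) (s n) < r"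
      using metric_CauchyD[OF cs r] by auto
    have lt: "dist (X m x) (X n x) < e" if "M \<le> m" "m \<le> n" for m n
    proof -
      have "dist (X m x) (X n x) = norm ((X n - X m) x)"
        by (simp add: blinfun.bilinear_simps dist_norm norm_minus_commute)
      also have "\<dots> \<le> (s n - s m) * norm x"
        by (intro order_trans[OF norm_blinfun] mult_right_mono dXm that) auto
      also have "\<dots> \<le> r * norm x"
        using M[of n m] that by (intro mult_right_mono) (auto simp: dist_real_def)
      also have "\<dots> < r * (norm x + 1)" using r by simp
      also have "\<dots> = e" using nx by (simp add: r_def)
      finally show ?thesis .
    qed
    show "\<exists>M. \<forall>m\<ge>M. \<forall>n\<ge>M. dist (X m x) (X n x) < e"
    proof (intro exI[of _ M] allI impI)
      fix m n assume "M \<le> m" "M \<le> n"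
      then show "dist (X m x) (X n x) < e"
        using lt[of m n] lt[of n m] by (cases "m \<le> n") (auto simp: dist_commute)
    qed
  qed
  have nX1: "norm (X n) \<le> 1" for n using nX[of n] s01[of n] by linarith
  from strong_limit_exists[OF conv nX1] obtain L :: "'a \<Rightarrow>\<^sub>L 'a" where L: "\<And>x. (\<lambda>n. X n x) \<longlonglongrightarrow> L x" and nL: "norm L \<le> 1" by blast
  have saX: "self_adjoint (X n)" for n
    by (induction n) (auto simp: X0 XS intro!: self_adjoint_scaleR self_adjoint_add sa self_adjoint_square)
  have saL: "self_adjoint L" by (rule self_adjoint_strong_limit[OF L saX])
  \<comment> \<open>Squaring passes to the strong limit because the iterates are uniformly bounded:
    X n (X n x - L x) tends to 0.\<close>
  have LL: "(\<lambda>n. X n (X n x)) \<longlonglongrightarrow> L (L x)" for x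
  proof -
    have "(\<lambda>n. X n (X n x - L x)) \<longlonglongrightarrow> 0"
    proof (rule Lim_null_comparison)
      show "\<forall>\<^sub>F n in sequentially. norm (X n (X n x - L x)) \<le> norm (X n x - L x)"
      proof (intro always_eventually allI)
        fix n
        have "norm (X n (X n x - L x)) \<le> 1 * norm (X n x - L x)"
          by (intro order_trans[OF norm_blinfun] mult_right_mono nX1) auto
        then show "norm (X n (X n x - L x)) \<le> norm (X n x - L x)" by simp
      qed
      show "(\<lambda>n. norm (X n x - L x)) \<longlonglongrightarrow> 0"
        using L[of x] by (simp add: LIM_zero tendsto_norm_zero)
    qed
    from tendsto_add[OF this L[of "L x"]] show ?thesis
      by (simp add: blinfun.bilinear_simps)
  qed
  have fix_eq: "L = (1/2) *\<^sub>R (R + (L o\<^sub>L L))"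
  proof (rule blinfun_eqI)
    fix x
    have "(\<lambda>n. X (Suc n) x) \<longlonglongrightarrow> (1/2) *\<^sub>R (R x + L (L x))"
      unfolding XS by (simp add: blinfun.bilinear_simps) (intro tendsto_intros LL)
    moreover have "(\<lambda>n. X (Suc n) x) \<longlonglongrightarrow> L x" using L by (rule LIMSEQ_Suc)
    ultimately show "L x = ((1/2) *\<^sub>R (R + (L o\<^sub>L L))) x"
      by (simp add: LIMSEQ_unique blinfun.bilinear_simps)
  qed
  have fix_x: "2 *\<^sub>R L x = R x + L (L x)" for x
    by (subst fix_eq) (simp add: blinfun.bilinear_simps)
  show ?thesis
  proof (rule that[of "id_blinfun - L"])
    have "inner (L x) x \<le> inner x x" for x
    proof -
      have "inner (L x) x \<le> norm (L x) * norm x" by (rule norm_cauchy_schwarz)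
      also have "\<dots> \<le> (1 * norm x) * norm x"
        by (intro mult_right_mono order_trans[OF norm_blinfun] nL) auto
      finally show ?thesis by (simp add: power2_norm_eq_inner[symmetric] power2_eq_square)
    qed
    then show "pos_op (id_blinfun - L)"
      by (simp add: pos_op_def self_adjoint_diff saL blinfun.bilinear_simps inner_diff_left)
    show "(id_blinfun - L) o\<^sub>L (id_blinfun - L) = id_blinfun - R"
    proof (rule blinfun_eqI)
      fix x
      have "R x = 2 *\<^sub>R L x - L (L x)" by (simp add: fix_x)
      then show "((id_blinfun - L) o\<^sub>L (id_blinfun - L)) x = (id_blinfun - R) x"
        by (simp add: blinfun.bilinear_simps scaleR_2)
    qed
    fix C assume C: "C o\<^sub>L R = R o\<^sub>L C"
    have "C o\<^sub>L X n = X n o\<^sub>L C" for n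
    proof (induction n)
      case 0
      then show ?case by (simp add: X0)
    next
      case (Suc n)
      have 1: "C (X n x) = X n (C x)" and 2: "C (R x) = R (C x)" for x
        using Suc C by (metis blinfun_apply_blinfun_compose)+
      show ?case
        by (rule blinfun_eqI) (simp add: XS blinfun.bilinear_simps 1 2)
    qed
    from commute_strong_limit[OF L this] have "C (L x) = L (C x)" for x
      by (metis blinfun_apply_blinfun_compose)
    then show "C o\<^sub>L (id_blinfun - L) = (id_blinfun - L) o\<^sub>L C"
      by (intro blinfun_eqI) (simp add: blinfun.bilinear_simps)
  qed
qed

text \<open>With c = norm S the operator S^2 / c^2 is 1 - Q for a contraction Q, so it has a square
  root; c times that root is the absolute value of S.\<close>

lemma abs_op_exists:
  fixes S :: "'a::{real_inner,complete_space} \<Rightarrow>\<^sub>L 'a"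
  assumes sa: "self_adjoint S"
  obtains R :: "'a \<Rightarrow>\<^sub>L 'a" where "pos_op R" "R o\<^sub>L R = S o\<^sub>L S" "\<And>C. C o\<^sub>L S = S o\<^sub>L C \<Longrightarrow> C o\<^sub>L R = R o\<^sub>L C"
proof (cases "S = 0")
  case True
  show ?thesis by (rule that[of 0]) (auto simp: True pos_op_def)
next
  case False
  define c where "c = norm S"
  have c: "c > 0" using False by (simp add: c_def)
  define Q where "Q = id_blinfun - (1 / c\<^sup>2) *\<^sub>R (S o\<^sub>L S)"
  have saQ: "self_adjoint Q" unfolding Q_def
    by (intro self_adjoint_diff self_adjoint_scaleR self_adjoint_square sa) simp
  have "norm Q \<le> 1"
  proof (rule self_adjoint_norm_le[OF saQ])
    fix x
    have "norm (S x) \<le> c * norm x" unfolding c_def by (rule norm_blinfun)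
    then have "(norm (S x))\<^sup>2 \<le> (c * norm x)\<^sup>2" by (intro power_mono) auto
    then have "(1 / c\<^sup>2) * (norm (S x))\<^sup>2 \<le> (norm x)\<^sup>2"
      using c by (simp add: field_simps)
    moreover have "inner (Q x) x = (norm x)\<^sup>2 - (1 / c\<^sup>2) * (norm (S x))\<^sup>2"
      using self_adjointD[OF sa, of "S x" x]
      by (simp add: Q_def blinfun.bilinear_simps inner_diff_left power2_norm_eq_inner)
    moreover have "0 \<le> (1 / c\<^sup>2) * (norm (S x))\<^sup>2" using c by simp
    ultimately show "\<bar>inner (Q x) x\<bar> \<le> 1 * (norm x)\<^sup>2" by linarith
  qed simp
  from sqrt_op_exists[OF saQ this] obtain T :: "'a \<Rightarrow>\<^sub>L 'a" where T: "pos_op T" "T o\<^sub>L T = id_blinfun - Q"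
    "\<And>C. C o\<^sub>L Q = Q o\<^sub>L C \<Longrightarrow> C o\<^sub>L T = T o\<^sub>L C" by blast
  show ?thesis
  proof (rule that[of "c *\<^sub>R T"])
    show "pos_op (c *\<^sub>R T)"
      using T(1) c by (auto simp: pos_op_def self_adjoint_scaleR blinfun.bilinear_simps)
    show "c *\<^sub>R T o\<^sub>L c *\<^sub>R T = S o\<^sub>L S"
    proof (rule blinfun_eqI)
      fix x
      have "T (T x) = (1 / c\<^sup>2) *\<^sub>R S (S x)"
        using arg_cong[OF T(2), of "\<lambda>f. blinfun_apply f x"] by (simp add: Q_def blinfun.bilinear_simps)
      then show "(c *\<^sub>R T o\<^sub>L c *\<^sub>R T) x = (S o\<^sub>L S) x"
        using c by (simp add: blinfun.bilinear_simps power2_eq_square)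
    qed
    fix C assume "C o\<^sub>L S = S o\<^sub>L C"
    then have "C (S x) = S (C x)" for x by (metis blinfun_apply_blinfun_compose)
    then have "C o\<^sub>L Q = Q o\<^sub>L C"
      by (intro blinfun_eqI) (simp add: Q_def blinfun.bilinear_simps)
    from T(3)[OF this] have "C (T x) = T (C x)" for x by (metis blinfun_apply_blinfun_compose)
    then show "C o\<^sub>L c *\<^sub>R T = c *\<^sub>R T o\<^sub>L C"
      by (intro blinfun_eqI) (simp add: blinfun.bilinear_simps)
  qed
qed

text \<open>Repeated squaring of a positive contraction Y converges strongly to the projection onto the
  eigenspace of Y for the eigenvalue 1.\<close>

lemma kernel_projection_exists:
  fixes N :: "'a::{real_inner,complete_space} \<Rightarrow>\<^sub>L 'a"
  assumes sa: "self_adjoint N"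
  obtains E :: "'a \<Rightarrow>\<^sub>L 'a" where "self_adjoint E" "E o\<^sub>L E = E" "\<And>x. E x = x \<longleftrightarrow> N x = 0"
    "\<And>C. C o\<^sub>L N = N o\<^sub>L C \<Longrightarrow> C o\<^sub>L E = E o\<^sub>L C"
proof -
  \<comment> \<open>The summand 1 keeps c positive when N = 0. The start value 1 - N^2/c^2 below is
    a positive contraction whose fixed vectors form the kernel of N.\<close>
  define c where "c = norm N + 1"
  have c: "c > 0" unfolding c_def by (simp add: add_nonneg_pos)
  define Y where "Y = rec_nat (id_blinfun - (1 / c\<^sup>2) *\<^sub>R (N o\<^sub>L N)) (\<lambda>_ Z. Z o\<^sub>L Z)"
  have Y0: "Y 0 = id_blinfun - (1 / c\<^sup>2) *\<^sub>R (N o\<^sub>L N)" and YS: "Y (Suc n) = Y n o\<^sub>L Y n" for n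
    by (simp_all add: Y_def)
  have saY: "self_adjoint (Y n)" for n
    by (induction n) (auto simp: Y0 YS intro!: self_adjoint_diff self_adjoint_scaleR self_adjoint_square sa)
  have form0: "inner (Y 0 x) x = (norm x)\<^sup>2 - (1 / c\<^sup>2) * (norm (N x))\<^sup>2" for x
    using self_adjointD[OF sa, of "N x" x]
    by (simp add: Y0 blinfun.bilinear_simps inner_diff_left power2_norm_eq_inner)
  have formS: "inner (Y (Suc n) x) x = (norm (Y n x))\<^sup>2" for n x
    using self_adjointD[OF saY, of n "Y n x" x] by (simp add: YS power2_norm_eq_inner)
  have bnd: "0 \<le> inner (Y n x) x \<and> inner (Y n x) x \<le> (norm x)\<^sup>2" for n x
  proof (induction n arbitrary: x)
    case 0
    have "norm (N x) \<le> c * norm x"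
      by (rule order_trans[OF norm_blinfun]) (auto simp: c_def intro: mult_right_mono)
    then have "(norm (N x))\<^sup>2 \<le> (c * norm x)\<^sup>2" by (intro power_mono) auto
    then have "(1 / c\<^sup>2) * (norm (N x))\<^sup>2 \<le> (norm x)\<^sup>2"
      using c by (simp add: field_simps)
    then show ?case unfolding form0 using c by auto
  next
    case (Suc n)
    have "norm (Y n) \<le> 1"
    proof (rule self_adjoint_norm_le[OF saY])
      show "\<bar>inner (Y n x) x\<bar> \<le> 1 * (norm x)\<^sup>2" for x using Suc[of x] by simp
    qed simp
    then have "norm (Y n x) \<le> 1 * norm x"
      by (intro order_trans[OF norm_blinfun] mult_right_mono) auto
    then show ?case unfolding formS by (simp add: power_mono)
  qed
  have pos: "pos_op (Y n)" for n using saY bnd by (simp add: pos_op_def)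
  have nY: "norm (Y n) \<le> 1" for n
  proof (rule self_adjoint_norm_le[OF saY])
    show "\<bar>inner (Y n x) x\<bar> \<le> 1 * (norm x)\<^sup>2" for x using bnd[of n x] by simp
  qed simp
  have dec: "inner (Y (Suc n) x) x \<le> inner (Y n x) x" for n x
    using pos_op_norm_sq_le[OF pos nY, of n x] by (simp add: formS)
  have "pos_op (id_blinfun - Y n)" for n
    using bnd by (auto simp: pos_op_def self_adjoint_diff saY blinfun.bilinear_simps inner_diff_left
        power2_norm_eq_inner)
  then obtain L :: "'a \<Rightarrow>\<^sub>L 'a" where L: "\<And>x. (\<lambda>n. (id_blinfun - Y n) x) \<longlonglongrightarrow> L x"
    by (rule monotone_strong_limit[of "\<lambda>n. id_blinfun - Y n"])
       (use dec bnd in \<open>auto simp: blinfun.bilinear_simps inner_diff_left power2_norm_eq_inner\<close>)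
  define E where "E = id_blinfun - L"
  have E: "(\<lambda>n. Y n x) \<longlonglongrightarrow> E x" for x
    using tendsto_diff[OF tendsto_const[of x] L[of x]] by (simp add: E_def blinfun.bilinear_simps)
  have saE: "self_adjoint E" by (rule self_adjoint_strong_limit[OF E saY])
  \<comment> \<open>The form of each square is the squared norm of the previous iterate; in the
    limit this reads norm (E x)^2 = \<open>inner (E x) x\<close>.\<close>
  have EE: "E o\<^sub>L E = E"
  proof (rule self_adjoint_eqI)
    fix x
    have "(\<lambda>n. (norm (Y n x))\<^sup>2) \<longlonglongrightarrow> (norm (E x))\<^sup>2" by (intro tendsto_intros E)
    moreover have "(\<lambda>n. inner (Y (Suc n) x) x) \<longlonglongrightarrow> inner (E x) x"
      by (rule tendsto_inner[OF LIMSEQ_Suc[OF E] tendsto_const])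
    ultimately have "(norm (E x))\<^sup>2 = inner (E x) x" by (simp add: formS LIMSEQ_unique)
    then show "inner ((E o\<^sub>L E) x) x = inner (E x) x"
      using self_adjointD[OF saE, of "E x" x] by (simp add: power2_norm_eq_inner)
  qed (simp_all add: saE self_adjoint_square)
  show ?thesis
  proof (rule that[of E])
    fix x
    show "E x = x \<longleftrightarrow> N x = 0"
    proof
      assume Ex: "E x = x"
      \<comment> \<open>The forms decrease from the start value to norm x squared, so already the
        first one has lost nothing, which forces N x = 0.\<close>
      have "decseq (\<lambda>n. inner (Y n x) x)" by (rule decseq_SucI) (rule dec)
      moreover have "(\<lambda>n. inner (Y n x) x) \<longlonglongrightarrow> inner (E x) x" by (intro tendsto_intros E)
      ultimately have "inner (E x) x \<le> inner (Y 0 x) x" by (rule decseq_ge)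
      then have "(1 / c\<^sup>2) * (norm (N x))\<^sup>2 \<le> 0"
        unfolding form0 by (simp add: Ex power2_norm_eq_inner)
      then show "N x = 0" using c by (simp add: mult_le_0_iff divide_le_0_iff)
    next
      assume "N x = 0"
      have "Y n x = x" for n
        by (induction n) (simp_all add: Y0 YS \<open>N x = 0\<close> blinfun.bilinear_simps)
      then show "E x = x" using E[of x] by (simp add: LIMSEQ_const_iff)
    qed
  next
    fix C assume C: "C o\<^sub>L N = N o\<^sub>L C"
    have "C o\<^sub>L Y n = Y n o\<^sub>L C" for n
    proof (induction n)
      case 0
      have "C (N x) = N (C x)" for x using C by (metis blinfun_apply_blinfun_compose)
      then show ?case by (intro blinfun_eqI) (simp add: Y0 blinfun.bilinear_simps)
    next
      case (Suc n)
      then have "C (Y n x) = Y n (C x)" for x by (metis blinfun_apply_blinfun_compose)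
      then show ?case by (intro blinfun_eqI) (simp add: YS)
    qed
    then show "C o\<^sub>L E = E o\<^sub>L C" by (rule commute_strong_limit[OF E])
  qed (simp_all add: saE EE)
qed

text \<open>The range of the projection below is the kernel of the positive part of S. Its orthogonal
  complement lies in the kernel of the negative part, since the product of the two parts vanishes.\<close>

lemma nonpositive_projection_exists:
  fixes S :: "'a::{real_inner,complete_space} \<Rightarrow>\<^sub>L 'a"
  assumes sa: "self_adjoint S"
  obtains E :: "'a \<Rightarrow>\<^sub>L 'a" where "self_adjoint E" "E o\<^sub>L E = E"
    "\<And>x. E x = x \<Longrightarrow> inner (S x) x \<le> 0"
    "\<And>x. E x = 0 \<Longrightarrow> x \<noteq> 0 \<Longrightarrow> 0 < inner (S x) x"
    "\<And>C. C o\<^sub>L S = S o\<^sub>L C \<Longrightarrow> C o\<^sub>L E = E o\<^sub>L C"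
proof -
  from abs_op_exists[OF sa] obtain R :: "'a \<Rightarrow>\<^sub>L 'a" where R: "pos_op R" "R o\<^sub>L R = S o\<^sub>L S"
    "\<And>C. C o\<^sub>L S = S o\<^sub>L C \<Longrightarrow> C o\<^sub>L R = R o\<^sub>L C" by blast
  have saR: "self_adjoint R" using R(1) by (simp add: pos_op_def)
  \<comment> \<open>R + S is twice the positive part of S, R being the absolute value.\<close>
  have saRS: "self_adjoint (R + S)" by (intro self_adjoint_add saR sa)
  from kernel_projection_exists[OF saRS] obtain E :: "'a \<Rightarrow>\<^sub>L 'a" where E: "self_adjoint E" "E o\<^sub>L E = E"
    "\<And>x. E x = x \<longleftrightarrow> (R + S) x = 0"
    "\<And>C. C o\<^sub>L (R + S) = (R + S) o\<^sub>L C \<Longrightarrow> C o\<^sub>L E = E o\<^sub>L C" by blast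
  have SR: "S (R x) = R (S x)" for x
    using R(3)[of S] by (metis blinfun_apply_blinfun_compose)
  have RR: "R (R x) = S (S x)" for x
    using R(2) by (metis blinfun_apply_blinfun_compose)
  show ?thesis
  proof (rule that[of E])
    fix x assume "E x = x"
    then have "S x = - R x"
      using E(3)[of x] by (simp add: blinfun.bilinear_simps eq_neg_iff_add_eq_0 add.commute)
    then show "inner (S x) x \<le> 0" using R(1) by (simp add: pos_op_def)
  next
    fix x assume Ex: "E x = 0" and x: "x \<noteq> 0"
    \<comment> \<open>Since (R + S)(R - S) = 0, the range of R - S lies in that of E, hence is
      orthogonal to x. So S and R agree at x.\<close>
    have "inner x ((R - S) y) = 0" for y
    proof -
      have "(R + S) ((R - S) y) = 0" by (simp add: blinfun.bilinear_simps SR RR)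
      then have "E ((R - S) y) = (R - S) y" by (simp add: E(3))
      then show ?thesis using self_adjointD[OF E(1), of x "(R - S) y"] Ex by simp
    qed
    then have "inner ((R - S) x) ((R - S) x) = 0"
      using self_adjointD[OF self_adjoint_diff[OF saR sa]] by simp
    then have SRx: "S x = R x" by (simp add: blinfun.bilinear_simps)
    show "0 < inner (S x) x"
    proof (rule ccontr)
      assume "\<not> ?thesis"
      moreover have "0 \<le> inner (R x) x" using R(1) by (simp add: pos_op_def)
      ultimately have "inner (R x) x = 0" by (simp add: SRx)
      then have "R x = 0" using pos_op_eq_0[OF R(1)] by simp
      then have "E x = x" using SRx by (simp add: E(3) blinfun.bilinear_simps)
      then show False using Ex x by simp
    qed
  next
    fix C assume C: "C o\<^sub>L S = S o\<^sub>L C"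
    have "C (S x) = S (C x)" "C (R x) = R (C x)" for x
      using C R(3)[OF C] by (metis blinfun_apply_blinfun_compose)+
    then have "C o\<^sub>L (R + S) = (R + S) o\<^sub>L C"
      by (intro blinfun_eqI) (simp add: blinfun.bilinear_simps)
    then show "C o\<^sub>L E = E o\<^sub>L C" by (rule E(4))
  qed (rule E)+
qed

section \<open>The spectral theorem\<close>

text \<open>A resolution of the identity: \<open>E l\<close> stands for the projection of the
  half-line up to and including l. The weak inequality in \<open>below\<close> against the strict
  one in \<open>above\<close> yields right continuity, and \<open>comm\<close> makes the projections
  commute with T and with each other.\<close>

locale spectral_family =
  fixes T :: "'a::{real_inner,complete_space} \<Rightarrow>\<^sub>L 'a" and E :: "real \<Rightarrow> 'a \<Rightarrow>\<^sub>L 'a"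
  assumes saT: "self_adjoint T"
    and saE: "self_adjoint (E l)" and idem: "E l o\<^sub>L E l = E l"
    and comm: "C o\<^sub>L T = T o\<^sub>L C \<Longrightarrow> C o\<^sub>L E l = E l o\<^sub>L C"
    and below: "E l x = x \<Longrightarrow> inner (T x) x \<le> l * (norm x)\<^sup>2"
    and above: "E l x = 0 \<Longrightarrow> x \<noteq> 0 \<Longrightarrow> l * (norm x)\<^sup>2 < inner (T x) x"

lemma spectral_family_exists:
  fixes T :: "'a::{real_inner,complete_space} \<Rightarrow>\<^sub>L 'a"
  assumes sa: "self_adjoint T"
  shows "\<exists>E. spectral_family T E"
proof -
  let ?P = "\<lambda>l E. self_adjoint E \<and> E o\<^sub>L E = E \<and> (\<forall>C. C o\<^sub>L T = T o\<^sub>L C \<longrightarrow> C o\<^sub>L E = E o\<^sub>L C) \<and>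
     (\<forall>x. blinfun_apply E x = x \<longrightarrow> inner (T x) x \<le> l * (norm x)\<^sup>2) \<and>
     (\<forall>x. blinfun_apply E x = 0 \<longrightarrow> x \<noteq> 0 \<longrightarrow> l * (norm x)\<^sup>2 < inner (T x) x)"
  have "\<exists>E. ?P l E" for l
  proof -
    have form: "inner ((T - l *\<^sub>R id_blinfun) x) x = inner (T x) x - l * (norm x)\<^sup>2" for x
      by (simp add: blinfun.bilinear_simps inner_diff_left power2_norm_eq_inner)
    have comm: "C o\<^sub>L (T - l *\<^sub>R id_blinfun) = (T - l *\<^sub>R id_blinfun) o\<^sub>L C" if "C o\<^sub>L T = T o\<^sub>L C" for C
    proof -
      have "C (T x) = T (C x)" for x using that by (metis blinfun_apply_blinfun_compose)
      then show ?thesis by (intro blinfun_eqI) (simp add: blinfun.bilinear_simps)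
    qed
    have "self_adjoint (T - l *\<^sub>R id_blinfun)"
      by (intro self_adjoint_diff self_adjoint_scaleR sa) simp
    from nonpositive_projection_exists[OF this] obtain E where E: "self_adjoint E" "E o\<^sub>L E = E"
      "\<And>x. blinfun_apply E x = x \<Longrightarrow> inner ((T - l *\<^sub>R id_blinfun) x) x \<le> 0"
      "\<And>x. blinfun_apply E x = 0 \<Longrightarrow> x \<noteq> 0 \<Longrightarrow> 0 < inner ((T - l *\<^sub>R id_blinfun) x) x"
      "\<And>C. C o\<^sub>L (T - l *\<^sub>R id_blinfun) = (T - l *\<^sub>R id_blinfun) o\<^sub>L C \<Longrightarrow> C o\<^sub>L E = E o\<^sub>L C"
      by blast
    have "inner (T x) x \<le> l * (norm x)\<^sup>2" if "blinfun_apply E x = x" for x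
      using E(3)[OF that] unfolding form by simp
    moreover have "l * (norm x)\<^sup>2 < inner (T x) x" if "blinfun_apply E x = 0" "x \<noteq> 0" for x
      using E(4)[OF that] unfolding form by simp
    ultimately show ?thesis
      using E(1,2) E(5)[OF comm] by blast
  qed
  then obtain E where "\<And>l. ?P l (E l)" by metis
  then show ?thesis
    using sa by (intro exI[of _ E], unfold_locales) blast+
qed

text \<open>Half-lines are stable under intersection, so Dynkin's lemma reduces unions to disjoint
  ones, where countable additivity is available.\<close>

lemma borel_real_induct [consumes 1, case_names atMost empty compl union]:
  assumes D: "D \<in> sets (borel :: real measure)"
    and atMost: "\<And>a. P {..a}"
    and empty: "P {}"
    and compl: "\<And>D. D \<in> sets borel \<Longrightarrow> P D \<Longrightarrow> P (- D)"
    and union: "\<And>F. disjoint_family F \<Longrightarrow> (\<And>i. F i \<in> sets borel) \<Longrightarrow> (\<And>i::nat. P (F i)) \<Longrightarrow> P (\<Union>i. F i)"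
  shows "P D"
proof -
  let ?G = "range (\<lambda>a::real. {..a})"
  have eq: "sigma_sets UNIV ?G = sets borel"
    by (simp add: borel_eq_atMost)
  have "Int_stable ?G"
    by (rule Int_stableI) (auto intro: range_eqI[of _ _ "min _ _"])
  moreover have "?G \<subseteq> Pow UNIV" by simp
  moreover have "D \<in> sigma_sets UNIV ?G" using D by (simp add: eq)
  ultimately show ?thesis
  proof (induction rule: sigma_sets_induct_disjoint)
    case (basic A)
    then show ?case using atMost by auto
  next
    case empty
    then show ?case by (rule assms(3))
  next
    case (compl A)
    then show ?case using assms(4)[of A] by (simp add: eq Compl_eq_Diff_UNIV)
  next
    case (union A)
    then show ?case using assms(5)[of A] by (auto simp: eq)
  qed
qed

text \<open>On a partition into n + 1 equal steps the bounds telescope to (b - a)(F b - F a)/(n +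
  1). This identifies a quadratic form with a Stieltjes integral by comparing increments
  only.\<close>

lemma const_if_increments_small:
  fixes u F :: "real \<Rightarrow> real"
  assumes inc: "\<And>s t. a \<le> s \<Longrightarrow> s \<le> t \<Longrightarrow> t \<le> b \<Longrightarrow> \<bar>u t - u s\<bar> \<le> (t - s) * (F t - F s)"
    and ab: "a \<le> b"
  shows "u b = u a"
proof -
  have bound: "\<bar>u b - u a\<bar> \<le> ((b - a) * (F b - F a)) / real (Suc n)" for n
  proof -
    define h where "h = (b - a) / real (Suc n)"
    define p where "p i = a + real i * h" for i
    have h: "0 \<le> h" using ab by (simp add: h_def)
    have p0: "p 0 = a" and pn: "p (Suc n) = b" by (simp_all add: p_def h_def field_simps)
    have step: "p (Suc i) - p i = (b - a) / real (Suc n)" for i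
      unfolding h_def[symmetric] by (simp add: p_def algebra_simps)
    have mono: "i \<le> j \<Longrightarrow> p i \<le> p j" for i j
      unfolding p_def using h by (intro add_left_mono mult_right_mono) auto
    have "u b - u a = (\<Sum>i<Suc n. u (p (Suc i)) - u (p i))"
      using sum_lessThan_telescope[of "\<lambda>i. u (p i)" "Suc n"] p0 pn by simp
    also have "\<bar>\<dots>\<bar> \<le> (\<Sum>i<Suc n. \<bar>u (p (Suc i)) - u (p i)\<bar>)" by (rule sum_abs)
    also have "\<dots> \<le> (\<Sum>i<Suc n. (b - a) / real (Suc n) * (F (p (Suc i)) - F (p i)))"
    proof (rule sum_mono)
      fix i assume "i \<in> {..<Suc n}"
      then have "a \<le> p i" "p i \<le> p (Suc i)" "p (Suc i) \<le> b"
        using mono[of 0 i] mono[of i "Suc i"] mono[of "Suc i" "Suc n"] p0 pn by auto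
      from inc[OF this] show "\<bar>u (p (Suc i)) - u (p i)\<bar> \<le> (b - a) / real (Suc n) * (F (p (Suc i)) - F (p i))"
        by (simp add: step)
    qed
    also have "\<dots> = (b - a) / real (Suc n) * (F b - F a)"
      by (simp only: sum_distrib_left[symmetric] sum_lessThan_telescope[of "\<lambda>i. F (p i)"] p0 pn)
    finally show ?thesis by simp
  qed
  have "(\<lambda>n. ((b - a) * (F b - F a)) / real (Suc n)) \<longlonglongrightarrow> 0"
    by (rule LIMSEQ_Suc[OF lim_const_over_n[of "(b - a) * (F b - F a)"]])
  then have "\<bar>u b - u a\<bar> \<le> 0"
    by (rule LIMSEQ_le_const) (use bound in blast)
  then show ?thesis by simp
qed

section \<open>Monotonicity and right continuity of the resolution of the identity\<close>

context spectral_family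
begin

lemma E_idem: "E l (E l x) = E l x"
  using idem by (metis blinfun_apply_blinfun_compose)

lemma T_E: "T (E l x) = E l (T x)"
  using comm[of T l] by (metis blinfun_apply_blinfun_compose)

lemma E_comm: "E l (E m x) = E m (E l x)"
proof -
  have "E l o\<^sub>L T = T o\<^sub>L E l" by (rule blinfun_eqI) (simp add: T_E)
  from comm[OF this, of m] show ?thesis by (metis blinfun_apply_blinfun_compose)
qed

text \<open>A nonzero defect y would lie in the range of \<open>E l\<close> and in the kernel of
  \<open>E m\<close>, so its form would be at most l and more than m times the squared norm.\<close>

lemma E_mono1:
  assumes "l \<le> m"
  shows "E m (E l x) = E l x"
proof (rule ccontr)
  assume *: "\<not> ?thesis"
  define y where "y = E l x - E m (E l x)"
  have y: "y \<noteq> 0" using * by (simp add: y_def)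
  have "E l y = y"
    unfolding y_def blinfun.diff_right E_comm[of l m "E l x"] E_idem ..
  then have 1: "inner (T y) y \<le> l * (norm y)\<^sup>2" by (rule below)
  have "E m y = 0" by (simp add: y_def blinfun.bilinear_simps E_idem)
  then have 2: "m * (norm y)\<^sup>2 < inner (T y) y" using y by (rule above)
  have "l * (norm y)\<^sup>2 \<le> m * (norm y)\<^sup>2" using assms by (intro mult_right_mono) auto
  then show False using 1 2 by simp
qed

lemma E_mono2: "l \<le> m \<Longrightarrow> E l (E m x) = E l x"
  using E_mono1[of l m x] E_comm[of l m x] by simp

lemma E_top:
  assumes "norm T \<le> l"
  shows "E l x = x"
proof (rule ccontr)
  assume *: "\<not> ?thesis"
  define y where "y = x - E l x"
  have "y \<noteq> 0" using * by (simp add: y_def)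
  moreover have "E l y = 0" by (simp add: y_def blinfun.bilinear_simps E_idem)
  ultimately have "l * (norm y)\<^sup>2 < inner (T y) y" using above by blast
  also have "\<dots> \<le> norm (T y) * norm y" by (rule norm_cauchy_schwarz)
  also have "\<dots> \<le> (l * norm y) * norm y"
    by (intro mult_right_mono order_trans[OF norm_blinfun] assms) auto
  finally show False by (simp add: power2_eq_square)
qed

lemma E_bot:
  assumes "l < - norm T"
  shows "E l x = 0"
proof (rule ccontr)
  assume *: "\<not> ?thesis"
  define y where "y = E l x"
  have y: "norm y > 0" using * by (simp add: y_def)
  have "inner (T y) y \<le> l * (norm y)\<^sup>2" by (rule below) (simp add: y_def E_idem)
  moreover have "- inner (T y) y \<le> norm T * (norm y)\<^sup>2"
  proof -
    have "- inner (T y) y \<le> norm (T y) * norm y"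
      using Cauchy_Schwarz_ineq2[of "T y" y] by linarith
    also have "\<dots> \<le> (norm T * norm y) * norm y"
      by (intro mult_right_mono norm_blinfun) auto
    finally show ?thesis by (simp add: power2_eq_square)
  qed
  ultimately have "0 \<le> (l + norm T) * (norm y)\<^sup>2" by (simp add: algebra_simps)
  moreover have "(l + norm T) * (norm y)\<^sup>2 < 0"
    using assms y by (intro mult_neg_pos) auto
  ultimately show False by simp
qed

text \<open>The distribution function of the scalar spectral measure of x.\<close>

definition F :: "'a \<Rightarrow> real \<Rightarrow> real" where
  "F x l = inner (E l x) x"

lemma F_eq: "F x l = (norm (E l x))\<^sup>2"
  unfolding F_def by (rule projection_norm_sq[OF saE idem])

lemma F_diff:
  assumes "l \<le> m"
  shows "F x m - F x l = (norm (E m x - E l x))\<^sup>2"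
proof -
  have "inner (E m x) (E l x) = F x l"
    using self_adjointD[OF saE, of m x "E l x"] E_mono1[OF assms, of x] by (simp add: F_def inner_commute)
  then show ?thesis
    unfolding F_eq power2_norm_eq_inner
    by (simp add: inner_diff_left inner_diff_right inner_commute F_eq power2_norm_eq_inner)
qed

lemma F_mono: "l \<le> m \<Longrightarrow> F x l \<le> F x m"
  using F_diff[of l m x] by (metis diff_ge_0_iff_ge zero_le_power2)

lemma F_le: "F x l \<le> (norm x)\<^sup>2"
  unfolding F_eq by (intro power_mono projection_norm_le[OF saE idem]) auto

text \<open>The jump vector y at l is fixed by all projections to the right of l and killed by
  \<open>E l\<close>. The bounds from the right give a form of at most l times the squared norm,
  which \<open>above\<close> allows only for y = 0.\<close>

lemma F_limit: "(\<lambda>n. F x (l + 1 / real (Suc n))) \<longlonglongrightarrow> F x l"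
proof -
  define e where "e n = l + 1 / real (Suc n)" for n
  have el: "l \<le> e n" for n by (simp add: e_def)
  have edec: "e n \<le> e m" if "m \<le> n" for m n using that by (simp add: e_def frac_le)
  have pos: "pos_op (id_blinfun - E (e n))" for n
    using F_le by (auto simp: pos_op_def self_adjoint_diff saE blinfun.bilinear_simps inner_diff_left
        power2_norm_eq_inner[symmetric] F_def[symmetric])
  have inc: "inner ((id_blinfun - E (e n)) x) x \<le> inner ((id_blinfun - E (e (Suc n))) x) x" for n x
  proof -
    have "F x (e (Suc n)) \<le> F x (e n)" by (rule F_mono[OF edec]) simp
    then show ?thesis by (simp add: blinfun.bilinear_simps inner_diff_left F_def)
  qed
  have bound: "inner ((id_blinfun - E (e n)) x) x \<le> (norm x)\<^sup>2" for n x
  proof -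
    have "0 \<le> F x (e n)" by (simp add: F_eq)
    then show ?thesis
      by (simp add: blinfun.bilinear_simps inner_diff_left F_def power2_norm_eq_inner)
  qed
  from monotone_strong_limit[of "\<lambda>n. id_blinfun - E (e n)", OF pos inc bound]
  obtain L :: "'a \<Rightarrow>\<^sub>L 'a" where L: "\<And>x. (\<lambda>n. (id_blinfun - E (e n)) x) \<longlonglongrightarrow> L x"
    by blast
  define y where "y = (x - L x) - E l x"
  have lim: "(\<lambda>n. E (e n) x) \<longlonglongrightarrow> x - L x"
    using tendsto_diff[OF tendsto_const[of x] L[of x]] by (simp add: blinfun.bilinear_simps)
  have fixed: "E (e n) y = y" for n
  proof -
    have "(\<lambda>k. E (e n) (E (e (k + n)) x)) \<longlonglongrightarrow> E (e n) (x - L x)"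
      by (intro blinfun.tendsto tendsto_const LIMSEQ_ignore_initial_segment lim)
    moreover have "E (e n) (E (e (k + n)) x) = E (e (k + n)) x" for k
      by (rule E_mono1[OF edec]) simp
    ultimately have "E (e n) (x - L x) = x - L x"
      using LIMSEQ_unique LIMSEQ_ignore_initial_segment[OF lim, of n] by simp
    then show ?thesis
      by (simp add: y_def blinfun.diff_right E_mono1[OF el])
  qed
  have "E l y = 0"
  proof -
    have "(\<lambda>k. E l (E (e k) x)) \<longlonglongrightarrow> E l (x - L x)"
      by (intro blinfun.tendsto tendsto_const lim)
    then have "E l (x - L x) = E l x"
      using E_mono2[OF el] by (simp add: LIMSEQ_const_iff)
    then show ?thesis by (simp add: y_def blinfun.bilinear_simps E_idem)
  qed
  have "(\<lambda>n. e n * (norm y)\<^sup>2) \<longlonglongrightarrow> (l + 0) * (norm y)\<^sup>2"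
    unfolding e_def by (intro tendsto_intros LIMSEQ_Suc[OF lim_const_over_n])
  then have "inner (T y) y \<le> (l + 0) * (norm y)\<^sup>2"
    by (rule LIMSEQ_le_const) (use below[OF fixed] in blast)
  then have "y = 0" using above[OF \<open>E l y = 0\<close>] by (metis add_0_right not_le)
  then have "x - L x = E l x" by (simp add: y_def)
  then have "(\<lambda>n. inner (E (e n) x) x) \<longlonglongrightarrow> inner (E l x) x"
    using lim by (intro tendsto_inner tendsto_const) simp
  then show ?thesis by (simp add: F_def e_def)
qed

lemma F_right_cont: "continuous (at_right l) (F x)"
proof -
  have "\<exists>d>0. F x (l + d) - F x l < e" if "e > 0" for e
  proof -
    obtain n where "dist (F x (l + 1 / real (Suc n))) (F x l) < e"
      using metric_LIMSEQ_D[OF F_limit \<open>e > 0\<close>, of x l] by auto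
    then have "F x (l + 1 / real (Suc n)) - F x l < e"
      by (simp only: dist_real_def)
    then show ?thesis by (intro exI[of _ "1 / real (Suc n)"]) simp
  qed
  then show ?thesis
    using F_mono by (subst continuous_at_right_real_increasing) auto
qed

section \<open>From Stieltjes measures to projections of Borel sets\<close>

definition mu :: "'a \<Rightarrow> real measure" where
  "mu x = interval_measure (F x)"

lemma sets_mu [simp, measurable_cong]: "sets (mu x) = sets borel"
  and space_mu [simp]: "space (mu x) = UNIV"
  by (simp_all add: mu_def)

lemma emeasure_mu_Ioc: "a \<le> b \<Longrightarrow> emeasure (mu x) {a<..b} = ennreal (F x b - F x a)"
  unfolding mu_def by (rule emeasure_interval_measure_Ioc) (auto simp: F_mono F_right_cont)

lemma emeasure_mu_atMost: "emeasure (mu x) {..a} = ennreal (F x a)"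
proof -
  define A where "A n = {- real n<..a}" for n
  have "(\<lambda>n. emeasure (mu x) (A n)) \<longlonglongrightarrow> emeasure (mu x) (\<Union>n. A n)"
    by (rule Lim_emeasure_incseq) (auto simp: A_def incseq_def)
  moreover have "(\<Union>n. A n) = {..a}"
  proof -
    have "\<exists>n. - real n < t" for t using reals_Archimedean2[of "- t"] by (auto simp: minus_less_iff)
    then show ?thesis by (auto simp: A_def)
  qed
  moreover have "(\<lambda>n. emeasure (mu x) (A n)) \<longlonglongrightarrow> ennreal (F x a)"
  proof (rule tendsto_eventually)
    obtain N :: nat where N: "norm T + \<bar>a\<bar> < real N" using reals_Archimedean2 by blast
    show "\<forall>\<^sub>F n in sequentially. emeasure (mu x) (A n) = ennreal (F x a)"
      unfolding eventually_sequentially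
    proof (intro exI[of _ N] allI impI)
      fix n assume "N \<le> n"
      then have n: "norm T + \<bar>a\<bar> < real n" using N by linarith
      then have "- real n < - norm T" by linarith
      then have "F x (- real n) = 0" by (simp add: F_def E_bot)
      moreover have "- real n \<le> a" using n norm_ge_zero[of T] by linarith
      ultimately show "emeasure (mu x) (A n) = ennreal (F x a)"
        unfolding A_def by (simp add: emeasure_mu_Ioc)
    qed
  qed
  ultimately show ?thesis by (simp add: LIMSEQ_unique)
qed

lemma emeasure_mu_UNIV: "emeasure (mu x) UNIV = ennreal ((norm x)\<^sup>2)"
proof -
  define A where "A n = {..real n}" for n
  have "(\<lambda>n. emeasure (mu x) (A n)) \<longlonglongrightarrow> emeasure (mu x) (\<Union>n. A n)"
    by (rule Lim_emeasure_incseq) (auto simp: A_def incseq_def)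
  moreover have "(\<Union>n. A n) = UNIV"
    using real_arch_simple by (auto simp: A_def)
  moreover have "(\<lambda>n. emeasure (mu x) (A n)) \<longlonglongrightarrow> ennreal ((norm x)\<^sup>2)"
  proof (rule tendsto_eventually)
    obtain N :: nat where N: "norm T < real N" using reals_Archimedean2 by blast
    have "emeasure (mu x) (A n) = ennreal ((norm x)\<^sup>2)" if "N \<le> n" for n
    proof -
      have "norm T \<le> real n" using N that by linarith
      then show ?thesis by (simp add: A_def emeasure_mu_atMost F_eq E_top)
    qed
    then show "\<forall>\<^sub>F n in sequentially. emeasure (mu x) (A n) = ennreal ((norm x)\<^sup>2)"
      unfolding eventually_sequentially by blast
  qed
  ultimately show ?thesis by (simp add: LIMSEQ_unique)
qed

sublocale mu: finite_measure "mu x" for x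
  by (rule finite_measureI) (simp add: emeasure_mu_UNIV)

lemma measure_mu_atMost: "measure (mu x) {..a} = inner (E a x) x"
  by (simp add: measure_def emeasure_mu_atMost F_eq projection_norm_sq[OF saE idem])

lemma measure_mu_UNIV: "measure (mu x) UNIV = (norm x)\<^sup>2"
  by (simp add: measure_def emeasure_mu_UNIV)

lemma measure_mu_compl: "D \<in> sets borel \<Longrightarrow> measure (mu x) (- D) = (norm x)\<^sup>2 - measure (mu x) D"
  using mu.finite_measure_compl[of D x] by (simp add: measure_mu_UNIV Compl_eq_Diff_UNIV)

lemma measure_mu_le: "measure (mu x) D \<le> (norm x)\<^sup>2"
  using mu.bounded_measure[of x D] by (simp add: measure_mu_UNIV)

text \<open>The partial sums increase and their forms are measures of unions, bounded by the total
  mass. This serves both to construct the operator of a countable disjoint union and to prove strong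
  countable additivity.\<close>

lemma partial_sums_limit:
  assumes dis: "disjoint_family (A :: nat \<Rightarrow> real set)" and A: "\<And>i. A i \<in> sets borel"
    and S: "\<And>i. self_adjoint (S i)" "\<And>i x. inner (blinfun_apply (S i) x) x = measure (mu x) (A i)"
  obtains L :: "'a \<Rightarrow>\<^sub>L 'a" where "\<And>x. (\<lambda>i. S i x) sums L x" "self_adjoint L"
    "\<And>x. inner (L x) x = measure (mu x) (\<Union>i. A i)"
proof -
  have form: "inner ((\<Sum>i<n. S i) x) x = (\<Sum>i<n. measure (mu x) (A i))" for n x
    by (simp add: blinfun.sum_left inner_sum_left S)
  have form': "(\<Sum>i<n. measure (mu x) (A i)) = measure (mu x) (\<Union>i<n. A i)" for n x
    using dis A by (intro mu.finite_measure_finite_Union[symmetric])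
      (auto simp: disjoint_family_on_def)
  have sa: "self_adjoint (\<Sum>i<n. S i)" for n by (intro self_adjoint_sum S)
  have pos: "pos_op (\<Sum>i<n. S i)" for n
    by (auto simp: pos_op_def sa form intro!: sum_nonneg)
  have inc: "inner ((\<Sum>i<n. S i) x) x \<le> inner ((\<Sum>i<Suc n. S i) x) x" for n x
    unfolding form by simp
  have bound: "inner ((\<Sum>i<n. S i) x) x \<le> (norm x)\<^sup>2" for n x
    unfolding form form' by (rule measure_mu_le)
  from monotone_strong_limit[of "\<lambda>n. \<Sum>i<n. S i", OF pos inc bound]
  obtain L :: "'a \<Rightarrow>\<^sub>L 'a" where L: "\<And>x. (\<lambda>n. (\<Sum>i<n. S i) x) \<longlonglongrightarrow> L x" "self_adjoint L"
    by blast
  show ?thesis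
  proof (rule that[OF _ L(2)])
    show "(\<lambda>i. S i x) sums L x" for x
      using L(1)[of x] by (simp add: sums_def blinfun.sum_left)
    fix x
    have "(\<lambda>n. inner ((\<Sum>i<n. S i) x) x) \<longlonglongrightarrow> inner (L x) x"
      by (intro tendsto_inner tendsto_const L(1))
    moreover have "(\<lambda>i. measure (mu x) (A i)) sums measure (mu x) (\<Union>i. A i)"
      using dis A by (intro mu.finite_measure_UNION) auto
    ultimately show "inner (L x) x = measure (mu x) (\<Union>i. A i)"
      by (simp add: form sums_def LIMSEQ_unique)
  qed
qed

text \<open>The sets whose measure is the form of an operator in x contain the half-lines and are
  closed under the operations of Dynkin's lemma, so no complex-valued or polarized measures are
  needed.\<close>

lemma spectral_op_exists:
  "D \<in> sets borel \<Longrightarrow> \<exists>S. self_adjoint S \<and> (\<forall>x. inner (blinfun_apply S x) x = measure (mu x) D)"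
proof (induction rule: borel_real_induct)
  case (atMost a)
  then show ?case by (intro exI[of _ "E a"]) (simp add: saE measure_mu_atMost)
next
  case empty
  then show ?case by (intro exI[of _ 0]) simp
next
  case (compl D)
  then obtain S where "self_adjoint S" "\<And>x. inner (blinfun_apply S x) x = measure (mu x) D" by blast
  then show ?case using compl
    by (intro exI[of _ "id_blinfun - S"])
       (simp add: self_adjoint_diff blinfun.bilinear_simps inner_diff_left measure_mu_compl
         power2_norm_eq_inner)
next
  case (union A)
  then obtain S where "\<And>i. self_adjoint (S i)" "\<And>i x. inner (blinfun_apply (S i) x) x = measure (mu x) (A i)"
    by metis
  from partial_sums_limit[OF union(1,2) this] show ?case by metis
qed

text \<open>The choice is harmless: a self-adjoint operator is determined by its form.\<close>

definition G :: "real set \<Rightarrow> 'a \<Rightarrow>\<^sub>L 'a" where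
  "G D = (SOME S. self_adjoint S \<and> (\<forall>x. inner (blinfun_apply S x) x = measure (mu x) D))"

lemma saG: "D \<in> sets borel \<Longrightarrow> self_adjoint (G D)"
  and form_G: "D \<in> sets borel \<Longrightarrow> inner (G D x) x = measure (mu x) D"
  unfolding G_def using someI_ex[OF spectral_op_exists, of D] by blast+

lemma G_eqI:
  "D \<in> sets borel \<Longrightarrow> self_adjoint S \<Longrightarrow> (\<And>x. inner (blinfun_apply S x) x = measure (mu x) D) \<Longrightarrow> G D = S"
  by (rule self_adjoint_eqI) (auto simp: saG form_G)

lemma G_atMost: "G {..a} = E a"
  by (rule G_eqI) (auto simp: saE measure_mu_atMost)

lemma G_UNIV: "G UNIV = id_blinfun"
  by (rule G_eqI) (auto simp: measure_mu_UNIV power2_norm_eq_inner)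

lemma G_empty: "G {} = 0"
  by (rule G_eqI) auto

lemma G_sums:
  assumes dis: "disjoint_family (A :: nat \<Rightarrow> real set)" and A: "\<And>i. A i \<in> sets borel"
  shows "(\<lambda>i. G (A i) x) sums G (\<Union>i. A i) x"
proof -
  from partial_sums_limit[OF dis A saG[OF A] form_G[OF A]] obtain L :: "'a \<Rightarrow>\<^sub>L 'a" where
    L: "\<And>x. (\<lambda>i. G (A i) x) sums L x" "self_adjoint L" "\<And>x. inner (L x) x = measure (mu x) (\<Union>i. A i)"
    by blast
  have "G (\<Union>i. A i) = L" using A by (intro G_eqI L sets.countable_UN) auto
  then show ?thesis using L(1) by simp
qed

lemma G_diff:
  assumes "D \<in> sets borel" "J \<in> sets borel"
  shows "G (- D \<inter> J) = G J - G (D \<inter> J)"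
proof (rule G_eqI)
  fix x
  have eq: "- D \<inter> J = J - D \<inter> J" by auto
  have "measure (mu x) (J - D \<inter> J) = measure (mu x) J - measure (mu x) (D \<inter> J)"
    using assms by (intro mu.finite_measure_Diff) auto
  then show "inner ((G J - G (D \<inter> J)) x) x = measure (mu x) (- D \<inter> J)"
    using assms by (simp add: blinfun.bilinear_simps inner_diff_left form_G eq)
qed (use assms in \<open>auto intro!: self_adjoint_diff saG\<close>)

text \<open>First of two Dynkin inductions for multiplicativity, one for each factor; monotonicity
  of the resolution of the identity is the base case.\<close>

lemma G_mult_atMost: "D \<in> sets borel \<Longrightarrow> G (D \<inter> {..a}) x = G D (G {..a} x)"
proof (induction arbitrary: x rule: borel_real_induct)
  case (atMost b)
  have "{..b} \<inter> {..a} = {..min b a}" by auto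
  then show ?case
    by (cases "b \<le> a") (simp_all add: G_atMost E_mono1 E_mono2)
next
  case empty
  then show ?case by (simp add: G_empty)
next
  case (compl D)
  have "G (- D \<inter> UNIV) = G UNIV - G (D \<inter> UNIV)" by (rule G_diff) (use compl in auto)
  then have "G (- D) = id_blinfun - G D" by (simp add: G_UNIV)
  then show ?case using compl by (simp add: G_diff blinfun.bilinear_simps)
next
  case (union A)
  have "(\<lambda>i. G (A i \<inter> {..a}) x) sums G (\<Union>i. A i \<inter> {..a}) x"
    by (rule G_sums) (use union in \<open>auto simp: disjoint_family_on_def\<close>)
  moreover have "(\<lambda>i. G (A i) (G {..a} x)) sums G (\<Union>i. A i) (G {..a} x)"
    by (rule G_sums) (use union in auto)
  ultimately show ?case using union(3) by (simp add: sums_unique2)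
qed

lemma G_mult: "D' \<in> sets borel \<Longrightarrow> D \<in> sets borel \<Longrightarrow> G (D \<inter> D') x = G D (G D' x)"
proof (induction arbitrary: x rule: borel_real_induct)
  case (atMost a)
  then show ?case by (simp add: G_mult_atMost)
next
  case empty
  then show ?case by (simp add: G_empty blinfun.bilinear_simps)
next
  case (compl D')
  have "G (- D' \<inter> UNIV) = G UNIV - G (D' \<inter> UNIV)" by (rule G_diff) (use compl in auto)
  then have "G (- D') = id_blinfun - G D'" by (simp add: G_UNIV)
  moreover have "G (D \<inter> - D') = G D - G (D \<inter> D')"
    using G_diff[of D' D] compl by (simp add: Int_commute)
  ultimately show ?case using compl by (simp add: blinfun.bilinear_simps)
next
  case (union A)
  have "(\<lambda>i. G (D \<inter> A i) x) sums G (\<Union>i. D \<inter> A i) x"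
    by (rule G_sums) (use union in \<open>auto simp: disjoint_family_on_def\<close>)
  moreover have "(\<lambda>i. G (A i) x) sums G (\<Union>i. A i) x"
    by (rule G_sums) (use union in auto)
  then have "(\<lambda>i. G D (G (A i) x)) sums G D (G (\<Union>i. A i) x)"
    by (rule bounded_linear.sums[OF blinfun.bounded_linear_right])
  moreover have "G (D \<inter> A i) x = G D (G (A i) x)" for i using union by simp
  ultimately have "G (\<Union>i. D \<inter> A i) x = G D (G (\<Union>i. A i) x)"
    by (simp only: sums_unique2)
  then show ?case by (simp only: Int_UN_distrib)
qed

lemma pvm_scalar_measure_G: "pvm_scalar_measure G x = mu x"
proof -
  have "pvm_scalar_measure G x = measure_of UNIV (sets borel) (emeasure (mu x))"
    unfolding pvm_scalar_measure_def
  proof (rule measure_of_eq)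
    fix D assume "D \<in> sigma_sets UNIV (sets (borel :: real measure))"
    then have "D \<in> sets borel" by (metis sets.sigma_sets_eq space_borel)
    then show "ennreal (inner (G D x) x) = emeasure (mu x) D"
      by (simp add: form_G mu.emeasure_eq_measure)
  qed simp
  also have "\<dots> = mu x"
    using measure_of_of_measure[of "mu x"] by simp
  finally show ?thesis .
qed

lemma G_bounded: "G {t. norm T + 1 < \<bar>t\<bar>} = 0"
proof -
  define c where "c = norm T + 1"
  have "{t. c < \<bar>t\<bar>} = - {-c..c}" by auto
  moreover have "measure (mu x) (- {-c..c}) = 0" for x
  proof -
    have c: "- c \<le> c" "norm T \<le> c" "- c < - norm T"
      using norm_ge_zero[of T] by (simp_all add: c_def)
    have "emeasure (mu x) {-c<..c} = ennreal ((norm x)\<^sup>2)"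
      using emeasure_mu_Ioc[of "-c" c x] c by (simp add: F_def E_top E_bot power2_norm_eq_inner)
    then have "measure (mu x) {-c<..c} = (norm x)\<^sup>2" by (simp add: measure_def)
    moreover have "measure (mu x) {-c<..c} \<le> measure (mu x) {-c..c}"
      by (rule mu.finite_measure_mono) auto
    ultimately show ?thesis
      using measure_mu_compl[of "{-c..c}" x] measure_mu_le[of x "{-c..c}"] by simp
  qed
  ultimately show ?thesis by (intro G_eqI) (auto simp: c_def)
qed

text \<open>From s to t, both the form of T E and the truncated integral grow by an amount between s
  and t times the increment of F. Their difference u is therefore constant by
  \<open>const_if_increments_small\<close>; it is 0 at -c, and at c it compares the two sides of the
  claim.\<close>

lemma mu_integral: "inner (T x) x = integral\<^sup>L (mu x) (\<lambda>t. t)"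
proof -
  define c where "c = norm T + 1"
  have c: "- c \<le> c" "norm T \<le> c" "- c < - norm T"
    using norm_ge_zero[of T] by (simp_all add: c_def)
  define k where "k s = integral\<^sup>L (mu x) (\<lambda>t. t * indicator {-c<..s} t)" for s
  define u where "u s = inner (T (E s x)) x - k s" for s
  have int: "integrable (mu x) (\<lambda>t. t * indicator {s<..r} t)" for s r
    by (rule mu.integrable_const_bound[where B = "max \<bar>s\<bar> \<bar>r\<bar>"]) (auto intro!: AE_I2 split: split_indicator)
  have "u c = u (- c)"
  proof (rule const_if_increments_small[where u = u and F = "F x" and a = "- c" and b = c])
    fix s t assume st: "- c \<le> s" "s \<le> t" "t \<le> c"
    define y where "y = E t x - E s x"
    have y2: "(norm y)\<^sup>2 = F x t - F x s" by (simp add: y_def F_diff[OF st(2)])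
    have Ety: "E t y = y" by (simp add: y_def blinfun.bilinear_simps E_idem E_mono1[OF st(2)])
    have Esy: "E s y = 0" by (simp add: y_def blinfun.bilinear_simps E_idem E_mono2[OF st(2)])
    have up: "inner (T y) y \<le> t * (F x t - F x s)" using below[OF Ety] by (simp add: y2)
    have lo: "s * (F x t - F x s) \<le> inner (T y) y"
      using above[OF Esy] by (cases "y = 0") (auto simp: y2[symmetric] blinfun.bilinear_simps)
    have "inner (T (E t x)) x - inner (T (E s x)) x = inner (T y) x"
      by (simp add: y_def blinfun.bilinear_simps inner_diff_left)
    also have "\<dots> = inner (T y) (E t x - E s x)"
    proof -
      have "inner (T y) x = inner (E t (T y)) x"
        using T_E[of t y] Ety by simp
      also have "\<dots> = inner (T y) (E t x)" by (rule self_adjointD[OF saE])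
      finally have 1: "inner (T y) x = inner (T y) (E t x)" .
      have "inner (T y) (E s x) = inner (E s (T y)) x" by (rule self_adjointD[OF saE, symmetric])
      also have "E s (T y) = 0" using T_E[of s y] Esy by (simp add: blinfun.bilinear_simps)
      finally show ?thesis using 1 by (simp add: inner_diff_right)
    qed
    finally have e1: "inner (T (E t x)) x - inner (T (E s x)) x = inner (T y) y" by (simp add: y_def)
    have "k t = integral\<^sup>L (mu x) (\<lambda>r. r * indicator {-c<..s} r + r * indicator {s<..t} r)"
      unfolding k_def using st by (intro Bochner_Integration.integral_cong) (auto split: split_indicator)
    also have "\<dots> = k s + integral\<^sup>L (mu x) (\<lambda>r. r * indicator {s<..t} r)"
      unfolding k_def by (intro Bochner_Integration.integral_add int)
    finally have e2: "k t - k s = integral\<^sup>L (mu x) (\<lambda>r. r * indicator {s<..t} r)" by simp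
    have ms: "measure (mu x) {s<..t} = F x t - F x s"
      using F_mono[OF st(2), of x] by (simp add: measure_def emeasure_mu_Ioc[OF st(2)])
    have ic: "integrable (mu x) (\<lambda>r. q * indicator {s<..t} r)" for q :: real
      by (rule mu.integrable_const_bound[where B = "\<bar>q\<bar>"]) (auto intro!: AE_I2 split: split_indicator)
    have "integral\<^sup>L (mu x) (\<lambda>r. s * indicator {s<..t} r) \<le> k t - k s"
      unfolding e2 by (intro integral_mono int ic) (auto split: split_indicator)
    then have lo2: "s * (F x t - F x s) \<le> k t - k s" by (simp add: ms)
    have "k t - k s \<le> integral\<^sup>L (mu x) (\<lambda>r. t * indicator {s<..t} r)"
      unfolding e2 by (intro integral_mono int ic) (auto split: split_indicator)
    then have up2: "k t - k s \<le> t * (F x t - F x s)" by (simp add: ms)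
    have "u t - u s = inner (T y) y - (k t - k s)" using e1 by (simp add: u_def)
    then show "\<bar>u t - u s\<bar> \<le> (t - s) * (F x t - F x s)"
      using up lo up2 lo2 by (simp add: left_diff_distrib abs_le_iff)
  qed (rule c)
  moreover have "u (- c) = 0" by (simp add: u_def k_def E_bot[OF c(3)] blinfun.bilinear_simps)
  moreover have "k c = integral\<^sup>L (mu x) (\<lambda>t. t)"
    unfolding k_def
  proof (rule integral_cong_AE)
    have "emeasure (mu x) {-c<..c} = ennreal ((norm x)\<^sup>2)"
      using emeasure_mu_Ioc[of "-c" c x] c by (simp add: F_def E_top E_bot power2_norm_eq_inner)
    then have "measure (mu x) {-c<..c} = (norm x)\<^sup>2" by (simp add: measure_def)
    then have "measure (mu x) (- {-c<..c}) = 0" by (simp add: measure_mu_compl)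
    then have "AE t in mu x. t \<notin> - {-c<..c}"
      by (intro AE_not_in) (auto simp: null_sets_def mu.emeasure_eq_measure)
    then show "AE t in mu x. t * indicator {-c<..c} t = t"
      by eventually_elim auto
  qed auto
  ultimately show ?thesis by (simp add: u_def E_top c)
qed

lemma is_spectral_measure_G: "is_spectral_measure T G"
  unfolding is_spectral_measure_def
proof (intro conjI ballI allI impI)
  fix D J :: "real set" assume "D \<in> sets borel" "J \<in> sets borel"
  then show "G (D \<inter> J) = G D o\<^sub>L G J" by (intro blinfun_eqI) (simp add: G_mult)
next
  show "\<exists>c. G {t. c < \<bar>t\<bar>} = 0" using G_bounded by blast
qed (auto simp: saG G_UNIV G_sums pvm_scalar_measure_G mu_integral)

end

theorem spectral_measure_exists:
  fixes T :: "'a::{real_inner,complete_space} \<Rightarrow>\<^sub>L 'a"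
  assumes "self_adjoint T"
  shows "is_spectral_measure T (spectral_proj T)"
proof -
  from spectral_family_exists[OF assms] obtain E where "spectral_family T E" ..
  then have "is_spectral_measure T (spectral_family.G E)"
    by (rule spectral_family.is_spectral_measure_G)
  then have "is_spectral_measure T (SOME E. is_spectral_measure T E)" by (rule someI[where P = "is_spectral_measure T"])
  moreover have "spectral_proj T = (SOME E. is_spectral_measure T E)"
    by (auto simp: spectral_proj_def)
  ultimately show ?thesis by simp
qed

section \<open>Consequences of the spectral theorem\<close>

text \<open>Works with any measure satisfying the definition, hence with the one that
  \<open>SOME\<close> happens to pick in \<open>spectral_proj\<close>.\<close>

locale spectral_measure =
  fixes T :: "'a::{real_inner,complete_space} \<Rightarrow>\<^sub>L 'a" and E :: "real set \<Rightarrow> 'a \<Rightarrow>\<^sub>L 'a"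
  assumes sa: "self_adjoint T" and spectral: "is_spectral_measure T E"
begin

lemma saE: "D \<in> sets borel \<Longrightarrow> self_adjoint (E D)"
  and E_Int: "D \<in> sets borel \<Longrightarrow> D' \<in> sets borel \<Longrightarrow> E (D \<inter> D') = E D o\<^sub>L E D'"
  and E_UNIV: "E UNIV = id_blinfun"
  and E_bounded: "\<exists>c. E {t. c < \<bar>t\<bar>} = 0"
  and form_integral: "inner (T x) x = integral\<^sup>L (pvm_scalar_measure E x) (\<lambda>t. t)"
  using spectral by (auto simp: is_spectral_measure_def)

lemma E_sums: "(\<And>n. A n \<in> sets borel) \<Longrightarrow> disjoint_family A \<Longrightarrow> (\<lambda>n. E (A n) x) sums E (\<Union>n. A n) x"
  using spectral unfolding is_spectral_measure_def by blast

lemma E_E: "D \<in> sets borel \<Longrightarrow> D' \<in> sets borel \<Longrightarrow> E D (E D' x) = E (D \<inter> D') x"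
  by (simp add: E_Int)

lemma E_idem: "D \<in> sets borel \<Longrightarrow> E D o\<^sub>L E D = E D"
  using E_Int[of D D] by simp

lemma E_empty [simp]: "E {} = 0"
proof (rule blinfun_eqI)
  fix x
  have "(\<lambda>n::nat. E {} x) sums E {} x"
    using E_sums[of "\<lambda>_. {}" x] by (simp add: disjoint_family_on_def)
  then have "(\<lambda>n::nat. E {} x) \<longlonglongrightarrow> 0" by (intro summable_LIMSEQ_zero sums_summable)
  then show "E {} x = (0 :: 'a \<Rightarrow>\<^sub>L 'a) x" by (simp add: LIMSEQ_const_iff)
qed

lemma E_Un:
  assumes "D \<in> sets borel" "D' \<in> sets borel" "D \<inter> D' = {}"
  shows "E (D \<union> D') x = E D x + E D' x"
proof -
  have "(\<lambda>n. E (binaryset D D' n) x) sums E (\<Union>n. binaryset D D' n) x"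
    using assms by (intro E_sums)
      (auto simp: binaryset_def disjoint_family_on_def)
  moreover have "(\<lambda>n. E (binaryset D D' n) x) sums (\<Sum>n\<in>{0, Suc 0}. E (binaryset D D' n) x)"
    by (rule sums_finite) (auto simp: binaryset_def)
  ultimately have "E (\<Union>n. binaryset D D' n) x = (\<Sum>n\<in>{0, Suc 0}. E (binaryset D D' n) x)"
    by (rule sums_unique2)
  then show ?thesis by (simp add: UN_binaryset_eq) (simp add: binaryset_def)
qed

lemma E_compl: "D \<in> sets borel \<Longrightarrow> E (- D) x = x - E D x"
  using E_Un[of D "- D" x] by (simp add: E_UNIV Un_commute eq_diff_eq add.commute)

lemma E_UN_finite:
  assumes "finite I" "\<And>i. i \<in> I \<Longrightarrow> D i \<in> sets borel" "disjoint_family_on D I"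
  shows "E (\<Union>i\<in>I. D i) x = (\<Sum>i\<in>I. E (D i) x)"
  using assms
proof (induction I rule: finite_induct)
  case (insert i I)
  have "E (D i \<union> (\<Union>i\<in>I. D i)) x = E (D i) x + E (\<Union>i\<in>I. D i) x"
    using insert.prems insert.hyps by (intro E_Un) (auto simp: disjoint_family_on_def)
  moreover have "disjoint_family_on D I" using insert.prems by (auto simp: disjoint_family_on_def)
  ultimately show ?case using insert by simp
qed simp

lemma E_disjoint: "D \<in> sets borel \<Longrightarrow> D' \<in> sets borel \<Longrightarrow> D \<inter> D' = {} \<Longrightarrow> E D (E D' x) = 0"
  by (simp add: E_E)

lemma E_subset: "D \<in> sets borel \<Longrightarrow> D' \<in> sets borel \<Longrightarrow> D \<subseteq> D' \<Longrightarrow> E D' (E D x) = E D x"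
  by (simp add: E_E Int_absorb1 Int_absorb2)

lemma E_null_subset:
  assumes "D \<in> sets borel" "D' \<in> sets borel" "D \<subseteq> D'" "E D' = 0"
  shows "E D = 0"
proof (rule blinfun_eqI)
  show "E D x = (0 :: 'a \<Rightarrow>\<^sub>L 'a) x" for x using E_subset[OF assms(1-3), of x] assms(4) by simp
qed

lemma E_form: "D \<in> sets borel \<Longrightarrow> inner (E D x) x = (norm (E D x))\<^sup>2"
  by (rule projection_norm_sq[OF saE E_idem])

lemma E_norm_le: "D \<in> sets borel \<Longrightarrow> norm (E D x) \<le> norm x"
  by (rule projection_norm_le[OF saE E_idem])

definition mu :: "'a \<Rightarrow> real measure" where
  "mu x = pvm_scalar_measure E x"

lemma sets_mu [simp, measurable_cong]: "sets (mu x) = sets borel"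
  and space_mu [simp]: "space (mu x) = UNIV"
  by (simp_all add: mu_def pvm_scalar_measure_def sets.sigma_sets_eq[of borel, simplified])

text \<open>\<open>measure_of\<close> yields the prescribed values only for a countably additive set
  function; here additivity is the strong convergence of the projections paired with x.\<close>

lemma emeasure_mu: "D \<in> sets borel \<Longrightarrow> emeasure (mu x) D = ennreal (inner (E D x) x)"
proof (rule emeasure_measure_of[of _ UNIV "sets borel" "\<lambda>D. ennreal (inner (E D x) x)"])
  show "countably_additive (sets (mu x)) (\<lambda>D. ennreal (inner (E D x) x))"
  proof (rule countably_additiveI)
    fix A :: "nat \<Rightarrow> real set" assume A: "range A \<subseteq> sets (mu x)" "disjoint_family A"
    then have "(\<lambda>n. E (A n) x) sums E (\<Union>n. A n) x" by (intro E_sums) auto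
    then have "(\<lambda>n. inner (E (A n) x) x) sums inner (E (\<Union>n. A n) x) x"
      by (rule bounded_linear.sums[OF bounded_linear_inner_left])
    moreover have "0 \<le> inner (E (A n) x) x" for n using A by (subst E_form) auto
    ultimately show "(\<Sum>i. ennreal (inner (E (A i) x) x)) = ennreal (inner (E (\<Union>(range A)) x) x)"
      by (intro suminf_ennreal_eq)
  qed
qed (auto simp: mu_def pvm_scalar_measure_def positive_def)

sublocale mu: finite_measure "mu x" for x
  by (rule finite_measureI) (simp add: emeasure_mu)

lemma measure_mu: "D \<in> sets borel \<Longrightarrow> measure (mu x) D = inner (E D x) x"
  using E_form[of D x] by (simp add: measure_def emeasure_mu)

lemma AE_mu: "D \<in> sets borel \<Longrightarrow> E D x = x \<Longrightarrow> AE t in mu x. t \<in> D"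
  by (rule AE_I[of _ _ "- D"]) (auto simp: emeasure_mu E_compl)

lemma integrable_mu: "integrable (mu x) (\<lambda>t. t)"
proof -
  obtain c where c: "E {t. c < \<bar>t\<bar>} = 0" using E_bounded by blast
  have "AE t in mu x. t \<in> - {t. c < \<bar>t\<bar>}"
    by (intro AE_mu) (simp_all add: E_compl c)
  then have "AE t in mu x. norm t \<le> c" by eventually_elim auto
  then show ?thesis by (rule mu.integrable_const_bound) auto
qed

lemma form_mu: "inner (T x) x = integral\<^sup>L (mu x) (\<lambda>t. t)"
  by (simp add: form_integral mu_def)

lemma form_ge:
  assumes "D \<in> sets borel" "E D x = x" "\<And>t. t \<in> D \<Longrightarrow> l \<le> t"
  shows "l * (norm x)\<^sup>2 \<le> inner (T x) x"
proof -
  have "integral\<^sup>L (mu x) (\<lambda>t. l) \<le> integral\<^sup>L (mu x) (\<lambda>t. t)"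
    using AE_mu[OF assms(1,2)] assms(3) by (intro integral_mono_AE integrable_mu) auto
  then show ?thesis by (simp add: form_mu measure_mu E_UNIV power2_norm_eq_inner mult.commute)
qed

lemma form_le:
  assumes "D \<in> sets borel" "E D x = x" "\<And>t. t \<in> D \<Longrightarrow> t \<le> l"
  shows "inner (T x) x \<le> l * (norm x)\<^sup>2"
proof -
  have "integral\<^sup>L (mu x) (\<lambda>t. t) \<le> integral\<^sup>L (mu x) (\<lambda>t. l)"
    using AE_mu[OF assms(1,2)] assms(3) by (intro integral_mono_AE integrable_mu) auto
  then show ?thesis by (simp add: form_mu measure_mu E_UNIV power2_norm_eq_inner mult.commute)
qed

lemma mu_E:
  assumes S: "S \<in> sets borel"
  shows "mu (E S x) = density (mu x) (indicator S)"
proof (rule measure_eqI)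
  fix D assume "D \<in> sets (mu (E S x))"
  then have D: "D \<in> sets borel" by simp
  have "inner (E D (E S x)) (E S x) = inner (E (S \<inter> D) x) (E S x)"
    using S D by (simp only: E_E Int_commute)
  also have "\<dots> = inner (E S (E (S \<inter> D) x)) x" by (simp add: self_adjointD[OF saE[OF S]])
  also have "E S (E (S \<inter> D) x) = E (S \<inter> D) x" using S D by (intro E_subset) auto
  finally show "emeasure (mu (E S x)) D = emeasure (density (mu x) (indicator S)) D"
    using S D by (simp add: emeasure_restricted emeasure_mu)
qed simp

lemma form_E:
  assumes S: "S \<in> sets borel"
  shows "inner (T (E S x)) (E S x) = integral\<^sup>L (mu x) (\<lambda>t. indicator S t * t)"
proof -
  have "inner (T (E S x)) (E S x) = integral\<^sup>L (density (mu x) (\<lambda>t. ennreal (indicator S t))) (\<lambda>t. t)"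
    by (simp add: form_mu mu_E[OF S] ennreal_indicator)
  also have "\<dots> = integral\<^sup>L (mu x) (\<lambda>t. indicator S t *\<^sub>R t)"
    using S by (intro integral_density) auto
  finally show ?thesis by simp
qed

text \<open>Splitting the integral of t over S and its complement shows that T and its
  block-diagonal part P T P + Q T Q have the same form. So they coincide, and the block-diagonal
  part commutes with P.\<close>

lemma T_E:
  assumes S: "S \<in> sets borel"
  shows "T (E S x) = E S (T x)"
proof -
  let ?P = "E S" and ?Q = "E (- S)"
  have mS: "- S \<in> sets borel" using S by auto
  have sand: "self_adjoint (R o\<^sub>L T o\<^sub>L R)" if "self_adjoint R" for R
    using that sa by (simp add: self_adjoint_def)
  have eq: "T = (?P o\<^sub>L T o\<^sub>L ?P) + (?Q o\<^sub>L T o\<^sub>L ?Q)"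
  proof (rule self_adjoint_eqI[OF sa])
    show "self_adjoint ((?P o\<^sub>L T o\<^sub>L ?P) + (?Q o\<^sub>L T o\<^sub>L ?Q))"
      by (intro self_adjoint_add sand saE S mS)
    fix x
    have int: "integrable (mu x) (\<lambda>t. indicator D t * t)" if "D \<in> sets borel" for D
      using integrable_mult_indicator[of D "mu x" "\<lambda>t. t"] integrable_mu that by simp
    have "inner (T x) x = integral\<^sup>L (mu x) (\<lambda>t. indicator S t * t + indicator (- S) t * t)"
      unfolding form_mu by (intro Bochner_Integration.integral_cong) (auto split: split_indicator)
    also have "\<dots> = inner (T (?P x)) (?P x) + inner (T (?Q x)) (?Q x)"
      unfolding form_E[OF S] form_E[OF mS] by (intro Bochner_Integration.integral_add int S mS)
    finally show "inner (T x) x = inner (((?P o\<^sub>L T o\<^sub>L ?P) + (?Q o\<^sub>L T o\<^sub>L ?Q)) x) x"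
      by (simp add: blinfun.bilinear_simps inner_add_left self_adjointD[OF saE[OF S]] self_adjointD[OF saE[OF mS]])
  qed
  have app: "T z = ?P (T (?P z)) + ?Q (T (?Q z))" for z
    using arg_cong[OF eq, of "\<lambda>R. blinfun_apply R z"] by (simp add: blinfun.bilinear_simps)
  have PP: "?P (?P z) = ?P z" and PQ: "?P (?Q z) = 0" and QP: "?Q (?P z) = 0" for z
    using S mS by (simp_all add: E_E)
  have "T (?P x) = ?P (T (?P x))"
    by (subst app) (simp add: PP QP blinfun.bilinear_simps)
  moreover have "?P (T x) = ?P (T (?P x))"
    by (subst app) (simp add: PP PQ blinfun.bilinear_simps)
  ultimately show ?thesis by simp
qed

text \<open>Commutation makes (T - l) E S self-adjoint, so the two-sided bound on its form is a
  bound on its norm.\<close>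

lemma E_spectral_part_norm_le:
  assumes S: "S \<in> sets borel" and r: "0 \<le> r" "\<And>t. t \<in> S \<Longrightarrow> \<bar>t - l\<bar> \<le> r" and x: "E S x = x"
  shows "norm (T x - l *\<^sub>R x) \<le> r * norm x"
proof -
  define R where "R = (T - l *\<^sub>R id_blinfun) o\<^sub>L E S"
  have "norm R \<le> r"
  proof (rule self_adjoint_norm_le[OF _ r(1)])
    show "self_adjoint R" unfolding R_def
      by (intro self_adjoint_commute self_adjoint_diff sa self_adjoint_scaleR saE S self_adjoint_id blinfun_eqI)
         (simp add: blinfun.bilinear_simps T_E[OF S])
    fix z
    define w where "w = E S z"
    have w: "E S w = w" using S by (simp add: w_def E_E)
    have "inner (R z) z = inner (T (E S (E S z)) - l *\<^sub>R E S (E S z)) z"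
      using S by (simp add: R_def E_E blinfun.bilinear_simps)
    also have "\<dots> = inner (E S (T w - l *\<^sub>R w)) z"
      by (simp add: T_E[OF S] w_def blinfun.bilinear_simps)
    also have "\<dots> = inner (T w - l *\<^sub>R w) w"
      by (simp add: self_adjointD[OF saE[OF S]] w_def)
    also have "\<dots> = inner (T w) w - l * (norm w)\<^sup>2"
      by (simp add: inner_diff_left power2_norm_eq_inner)
    finally have e: "inner (R z) z = inner (T w) w - l * (norm w)\<^sup>2" .
    have bnd: "l - r \<le> t" "t \<le> l + r" if "t \<in> S" for t using r(2)[OF that] by auto
    have "\<bar>inner (R z) z\<bar> \<le> r * (norm w)\<^sup>2"
      unfolding e using form_ge[OF S w, of "l - r"] form_le[OF S w, of "l + r"] bnd
      by (auto simp: algebra_simps abs_le_iff)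
    also have "\<dots> \<le> r * (norm z)\<^sup>2"
      using r(1) S unfolding w_def by (intro mult_left_mono power_mono E_norm_le) auto
    finally show "\<bar>inner (R z) z\<bar> \<le> r * (norm z)\<^sup>2" .
  qed
  then have "norm (R x) \<le> r * norm x" by (intro order_trans[OF norm_blinfun] mult_right_mono) auto
  then show ?thesis by (simp add: R_def x blinfun.bilinear_simps)
qed

end

section \<open>The spectrum of a self-adjoint operator\<close>

text \<open>For surjectivity S (S x) = y is solved by Banach's fixed point theorem: 1 - S^2/M is a
  contraction, since S^2 is bounded below by e^2.\<close>

lemma bij_if_bounded_below:
  fixes S :: "'a::{real_inner,complete_space} \<Rightarrow>\<^sub>L 'a"
  assumes sa: "self_adjoint S" and e: "0 < e" and lower: "\<And>x. e * norm x \<le> norm (S x)"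
  shows "bij S"
proof (rule bijI)
  show "inj S"
  proof (rule injI)
    fix x y assume "S x = S y"
    then have "e * norm (x - y) \<le> 0" using lower[of "x - y"] by (simp add: blinfun.bilinear_simps)
    then show "x = y" using e by (simp add: mult_le_0_iff)
  qed
  show "surj S"
  proof (rule surjI)
    fix y
    \<comment> \<open>At least norm S squared, so that 1 - S^2/M is positive, and at least e^2, so
      that q is nonnegative.\<close>
    define M where "M = (norm S)\<^sup>2 + e\<^sup>2"
    have M: "M > 0" using e by (simp add: M_def add_nonneg_pos)
    define Q where "Q = id_blinfun - (1 / M) *\<^sub>R (S o\<^sub>L S)"
    define q where "q = 1 - e\<^sup>2 / M"
    have q: "0 \<le> q" "q < 1" using M e by (auto simp: q_def M_def field_simps)
    have "norm Q \<le> q"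
    proof (rule self_adjoint_norm_le[OF _ q(1)])
      show "self_adjoint Q" unfolding Q_def
        by (intro self_adjoint_diff self_adjoint_scaleR self_adjoint_square sa self_adjoint_id)
      fix x
      have form: "inner (Q x) x = (norm x)\<^sup>2 - (norm (S x))\<^sup>2 / M"
        using self_adjointD[OF sa, of "S x" x]
        by (simp add: Q_def blinfun.bilinear_simps inner_diff_left power2_norm_eq_inner)
      have "(e * norm x)\<^sup>2 \<le> (norm (S x))\<^sup>2" using e by (intro power_mono lower) auto
      then have "(e * norm x)\<^sup>2 / M \<le> (norm (S x))\<^sup>2 / M" using M by (simp add: divide_right_mono)
      then have 1: "inner (Q x) x \<le> q * (norm x)\<^sup>2"
        by (simp add: form q_def power_mult_distrib algebra_simps)
      have "(norm (S x))\<^sup>2 \<le> (norm S * norm x)\<^sup>2" by (intro power_mono norm_blinfun) auto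
      also have "\<dots> \<le> M * (norm x)\<^sup>2" by (simp add: M_def power_mult_distrib algebra_simps)
      finally have "(norm (S x))\<^sup>2 / M \<le> (norm x)\<^sup>2" using M by (simp add: field_simps)
      then have "0 \<le> inner (Q x) x" by (simp add: form)
      then show "\<bar>inner (Q x) x\<bar> \<le> q * (norm x)\<^sup>2" using 1 by simp
    qed
    then have "\<forall>x z. dist (Q x + (1 / M) *\<^sub>R y) (Q z + (1 / M) *\<^sub>R y) \<le> q * dist x z"
      using order_trans[OF norm_blinfun mult_right_mono, of Q q]
      by (simp add: dist_norm blinfun.diff_right[symmetric])
    from banach_fix_type[OF q this] obtain x where "Q x + (1 / M) *\<^sub>R y = x" by blast
    then have "(1 / M) *\<^sub>R y = (1 / M) *\<^sub>R S (S x)"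
      by (simp add: Q_def blinfun.bilinear_simps algebra_simps)
    then have "S (S x) = y" using M by simp
    then show "S (SOME x. S x = y) = y" by (rule someI)
  qed
qed

text \<open>The inverse of a bijective symmetric operator is symmetric, so its sublevel sets are closed
  and Baire's theorem bounds it.\<close>

lemma bounded_below_if_bij:
  fixes S :: "'a::{real_inner,complete_space} \<Rightarrow>\<^sub>L 'a"
  assumes sa: "self_adjoint S" and bij: "bij S"
  shows "\<exists>e>0. \<forall>x. e * norm x \<le> norm (S x)"
proof -
  define R where "R = inv (blinfun_apply S)"
  have SR: "S (R x) = x" for x using bij by (simp add: R_def bij_is_surj surj_f_inv_f)
  have RS: "R (S x) = x" for x using bij by (simp add: R_def bij_is_inj inv_f_f)
  have sym: "inner (R x) y = inner x (R y)" for x y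
    using self_adjointD[OF sa, of "R x" "R y"] by (simp add: SR)
  have Rdiff: "R (x - y) = R x - R y" for x y
    by (metis SR RS blinfun.diff_right)
  have Rscale: "R (c *\<^sub>R x) = c *\<^sub>R R x" for c x
    by (metis SR RS blinfun.scaleR_right)
  define K where "K n = {x. norm (R x) \<le> real n}" for n
  have closed: "closed (K n)" for n
    unfolding closed_sequential_limits
  proof (intro allI impI, elim conjE)
    fix f l assume f: "\<forall>k. f k \<in> K n" "f \<longlonglongrightarrow> l"
    have "inner (R l) (R l) \<le> real n * norm (R l)"
    proof (rule LIMSEQ_le_const2)
      show "(\<lambda>k. inner (f k) (R (R l))) \<longlonglongrightarrow> inner (R l) (R l)"
        unfolding sym[of l "R l"] by (intro tendsto_inner f tendsto_const)
      show "\<exists>N. \<forall>k\<ge>N. inner (f k) (R (R l)) \<le> real n * norm (R l)"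
      proof (intro exI allI impI)
        fix k
        have "inner (f k) (R (R l)) = inner (R (f k)) (R l)" by (simp add: sym)
        also have "\<dots> \<le> norm (R (f k)) * norm (R l)" by (rule norm_cauchy_schwarz)
        also have "\<dots> \<le> real n * norm (R l)" using f(1) by (intro mult_right_mono) (auto simp: K_def)
        finally show "inner (f k) (R (R l)) \<le> real n * norm (R l)" .
      qed
    qed
    then have "norm (R l) * norm (R l) \<le> real n * norm (R l)"
      by (simp add: power2_norm_eq_inner[symmetric] power2_eq_square)
    then have "norm (R l) \<le> real n" by (cases "R l = 0") auto
    then show "l \<in> K n" by (simp add: K_def)
  qed
  have "\<exists>n. interior (K n) \<noteq> {}"
  proof (rule ccontr)
    assume "\<not> ?thesis"
    then have "\<And>U. U \<in> range K \<Longrightarrow> closedin Met_TC.mtopology U \<and> Met_TC.mtopology interior_of U = {}"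
      using closed by auto
    moreover have "Met_TC.mcomplete TYPE('a)"
      using complete_UNIV by (simp add: mcomplete_iff_complete)
    ultimately have "Met_TC.mtopology interior_of \<Union>(range K) = {}"
      by (intro Met_TC.metric_Baire_category_alt) auto
    moreover have "\<Union>(range K) = UNIV" using real_arch_simple by (auto simp: K_def)
    ultimately show False by simp
  qed
  then obtain n a where "a \<in> interior (K n)" by blast
  then obtain r where r: "r > 0" "ball a r \<subseteq> K n" by (auto simp: mem_interior)
  have aK: "norm (R a) \<le> real n" using r by (auto simp: K_def subset_iff)
  have small: "norm (R y) \<le> 2 * real n" if "norm y < r" for y
  proof -
    have "a - (- y) \<in> K n" using r that by (auto simp: subset_iff dist_norm)
    then have "norm (R (a - (- y))) \<le> real n" by (simp only: K_def mem_Collect_eq)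
    moreover have "R y = R (a - (- y)) - R a" unfolding Rdiff[symmetric] by simp
    ultimately show ?thesis using aK norm_triangle_ineq4[of "R (a - (- y))" "R a"] by simp
  qed
  \<comment> \<open>Rescaling a vector to length r/2 gives the factor 4 n / r; the summand 1 keeps C
    positive when n = 0.\<close>
  define C where "C = 4 * (real n + 1) / r"
  have C: "C > 0" using r by (simp add: C_def)
  have "norm (R y) \<le> C * norm y" for y
  proof (cases "y = 0")
    case True
    then show ?thesis using Rscale[of 0 y] by simp
  next
    case False
    define c where "c = r / (2 * norm y)"
    have c: "c > 0" using r False by (simp add: c_def)
    have "norm (c *\<^sub>R y) < r" using r False by (simp add: c_def)
    from small[OF this] have "c * norm (R y) \<le> 2 * real n" using c by (simp add: Rscale)
    then have "norm (R y) \<le> 2 * real n / c" using c by (simp add: field_simps)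
    also have "\<dots> = (4 * real n / r) * norm y" using False r by (simp add: c_def field_simps)
    also have "\<dots> \<le> C * norm y" using r by (intro mult_right_mono) (auto simp: C_def divide_right_mono)
    finally show ?thesis .
  qed
  from this[of "S _"] have "norm x \<le> C * norm (S x)" for x by (simp add: RS)
  then show ?thesis using C by (intro exI[of _ "1 / C"]) (auto simp: field_simps)
qed

text \<open>Replaces bijectivity by a quantitative lower bound, which is what testing with
  reflections produces and what survives small perturbations.\<close>

lemma not_in_spec_iff:
  fixes T :: "'a::{real_inner,complete_space} \<Rightarrow>\<^sub>L 'a"
  assumes sa: "self_adjoint T"
  shows "l \<notin> spec T \<longleftrightarrow> (\<exists>e>0. \<forall>x. e * norm x \<le> norm (T x - l *\<^sub>R x))"
proof -
  have eq: "(\<lambda>x. T x - l *\<^sub>R x) = blinfun_apply (T - l *\<^sub>R id_blinfun)"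
    by (auto simp: blinfun.bilinear_simps)
  have s: "self_adjoint (T - l *\<^sub>R id_blinfun)"
    by (intro self_adjoint_diff self_adjoint_scaleR sa self_adjoint_id)
  show ?thesis
    unfolding spec_def mem_Collect_eq not_not fun_cong[OF eq] unfolding eq
    using bij_if_bounded_below[OF s] bounded_below_if_bij[OF s] by blast
qed

lemma closed_spec:
  fixes T :: "'a::{real_inner,complete_space} \<Rightarrow>\<^sub>L 'a"
  assumes sa: "self_adjoint T"
  shows "closed (spec T)"
  unfolding closed_def open_contains_ball
proof
  fix l assume "l \<in> - spec T"
  then obtain e where e: "e > 0" "\<And>x. e * norm x \<le> norm (T x - l *\<^sub>R x)"
    using not_in_spec_iff[OF sa, of l] by auto
  have "m \<notin> spec T" if "m \<in> ball l e" for m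
    unfolding not_in_spec_iff[OF sa]
  proof (intro exI[of _ "e - \<bar>m - l\<bar>"] conjI allI)
    show "0 < e - \<bar>m - l\<bar>" using that by (simp add: dist_real_def abs_minus_commute)
    fix x
    have "norm (T x - l *\<^sub>R x) \<le> norm (T x - m *\<^sub>R x) + norm ((m - l) *\<^sub>R x)"
      by (rule order_trans[OF _ norm_triangle_ineq]) (simp add: algebra_simps)
    then show "(e - \<bar>m - l\<bar>) * norm x \<le> norm (T x - m *\<^sub>R x)"
      using e(2)[of x] by (simp add: left_diff_distrib)
  qed
  then show "\<exists>e>0. ball l e \<subseteq> - spec T" using e(1) by blast
qed

section \<open>Support of the spectral measure and distance to the spectrum\<close>

context spectral_measure
begin

lemma spec_borel: "spec T \<in> sets borel"
  using closed_spec[OF sa] by simp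

text \<open>Around a point off the spectrum, a vector in the range of a small ball would be almost
  an eigenvector, against the lower bound; so the ball is null. By Lindelof countably many such
  balls cover the complement of the spectrum.\<close>

lemma E_spec: "E (spec T) = id_blinfun"
proof -
  have ex: "\<exists>e>0. E (ball l e) = 0" if l: "l \<notin> spec T" for l
  proof -
    obtain e where e: "e > 0" "\<And>x. e * norm x \<le> norm (T x - l *\<^sub>R x)"
      using l not_in_spec_iff[OF sa, of l] by auto
    have "E (ball l (e / 2)) x = 0" for x
    proof (rule ccontr)
      assume "E (ball l (e / 2)) x \<noteq> 0"
      define y where "y = E (ball l (e / 2)) x"
      have "norm (T y - l *\<^sub>R y) \<le> e / 2 * norm y"
        by (rule E_spectral_part_norm_le[of "ball l (e / 2)"])
           (use e(1) in \<open>auto simp: y_def E_E dist_real_def abs_minus_commute\<close>)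
      then have "e * norm y \<le> e / 2 * norm y" using e(2)[of y] by linarith
      then show False using e(1) \<open>E (ball l (e / 2)) x \<noteq> 0\<close> by (simp add: y_def)
    qed
    then have "E (ball l (e / 2)) = 0" by (intro blinfun_eqI) simp
    then show ?thesis using e(1) by (intro exI[of _ "e / 2"]) simp
  qed
  then obtain e where e: "\<And>l. l \<notin> spec T \<Longrightarrow> e l > 0 \<and> E (ball l (e l)) = 0" by metis
  define \<F> where "\<F> = (\<lambda>l. ball l (e l)) ` (- spec T)"
  have "\<And>S. S \<in> \<F> \<Longrightarrow> open S" by (auto simp: \<F>_def)
  from Lindelof[OF this] obtain \<F>' where F': "\<F>' \<subseteq> \<F>" "countable \<F>'" "\<Union>\<F>' = \<Union>\<F>" by metis
  have cover: "- spec T \<subseteq> \<Union>\<F>'"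
    unfolding F'(3) \<F>_def using e by force
  have "E (- spec T) x = 0" for x
  proof -
    have "S \<in> null_sets (mu x)" if "S \<in> \<F>'" for S
    proof -
      have "E S = 0" "S \<in> sets borel" using that F'(1) e by (auto simp: \<F>_def)
      then show ?thesis by (simp add: null_sets_def emeasure_mu)
    qed
    then have "(\<Union>S\<in>\<F>'. S) \<in> null_sets (mu x)" using F'(2) by (intro null_sets_UN') auto
    then have "\<Union>\<F>' \<in> null_sets (mu x)" by simp
    then have "- spec T \<in> null_sets (mu x)"
      by (rule null_sets_subset) (use spec_borel cover in auto)
    then have "emeasure (mu x) (- spec T) = 0" by (simp add: null_sets_def)
    then have "(norm (E (- spec T) x))\<^sup>2 \<le> 0"
      using spec_borel by (simp add: emeasure_mu E_form ennreal_eq_0_iff)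
    then show ?thesis by simp
  qed
  then show ?thesis using spec_borel by (intro blinfun_eqI) (simp add: E_compl)
qed

lemma E_Int_spec: "D \<in> sets borel \<Longrightarrow> E (D \<inter> spec T) = E D"
  by (intro blinfun_eqI) (simp add: E_Int spec_borel E_spec)

text \<open>Test the operator against the reflection sgn (T - l).\<close>

lemma spectral_gap_lower_bound:
  assumes r: "0 \<le> r" "\<And>s. s \<in> spec T \<Longrightarrow> r \<le> \<bar>s - l\<bar>"
  shows "r * norm x \<le> norm (T x - l *\<^sub>R x)"
proof -
  define U where "U = spec T \<inter> {l..}"
  define W where "W = spec T \<inter> {..<l}"
  have UW: "U \<in> sets borel" "W \<in> sets borel" using spec_borel by (auto simp: U_def W_def)
  define p where "p = E U x"
  define q where "q = E W x"
  have "U \<inter> W = {}" "U \<union> W = spec T" by (auto simp: U_def W_def)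
  then have x: "x = p + q" using E_Un[OF UW, of x] by (simp add: p_def q_def E_spec)
  have p: "E U p = p" "E W p = 0" and q: "E W q = q" "E U q = 0"
    using UW \<open>U \<inter> W = {}\<close> by (simp_all add: p_def q_def E_E Int_commute)
  have ortho: "inner p q = 0"
    using self_adjointD[OF saE[OF UW(1)], of p q] p q by simp
  have Tpq: "inner (T p) q = 0"
    using self_adjointD[OF saE[OF UW(1)], of "T p" q] T_E[OF UW(1), of p] p q by simp
  have Tqp: "inner (T q) p = 0"
    using Tpq self_adjointD[OF sa, of q p] by (simp add: inner_commute)
  have "(l + r) * (norm p)\<^sup>2 \<le> inner (T p) p"
    by (rule form_ge[OF UW(1) p(1)]) (use r(2) in \<open>force simp: U_def\<close>)
  moreover have "inner (T q) q \<le> (l - r) * (norm q)\<^sup>2"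
    by (rule form_le[OF UW(2) q(1)]) (use r(2) in \<open>force simp: W_def\<close>)
  ultimately have "r * ((norm p)\<^sup>2 + (norm q)\<^sup>2) \<le> inner (T x - l *\<^sub>R x) (p - q)"
    using Tpq Tqp ortho
    by (simp add: x blinfun.bilinear_simps inner_add_left inner_diff_left inner_diff_right
        inner_add_right power2_norm_eq_inner inner_commute algebra_simps)
  also have "\<dots> \<le> norm (T x - l *\<^sub>R x) * norm (p - q)" by (rule norm_cauchy_schwarz)
  finally have 1: "r * ((norm p)\<^sup>2 + (norm q)\<^sup>2) \<le> norm (T x - l *\<^sub>R x) * norm (p - q)" .
  have nx: "(norm x)\<^sup>2 = (norm p)\<^sup>2 + (norm q)\<^sup>2" "(norm (p - q))\<^sup>2 = (norm p)\<^sup>2 + (norm q)\<^sup>2"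
    using ortho by (simp_all add: x power2_norm_eq_inner inner_add_left inner_add_right inner_diff_left
        inner_diff_right inner_commute)
  then have "norm (p - q) = norm x" by (metis norm_ge_zero power2_eq_iff_nonneg)
  then have "norm x * (r * norm x) \<le> norm x * norm (T x - l *\<^sub>R x)"
    using 1 nx(1) by (simp add: power2_eq_square mult_ac)
  then show ?thesis by (cases "x = 0") (auto simp: blinfun.bilinear_simps)
qed

end

lemma spec_perturbation:
  fixes S T :: "'a::{real_inner,complete_space} \<Rightarrow>\<^sub>L 'a"
  assumes "self_adjoint S" "self_adjoint T" and gap: "\<And>s. s \<in> spec T \<Longrightarrow> r \<le> \<bar>s - l\<bar>"
    and close: "norm (S - T) < r"
  shows "l \<notin> spec S"
proof -
  interpret spectral_measure T "spectral_proj T"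
    using assms(2) spectral_measure_exists by unfold_locales
  have r: "0 \<le> r" using close norm_ge_zero[of "S - T"] by linarith
  show ?thesis
    unfolding not_in_spec_iff[OF assms(1)]
  proof (intro exI[of _ "r - norm (S - T)"] conjI allI)
    show "0 < r - norm (S - T)" using close by simp
    fix x
    have "r * norm x \<le> norm (T x - l *\<^sub>R x)" by (rule spectral_gap_lower_bound[OF r gap])
    also have "\<dots> = norm ((S x - l *\<^sub>R x) - (S - T) x)" by (simp add: blinfun.bilinear_simps)
    also have "\<dots> \<le> norm (S x - l *\<^sub>R x) + norm ((S - T) x)" by (rule norm_triangle_ineq4)
    also have "\<dots> \<le> norm (S x - l *\<^sub>R x) + norm (S - T) * norm x" by (intro add_left_mono norm_blinfun)
    finally show "(r - norm (S - T)) * norm x \<le> norm (S x - l *\<^sub>R x)" by (simp add: algebra_simps)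
  qed
qed

section \<open>Separated spectral subspaces\<close>

text \<open>For h > 0 the half-open interval from i h to (i + 1) h; with the floor, disjointness and
  covering are immediate.\<close>

definition cell :: "real \<Rightarrow> int \<Rightarrow> real set" where
  "cell h i = {t. \<lfloor>t / h\<rfloor> = i}"

lemma cell_borel [measurable, simp]: "cell h i \<in> sets borel"
  unfolding cell_def by measurable

lemma cell_disjoint: "i \<noteq> j \<Longrightarrow> cell h i \<inter> cell h j = {}"
  by (auto simp: cell_def)

lemma cellD:
  assumes "h > 0" "t \<in> cell h i"
  shows "of_int i * h \<le> t" "t < (of_int i + 1) * h"
  using assms by (auto simp: cell_def floor_eq_iff field_simps)

context spectral_measure
begin

definition P :: "real set \<Rightarrow> real \<Rightarrow> int \<Rightarrow> 'a \<Rightarrow>\<^sub>L 'a" where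
  "P S h i = E (S \<inter> cell h i)"

context
  fixes S :: "real set" and h :: real and I :: "int set"
  assumes S: "S \<in> sets borel" and h: "h > 0" and I: "finite I"
    and cover: "E S x = (\<Sum>i\<in>I. P S h i x)"
begin

lemma Si: "S \<inter> cell h i \<in> sets borel" using S by auto

lemma saP: "self_adjoint (P S h i)" unfolding P_def by (rule saE[OF Si])

lemma P_P: "P S h i (P S h j x) = (if i = j then P S h i x else 0)"
proof (cases "i = j")
  case True
  then show ?thesis using Si by (simp add: P_def E_E)
next
  case False
  then have "(S \<inter> cell h i) \<inter> (S \<inter> cell h j) = {}" using cell_disjoint[of i j h] by blast
  then show ?thesis using Si E_disjoint[OF Si Si] False by (simp add: P_def)
qed

lemma inner_P_P: "inner (P S h i x) (P S h j y) = (if i = j then inner (P S h i x) y else 0)"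
proof -
  have "inner (P S h i x) (P S h j y) = inner (P S h j (P S h i x)) y"
    by (simp add: self_adjointD[OF saP])
  then show ?thesis by (simp add: P_P)
qed

lemma norm_comb_sq: "(norm (\<Sum>i\<in>I. f i *\<^sub>R P S h i x))\<^sup>2 = (\<Sum>i\<in>I. (f i)\<^sup>2 * (norm (P S h i x))\<^sup>2)"
proof -
  have "inner (f i *\<^sub>R P S h i x) (f j *\<^sub>R P S h j x) =
      (if i = j then (f i)\<^sup>2 * (norm (P S h i x))\<^sup>2 else 0)" for i j
  proof (cases "i = j")
    case True
    then show ?thesis by (simp add: power2_norm_eq_inner power2_eq_square[of "f j"])
  next
    case False
    then show ?thesis using inner_P_P[of i x j x] by simp
  qed
  then have "(norm (\<Sum>i\<in>I. f i *\<^sub>R P S h i x))\<^sup>2 =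
      (\<Sum>j\<in>I. \<Sum>i\<in>I. if i = j then (f i)\<^sup>2 * (norm (P S h i x))\<^sup>2 else 0)"
    unfolding power2_norm_eq_inner[of "\<Sum>i\<in>I. f i *\<^sub>R P S h i x"] inner_sum_right
    by (simp only: inner_sum_left)
  then show ?thesis using I by simp
qed

lemma sum_norm_P_sq: "(\<Sum>i\<in>I. (norm (P S h i x))\<^sup>2) \<le> (norm x)\<^sup>2"
proof -
  have "(\<Sum>i\<in>I. (norm (P S h i x))\<^sup>2) = (norm (E S x))\<^sup>2"
    using norm_comb_sq[of "\<lambda>_. 1" x] by (simp add: cover)
  also have "\<dots> \<le> (norm x)\<^sup>2" using S by (intro power_mono E_norm_le) auto
  finally show ?thesis .
qed

lemma E_comb: "E S (\<Sum>i\<in>I. f i *\<^sub>R P S h i x) = (\<Sum>i\<in>I. f i *\<^sub>R P S h i x)"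
proof -
  have "E S (P S h i x) = P S h i x" for i
    unfolding P_def by (rule E_subset[OF Si S]) auto
  then show ?thesis by (simp add: blinfun.sum_right blinfun.scaleR_right)
qed

text \<open>The part of T on the range of \<open>E S\<close>, with its spectrum rounded down to the
  multiples of h.\<close>

definition lattice_op :: "'a \<Rightarrow>\<^sub>L 'a" where
  "lattice_op = (\<Sum>i\<in>I. (of_int i * h) *\<^sub>R P S h i)"

lemma lattice_op_comb:
  "lattice_op (\<Sum>i\<in>I. f i *\<^sub>R P S h i x) = (\<Sum>i\<in>I. (of_int i * h * f i) *\<^sub>R P S h i x)"
proof -
  have "P S h i (\<Sum>j\<in>I. f j *\<^sub>R P S h j x) = f i *\<^sub>R P S h i x" if "i \<in> I" for i
  proof -
    have "P S h i (\<Sum>j\<in>I. f j *\<^sub>R P S h j x) = (\<Sum>j\<in>I. if i = j then f i *\<^sub>R P S h i x else 0)"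
      by (simp add: blinfun.sum_right blinfun.scaleR_right P_P if_distrib[of "\<lambda>z. _ *\<^sub>R z"] cong: if_cong)
    then show ?thesis using that I by simp
  qed
  then show ?thesis by (simp add: lattice_op_def blinfun.sum_left blinfun.scaleR_left)
qed

text \<open>T commutes with the cell projections, so the form of the difference is a sum over cells,
  and in each cell the form of T exceeds the rounded value by at most h times the squared
  norm.\<close>

lemma lattice_op_norm: "norm ((T o\<^sub>L E S) - lattice_op) \<le> h"
proof (rule self_adjoint_norm_le)
  show "self_adjoint ((T o\<^sub>L E S) - lattice_op)" unfolding lattice_op_def
    by (intro self_adjoint_diff self_adjoint_commute sa saE S self_adjoint_sum self_adjoint_scaleR
        saP blinfun_eqI) (simp add: T_E[OF S])
  show "0 \<le> h" using h by simp
  fix x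
  have "inner (T (P S h i x)) x = inner (T (P S h i x)) (P S h i x)" for i
  proof -
    have "inner (T (P S h i x)) x = inner (T (P S h i (P S h i x))) x" by (simp add: P_P)
    also have "\<dots> = inner (P S h i (T (P S h i x))) x" unfolding P_def by (simp only: T_E[OF Si])
    finally show ?thesis by (simp add: self_adjointD[OF saP])
  qed
  then have "inner (((T o\<^sub>L E S) - lattice_op) x) x =
      (\<Sum>i\<in>I. inner (T (P S h i x)) (P S h i x) - of_int i * h * (norm (P S h i x))\<^sup>2)"
    using inner_P_P[of _ x _ x]
    by (simp add: blinfun.bilinear_simps cover lattice_op_def blinfun.sum_left blinfun.sum_right inner_diff_left
        inner_sum_left sum_subtractf power2_norm_eq_inner)
  also have "\<bar>\<dots>\<bar> \<le> (\<Sum>i\<in>I. \<bar>inner (T (P S h i x)) (P S h i x) - of_int i * h * (norm (P S h i x))\<^sup>2\<bar>)"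
    by (rule sum_abs)
  also have "\<dots> \<le> (\<Sum>i\<in>I. h * (norm (P S h i x))\<^sup>2)"
  proof (rule sum_mono)
    fix i
    have fx: "E (S \<inter> cell h i) (P S h i x) = P S h i x" using Si by (simp add: P_def E_E)
    have "of_int i * h * (norm (P S h i x))\<^sup>2 \<le> inner (T (P S h i x)) (P S h i x)"
      by (rule form_ge[OF Si fx]) (use cellD[OF h] in auto)
    moreover have "inner (T (P S h i x)) (P S h i x) \<le> ((of_int i + 1) * h) * (norm (P S h i x))\<^sup>2"
      by (rule form_le[OF Si fx]) (use cellD[OF h] in \<open>auto intro: less_imp_le\<close>)
    ultimately show "\<bar>inner (T (P S h i x)) (P S h i x) - of_int i * h * (norm (P S h i x))\<^sup>2\<bar> \<le>
        h * (norm (P S h i x))\<^sup>2"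
      by (simp add: abs_le_iff algebra_simps)
  qed
  also have "\<dots> \<le> h * (norm x)\<^sup>2"
    unfolding sum_distrib_left[symmetric] using h sum_norm_P_sq[of x] by (intro mult_left_mono) auto
  finally show "\<bar>inner (((T o\<^sub>L E S) - lattice_op) x) x\<bar> \<le> h * (norm x)\<^sup>2" .
qed

end

lemma lattice_cover:
  assumes S: "S \<in> sets borel" and h: "h > 0" and c: "E {t. c < \<bar>t\<bar>} = 0" and k: "c / h + 1 \<le> real k"
  shows "E S x = (\<Sum>i\<in>{- int k..int k}. P S h i x)"
proof -
  define I where "I = {- int k..int k}"
  define U where "U = (\<Union>i\<in>I. S \<inter> cell h i)"
  have U: "U \<in> sets borel" unfolding U_def using S by (intro sets.finite_UN) (auto simp: I_def)
  have "S - U \<subseteq> {t. c < \<bar>t\<bar>}"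
  proof
    fix t assume t: "t \<in> S - U"
    have "t \<in> cell h \<lfloor>t / h\<rfloor>" by (simp add: cell_def)
    then have "\<lfloor>t / h\<rfloor> \<notin> I" using t by (auto simp: U_def)
    then have "int k < \<lfloor>t / h\<rfloor> \<or> \<lfloor>t / h\<rfloor> < - int k" by (auto simp: I_def)
    then have "c / h < \<bar>t / h\<bar>"
    proof
      assume "int k < \<lfloor>t / h\<rfloor>"
      then have "real_of_int (int k) < t / h" by (simp add: less_floor_iff)
      then show ?thesis using k abs_ge_self[of "t / h"] by simp
    next
      assume "\<lfloor>t / h\<rfloor> < - int k"
      then have "t / h < real_of_int (- int k)" by (simp only: floor_less_iff)
      then show ?thesis using k abs_ge_minus_self[of "t / h"] by simp
    qed
    then show "t \<in> {t. c < \<bar>t\<bar>}" using h by (simp add: field_simps)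
  qed
  then have 0: "E (S - U) = 0" by (rule E_null_subset[OF _ _ _ c, rotated 2]) (simp_all add: S U sets.Diff)
  have dec: "U \<union> (S - U) = S" by (auto simp: U_def)
  have "E (U \<union> (S - U)) x = E U x + E (S - U) x" using S U by (intro E_Un) auto
  then have "E S x = E U x + E (S - U) x" by (simp only: dec)
  also have "\<dots> = (\<Sum>i\<in>I. E (S \<inter> cell h i) x)"
  proof -
    have "disjoint_family_on (\<lambda>i. S \<inter> cell h i) I"
      using cell_disjoint[of _ _ h] unfolding disjoint_family_on_def by blast
    then have "E U x = (\<Sum>i\<in>I. E (S \<inter> cell h i) x)"
      unfolding U_def using S by (intro E_UN_finite) (auto simp: I_def)
    then show ?thesis by (simp add: 0)
  qed
  finally show ?thesis by (simp add: P_def I_def)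
qed

end

text \<open>The function t \<mapsto> \<Sum> cos ((i - j) t) \<langle>P i (Q j x), y\<rangle>, whose frequencies are bounded away
  from 0, has a derivative controlled by the commutator A X - X B. Bohr's inequality then bounds
  its value at 0. Here A and B are replaced by operators with spectrum in a lattice.\<close>

lemma separated_projections_inner_le_lattice:
  fixes A B :: "'a::{real_inner,complete_space} \<Rightarrow>\<^sub>L 'a"
  assumes "spectral_measure A E" "spectral_measure B F"
    and S: "S \<in> sets borel" and S': "S' \<in> sets borel"
    and sep: "\<And>s s'. s \<in> S \<Longrightarrow> s' \<in> S' \<Longrightarrow> r \<le> \<bar>s - s'\<bar>" and r: "r > 0" and N: "N > 0"
  shows "inner (E S (F S' x)) y \<le> pi / 2 * ((norm (A - B) + 2 * r / real N) * (norm x * norm y) / r)"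
proof -
  interpret A: spectral_measure A E by fact
  interpret B: spectral_measure B F by fact
  \<comment> \<open>With this mesh, points at distance r or more lie in cells whose indices differ
    by at least N.\<close>
  define h where "h = r / real N"
  have h: "h > 0" using r N by (simp add: h_def)
  obtain c1 where c1: "E {t. c1 < \<bar>t\<bar>} = 0" using A.E_bounded by blast
  obtain c2 where c2: "F {t. c2 < \<bar>t\<bar>} = 0" using B.E_bounded by blast
  obtain k :: nat where k: "max (c1 / h + 1) (c2 / h + 1) \<le> real k" using real_arch_simple by blast
  define I where "I = {- int k..int k}"
  have I: "finite I" by (simp add: I_def)
  define P where "P = A.P S h"
  define Q where "Q = B.P S' h"
  have cA: "E S x = (\<Sum>i\<in>I. A.P S h i x)" for x
    unfolding I_def by (rule A.lattice_cover[OF S h c1]) (use k in auto)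
  have cB: "F S' x = (\<Sum>i\<in>I. B.P S' h i x)" for x
    unfolding I_def by (rule B.lattice_cover[OF S' h c2]) (use k in auto)
  define a where "a = A.lattice_op S h I"
  define b where "b = B.lattice_op S' h I"
  \<comment> \<open>The two extra h are the rounding errors of A and B.\<close>
  define M where "M = norm (A - B) + 2 * h"
  have M0: "0 \<le> M" using h by (simp add: M_def)
  have expand: "inner (\<Sum>j\<in>I. \<alpha> j *\<^sub>R Q j x) (\<Sum>i\<in>I. \<beta> i *\<^sub>R P i y) =
      (\<Sum>(i, j)\<in>I \<times> I. \<beta> i * \<alpha> j * inner (Q j x) (P i y))" for \<alpha> \<beta>
    unfolding inner_sum_right unfolding inner_sum_left sum.cartesian_product
    by (intro sum.cong) auto
  define u where "u f = (\<Sum>j\<in>I. f j *\<^sub>R Q j x)" for f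
  define w where "w f = (\<Sum>i\<in>I. f i *\<^sub>R P i y)" for f
  have bil: "inner (u f) (a (w g)) - inner (b (u f)) (w g) =
      h * (\<Sum>(i, j)\<in>I \<times> I. of_int (i - j) * (f j * g i) * inner (Q j x) (P i y))" for f g
  proof -
    have "a (w g) = (\<Sum>i\<in>I. (of_int i * h * g i) *\<^sub>R P i y)"
      unfolding a_def w_def P_def by (rule A.lattice_op_comb[OF S h I cA])
    moreover have "b (u f) = (\<Sum>j\<in>I. (of_int j * h * f j) *\<^sub>R Q j x)"
      unfolding b_def u_def Q_def by (rule B.lattice_op_comb[OF S' h I cB])
    ultimately show ?thesis
      unfolding u_def w_def
      by (simp only: expand sum_distrib_left sum_subtractf[symmetric])
         (intro sum.cong, auto simp: algebra_simps)
  qed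
  have bnd: "\<bar>inner (u f) (a (w g)) - inner (b (u f)) (w g)\<bar> \<le> M * (norm (u f) * norm (w g))" for f g
  proof -
    have Ew: "E S (w g) = w g" unfolding w_def P_def by (rule A.E_comb[OF S h I cA])
    have Fu: "F S' (u f) = u f" unfolding u_def Q_def by (rule B.E_comb[OF S' h I cB])
    have n1: "norm (((A o\<^sub>L E S) - a) (w g)) \<le> h * norm (w g)"
      unfolding a_def by (intro order_trans[OF norm_blinfun] mult_right_mono A.lattice_op_norm S h I cA) auto
    have n2: "norm (((B o\<^sub>L F S') - b) (u f)) \<le> h * norm (u f)"
      unfolding b_def by (intro order_trans[OF norm_blinfun] mult_right_mono B.lattice_op_norm S' h I cB) auto
    have e: "inner (u f) (a (w g)) - inner (b (u f)) (w g) =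
       inner ((A - B) (u f)) (w g) - inner (u f) (((A o\<^sub>L E S) - a) (w g)) + inner (((B o\<^sub>L F S') - b) (u f)) (w g)"
      using self_adjointD[OF A.sa, of "u f" "w g"]
      by (simp add: blinfun.bilinear_simps inner_diff_left inner_diff_right Ew Fu)
    have i1: "\<bar>inner ((A - B) (u f)) (w g)\<bar> \<le> norm (A - B) * (norm (u f) * norm (w g))"
      using order_trans[OF Cauchy_Schwarz_ineq2 mult_right_mono[OF norm_blinfun], of "w g" "A - B" "u f"]
      by (simp add: mult.assoc)
    have i2: "\<bar>inner (u f) (((A o\<^sub>L E S) - a) (w g))\<bar> \<le> h * (norm (u f) * norm (w g))"
      using order_trans[OF Cauchy_Schwarz_ineq2 mult_left_mono[OF n1], of "u f"] by (simp add: mult_ac)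
    have i3: "\<bar>inner (((B o\<^sub>L F S') - b) (u f)) (w g)\<bar> \<le> h * (norm (u f) * norm (w g))"
      using order_trans[OF Cauchy_Schwarz_ineq2 mult_right_mono[OF n2], of "w g"] by (simp add: mult_ac)
    show ?thesis
      unfolding e M_def using i1 i2 i3 by (simp add: algebra_simps)
  qed
  \<comment> \<open>Cell components are orthogonal, so the cosine and the sine combination split the
    squared norm by cos^2 + sin^2 = 1. The pair plays the role of a unitary orbit of x.\<close>
  have nu: "(norm (u (\<lambda>j. cos (of_int j * t))))\<^sup>2 + (norm (u (\<lambda>j. sin (of_int j * t))))\<^sup>2 \<le> (norm x)\<^sup>2" for t
    unfolding u_def Q_def B.norm_comb_sq[OF S' h I cB] sum.distrib[symmetric] distrib_right[symmetric]
    using B.sum_norm_P_sq[OF S' h I cB, of x] by simp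
  have nw: "(norm (w (\<lambda>j. cos (of_int j * t))))\<^sup>2 + (norm (w (\<lambda>j. sin (of_int j * t))))\<^sup>2 \<le> (norm y)\<^sup>2" for t
    unfolding w_def P_def A.norm_comb_sq[OF S h I cA] sum.distrib[symmetric] distrib_right[symmetric]
    using A.sum_norm_P_sq[OF S h I cA, of y] by simp
  \<comment> \<open>Cauchy-Schwarz in the plane, from Lagrange's identity.\<close>
  have cs: "p1 * q2 + p2 * q1 \<le> X * Y" if "p1\<^sup>2 + p2\<^sup>2 \<le> X\<^sup>2" "q1\<^sup>2 + q2\<^sup>2 \<le> Y\<^sup>2" "0 \<le> X" "0 \<le> Y"
    for p1 p2 q1 q2 X Y :: real
  proof (rule power2_le_imp_le)
    have "(p1 * q2 + p2 * q1)\<^sup>2 + (p1 * q1 - p2 * q2)\<^sup>2 = (p1\<^sup>2 + p2\<^sup>2) * (q1\<^sup>2 + q2\<^sup>2)"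
      by (simp add: power2_eq_square algebra_simps)
    then have "(p1 * q2 + p2 * q1)\<^sup>2 \<le> (p1\<^sup>2 + p2\<^sup>2) * (q1\<^sup>2 + q2\<^sup>2)"
      using zero_le_power2[of "p1 * q1 - p2 * q2"] by linarith
    also have "\<dots> \<le> X\<^sup>2 * Y\<^sup>2" using that by (intro mult_mono) auto
    finally show "(p1 * q2 + p2 * q1)\<^sup>2 \<le> (X * Y)\<^sup>2" by (simp add: power_mult_distrib)
  qed (use that in auto)
  define m where "m ij = inner (Q (snd ij) x) (P (fst ij) y)" for ij :: "int \<times> int"
  \<comment> \<open>Taking the absolute value loses nothing, since z * sin (z * t) is even in
    z.\<close>
  define \<nu> where "\<nu> ij = nat \<bar>fst ij - snd ij\<bar>" for ij :: "int \<times> int"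
  define K where "K = {ij \<in> I \<times> I. N \<le> \<nu> ij}"
  \<comment> \<open>If the indices differ by at most N - 1, points of the two cells are closer than
    N h = r, so one of the cells misses its set. All surviving frequencies are at least N.\<close>
  have m0: "m ij = 0" if "ij \<in> I \<times> I - K" for ij
  proof -
    obtain i j where ij: "ij = (i, j)" by (cases ij)
    have "\<bar>i - j\<bar> < int N" using that by (auto simp: ij K_def \<nu>_def)
    then have lt: "\<bar>real_of_int i - real_of_int j\<bar> \<le> real N - 1" by linarith
    have "S \<inter> cell h i = {} \<or> S' \<inter> cell h j = {}"
    proof (rule ccontr)
      assume "\<not> ?thesis"
      then obtain s s' where s: "s \<in> S" "s \<in> cell h i" "s' \<in> S'" "s' \<in> cell h j" by blast
      have "\<bar>s - s'\<bar> < (\<bar>of_int i - of_int j\<bar> + 1) * h"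
      proof -
        have "\<bar>s - s'\<bar> < \<bar>of_int i * h - of_int j * h\<bar> + h"
          using cellD[OF h s(2)] cellD[OF h s(4)] by (simp add: distrib_right)
        also have "\<bar>of_int i * h - of_int j * h\<bar> = \<bar>of_int i - of_int j\<bar> * h"
          using h by (simp add: left_diff_distrib[symmetric] abs_mult)
        finally show ?thesis by (simp add: distrib_right)
      qed
      also have "\<dots> \<le> real N * h" using lt h by (intro mult_right_mono) auto
      also have "\<dots> = r" using N by (simp add: h_def)
      finally show False using sep[OF s(1,3)] by simp
    qed
    then show ?thesis by (auto simp: m_def ij P_def Q_def A.P_def B.P_def)
  qed
  have deriv: "\<bar>\<Sum>ij\<in>K. m ij * real (\<nu> ij) * sin (real (\<nu> ij) * t)\<bar> \<le> M * (norm x * norm y) / h" for t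
  proof -
    let ?uc = "u (\<lambda>j. cos (of_int j * t))" and ?us = "u (\<lambda>j. sin (of_int j * t))"
    let ?wc = "w (\<lambda>j. cos (of_int j * t))" and ?ws = "w (\<lambda>j. sin (of_int j * t))"
    have term_eq: "m ij * real (\<nu> ij) * sin (real (\<nu> ij) * t) =
        m ij * of_int (fst ij - snd ij) * sin (of_int (fst ij - snd ij) * t)" for ij
    proof -
      define z :: real where "z = of_int (fst ij - snd ij)"
      have "real (\<nu> ij) = z \<or> real (\<nu> ij) = - z" by (auto simp: \<nu>_def z_def)
      then show ?thesis unfolding z_def[symmetric] by auto
    qed
    define Z where "Z = (\<Sum>ij\<in>K. m ij * real (\<nu> ij) * sin (real (\<nu> ij) * t))"
    have "Z = (\<Sum>ij\<in>I \<times> I. m ij * of_int (fst ij - snd ij) * sin (of_int (fst ij - snd ij) * t))"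
      unfolding term_eq Z_def by (intro sum.mono_neutral_left) (auto simp: I K_def m0)
    \<comment> \<open>The addition theorem for sin ((i - j) t) separates the indices and leaves two
      commutator forms, each with one cosine and one sine combination.\<close>
    then have Z: "h * Z = (inner ?uc (a ?ws) - inner (b ?uc) ?ws) - (inner ?us (a ?wc) - inner (b ?us) ?wc)"
      unfolding bil right_diff_distrib[symmetric] sum_subtractf[symmetric]
      by (intro arg_cong[of _ _ "(*) h"], simp only:, intro sum.cong)
         (auto simp: m_def left_diff_distrib sin_diff algebra_simps)
    have "norm ?uc * norm ?ws + norm ?us * norm ?wc \<le> norm x * norm y"
      by (rule cs[OF nu[of t] nw[of t]]) auto
    then have "M * (norm ?uc * norm ?ws + norm ?us * norm ?wc) \<le> M * (norm x * norm y)"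
      using M0 by (rule mult_left_mono)
    then have "\<bar>h * Z\<bar> \<le> M * (norm x * norm y)"
      unfolding Z using bnd[of "\<lambda>j. cos (of_int j * t)" "\<lambda>j. sin (of_int j * t)"]
        bnd[of "\<lambda>j. sin (of_int j * t)" "\<lambda>j. cos (of_int j * t)"]
      unfolding distrib_left by linarith
    then have "\<bar>Z\<bar> * h \<le> M * (norm x * norm y)" using h by (simp add: abs_mult mult.commute)
    then show ?thesis unfolding Z_def[symmetric] using h by (simp only: pos_le_divide_eq)
  qed
  have "inner (E S (F S' x)) y = (\<Sum>ij\<in>I \<times> I. m ij)"
  proof -
    have "inner (E S (F S' x)) y = inner (F S' x) (E S y)" by (rule self_adjointD[OF A.saE[OF S]])
    also have "\<dots> = (\<Sum>ij\<in>I \<times> I. m ij)"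
      unfolding cA cB P_def[symmetric] Q_def[symmetric] m_def
      using expand[of "\<lambda>_. 1" "\<lambda>_. 1"] by (simp add: split_def)
    finally show ?thesis .
  qed
  also have "\<dots> = (\<Sum>ij\<in>K. m ij)"
    by (intro sum.mono_neutral_right) (auto simp: I K_def m0)
  also have "\<dots> \<le> pi / 2 * ((M * (norm x * norm y) / h) / real N)"
    by (rule bohr_inequality[OF _ N _ deriv]) (auto simp: K_def I)
  also have "\<dots> = pi / 2 * ((norm (A - B) + 2 * r / real N) * (norm x * norm y) / r)"
    using N r by (simp add: M_def h_def field_simps)
  finally show ?thesis .
qed

text \<open>The lattice estimate is tested with y = E S (F S' x), and N tends to infinity to remove
  the rounding error.\<close>

theorem separated_projections_norm_le:
  fixes A B :: "'a::{real_inner,complete_space} \<Rightarrow>\<^sub>L 'a"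
  assumes spA: "spectral_measure A E" and spB: "spectral_measure B F"
    and S: "S \<in> sets borel" and S': "S' \<in> sets borel"
    and sep: "\<And>s s'. s \<in> S \<Longrightarrow> s' \<in> S' \<Longrightarrow> r \<le> \<bar>s - s'\<bar>" and r: "r > 0"
  shows "norm (E S (F S' x)) \<le> pi / 2 * (norm (A - B) / r) * norm x"
proof -
  define y where "y = E S (F S' x)"
  have "(\<lambda>n. pi / 2 * ((norm (A - B) + 2 * r / real (Suc n)) * (norm x * norm y) / r)) \<longlonglongrightarrow>
      pi / 2 * ((norm (A - B) + 0) * (norm x * norm y) / r)"
    by (intro tendsto_intros LIMSEQ_Suc[OF lim_const_over_n[of "2 * r"]]) (use r in auto)
  then have "inner (E S (F S' x)) y \<le> pi / 2 * ((norm (A - B) + 0) * (norm x * norm y) / r)"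
    by (rule LIMSEQ_le_const)
       (use separated_projections_inner_le_lattice[OF spA spB S S' sep r] in blast)
  then have le: "norm y * norm y \<le> (pi / 2 * (norm (A - B) / r) * norm x) * norm y"
    by (simp add: y_def[symmetric] power2_norm_eq_inner[symmetric] power2_eq_square mult_ac)
  show ?thesis
  proof (cases "y = 0")
    case True
    then show ?thesis using r by (simp add: y_def)
  next
    case False
    then show ?thesis unfolding y_def[symmetric] by (intro mult_right_le_imp_le[OF le]) simp
  qed
qed

section \<open>Off-diagonal perturbations\<close>

context spectral_measure
begin

text \<open>The form of A + V on a spectral subspace on one side of l: the two parts of the spectrum
  cannot both come within r + d of l, and the equation \<delta> (\<delta> + d) = v^2 makes the
  2x2 form with diagonal entries \<delta>, \<delta> + d and off-diagonal entry v nonnegative.\<close>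

lemma offdiag_form_ge:
  assumes V: "self_adjoint V" "norm V \<le> v"
    and S: "S \<in> sets borel" "S' \<in> sets borel"
    and sep: "\<And>s s'. s \<in> S \<Longrightarrow> s' \<in> S' \<Longrightarrow> d \<le> \<bar>s - s'\<bar>"
    and off: "\<And>z. E S z = z \<Longrightarrow> inner (V z) z = 0" "\<And>z. E S' z = z \<Longrightarrow> inner (V z) z = 0"
    and \<delta>: "0 \<le> \<delta>" "0 < d" "\<delta> * (\<delta> + d) = v\<^sup>2"
    and \<epsilon>: "\<epsilon> = 1 \<or> \<epsilon> = (-1::real)"
    and far: "\<And>s. s \<in> S \<union> S' \<Longrightarrow> r \<le> \<epsilon> * (s - l)"
    and p: "E S p = p" and p': "E S' p' = p'"
  shows "(r - \<delta>) * (norm (p + p'))\<^sup>2 \<le>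
    \<epsilon> * (inner (T (p + p')) (p + p') - l * (norm (p + p'))\<^sup>2 + inner (V (p + p')) (p + p'))"
proof -
  have dis: "S \<inter> S' = {}" using sep \<delta>(2) by fastforce
  have ortho: "inner p p' = 0"
    using self_adjointD[OF saE[OF S(2)], of p p'] E_disjoint[OF S(2,1), of p] dis p p' by (simp add: Int_commute)
  have "inner (T p) p' = inner (E S (T p)) p'" using T_E[OF S(1), of p] p by simp
  also have "\<dots> = inner (T p) (E S p')" by (rule self_adjointD[OF saE[OF S(1)]])
  also have "E S p' = 0" using E_disjoint[OF S, of p'] dis p' by simp
  finally have Tpp': "inner (T p) p' = 0" by simp
  then have Tp'p: "inner (T p') p = 0" using self_adjointD[OF sa, of p' p] by (simp add: inner_commute)
  have np: "(norm (p + p'))\<^sup>2 = (norm p)\<^sup>2 + (norm p')\<^sup>2"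
    using ortho by (simp add: power2_norm_eq_inner inner_add_left inner_add_right inner_commute)
  have form: "m * (norm z)\<^sup>2 \<le> \<epsilon> * (inner (T z) z - l * (norm z)\<^sup>2)"
    if "D \<in> sets borel" "E D z = z" "\<And>s. s \<in> D \<Longrightarrow> m \<le> \<epsilon> * (s - l)" for D z m
    using \<epsilon>
  proof
    assume e: "\<epsilon> = 1"
    have "(l + m) * (norm z)\<^sup>2 \<le> inner (T z) z"
      by (rule form_ge[OF that(1,2)]) (use that(3) e in force)
    then show ?thesis by (simp add: e algebra_simps)
  next
    assume e: "\<epsilon> = -1"
    have "inner (T z) z \<le> (l - m) * (norm z)\<^sup>2"
      by (rule form_le[OF that(1,2)]) (use that(3) e in force)
    then show ?thesis by (simp add: e algebra_simps)
  qed
  have far': "(\<forall>s\<in>S. r + d \<le> \<epsilon> * (s - l)) \<or> (\<forall>s\<in>S'. r + d \<le> \<epsilon> * (s - l))"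
  proof (rule ccontr)
    assume "\<not> ?thesis"
    then obtain s s' where s: "s \<in> S" "\<epsilon> * (s - l) < r + d" "s' \<in> S'" "\<epsilon> * (s' - l) < r + d" by force
    have "r \<le> \<epsilon> * (s - l)" "r \<le> \<epsilon> * (s' - l)" using far s by auto
    then have "\<bar>s - s'\<bar> < d" using s \<epsilon> by (auto simp: abs_if)
    then show False using sep[OF s(1,3)] by simp
  qed
  have v: "0 \<le> v" using V(2) norm_ge_zero[of V] by linarith
  have quad: "2 * v * (a * b) \<le> \<delta> * a\<^sup>2 + (\<delta> + d) * b\<^sup>2" for a b :: real
  proof -
    \<comment> \<open>As v is the geometric mean of \<delta> and \<delta> + d, the difference of the
      two sides is a perfect square.\<close>
    have "v = sqrt \<delta> * sqrt (\<delta> + d)"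
      using \<delta> v by (simp add: real_sqrt_mult[symmetric])
    moreover have "0 \<le> (sqrt \<delta> * a - sqrt (\<delta> + d) * b)\<^sup>2" by simp
    ultimately show ?thesis
      using \<delta> by (simp add: power2_diff power_mult_distrib algebra_simps)
  qed
  have cross: "- (2 * v * (norm p * norm p')) \<le> \<epsilon> * inner (V (p + p')) (p + p')"
  proof -
    have "inner (V (p + p')) (p + p') = 2 * inner (V p) p'"
      using off(1)[OF p] off(2)[OF p'] self_adjointD[OF V(1), of p' p]
      by (simp add: blinfun.bilinear_simps inner_add_left inner_add_right inner_commute)
    moreover have "\<bar>inner (V p) p'\<bar> \<le> v * norm p * norm p'"
      using Cauchy_Schwarz_ineq2[of "V p" p'] order_trans[OF norm_blinfun mult_right_mono[OF V(2)], of p]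
      by (meson mult_right_mono norm_ge_zero order_trans)
    ultimately show ?thesis using \<epsilon> by (auto simp: abs_le_iff mult.assoc)
  qed
  have "(r - \<delta>) * ((norm p)\<^sup>2 + (norm p')\<^sup>2) \<le>
      \<epsilon> * (inner (T p) p - l * (norm p)\<^sup>2) + \<epsilon> * (inner (T p') p' - l * (norm p')\<^sup>2)
      - 2 * v * (norm p * norm p')"
    using far'
  proof
    assume h: "\<forall>s\<in>S. r + d \<le> \<epsilon> * (s - l)"
    have "(r + d) * (norm p)\<^sup>2 \<le> \<epsilon> * (inner (T p) p - l * (norm p)\<^sup>2)"
      using h by (intro form[OF S(1) p]) auto
    moreover have "r * (norm p')\<^sup>2 \<le> \<epsilon> * (inner (T p') p' - l * (norm p')\<^sup>2)"
      using far by (intro form[OF S(2) p']) auto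
    ultimately show ?thesis using quad[of "norm p'" "norm p"] by (simp add: algebra_simps)
  next
    assume h: "\<forall>s\<in>S'. r + d \<le> \<epsilon> * (s - l)"
    have "r * (norm p)\<^sup>2 \<le> \<epsilon> * (inner (T p) p - l * (norm p)\<^sup>2)"
      using far by (intro form[OF S(1) p]) auto
    moreover have "(r + d) * (norm p')\<^sup>2 \<le> \<epsilon> * (inner (T p') p' - l * (norm p')\<^sup>2)"
      using h by (intro form[OF S(2) p']) auto
    ultimately show ?thesis using quad[of "norm p" "norm p'"] by (simp add: algebra_simps)
  qed
  moreover have "inner (T (p + p')) (p + p') = inner (T p) p + inner (T p') p'"
    using Tpp' Tp'p by (simp add: blinfun.bilinear_simps inner_add_left inner_add_right)
  ultimately show ?thesis unfolding np using cross by (simp add: algebra_simps)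
qed

text \<open>The one-sided estimate is applied above l and, with reversed sign, below l. Testing x =
  p + q against p - q cancels the part of V between the two sides, so only the blocks covered by
  that estimate remain.\<close>

lemma offdiag_not_in_spec:
  assumes V: "self_adjoint V" "norm V \<le> v"
    and S: "S \<in> sets borel" "S' \<in> sets borel" and spec: "S \<union> S' = spec T"
    and sep: "\<And>s s'. s \<in> S \<Longrightarrow> s' \<in> S' \<Longrightarrow> d \<le> \<bar>s - s'\<bar>"
    and off: "E S o\<^sub>L V o\<^sub>L E S = 0" "E S' o\<^sub>L V o\<^sub>L E S' = 0"
    and \<delta>: "0 \<le> \<delta>" "0 < d" "\<delta> * (\<delta> + d) = v\<^sup>2"
    and gap: "\<And>s. s \<in> spec T \<Longrightarrow> r \<le> \<bar>s - l\<bar>" "\<delta> < r"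
  shows "l \<notin> spec (T + V)"
proof -
  \<comment> \<open>The diagonal blocks of V vanish on S and S'; their pieces above and below l
    inherit this.\<close>
  have form0: "inner (V z) z = 0" if "E D o\<^sub>L V o\<^sub>L E D = 0" "D \<in> sets borel" "E D' z = z" "D' \<in> sets borel" "D' \<subseteq> D"
    for D D' z
  proof -
    have z: "E D z = z" using E_subset[OF that(4,2,5), of z] that(3) by simp
    have "inner (V z) z = inner (V (E D z)) (E D z)" by (simp add: z)
    also have "\<dots> = inner ((E D o\<^sub>L V o\<^sub>L E D) z) z" by (simp add: self_adjointD[OF saE[OF that(2)]])
    finally show ?thesis using that(1) by simp
  qed
  have lower: "(r - \<delta>) * norm x \<le> norm ((T + V) x - l *\<^sub>R x)" for x
  proof -
    define U U' W W' where "U = S \<inter> {l<..}" and "U' = S' \<inter> {l<..}"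
      and "W = S \<inter> {..<l}" and "W' = S' \<inter> {..<l}"
    have m: "U \<in> sets borel" "U' \<in> sets borel" "W \<in> sets borel" "W' \<in> sets borel"
      using S by (auto simp: U_def U'_def W_def W'_def)
    have SS': "S \<inter> S' = {}" using sep \<delta>(2) by fastforce
    have l: "l \<notin> spec T" using gap(1)[of l] gap(2) \<delta>(1) by auto
    have UW: "(U \<union> U') \<union> (W \<union> W') = spec T"
      using l unfolding spec[symmetric] by (auto simp: U_def U'_def W_def W'_def) (metis linorder_neqE)+
    define p where "p = E U x + E U' x"
    define q where "q = E W x + E W' x"
    have pq: "p = E (U \<union> U') x" "q = E (W \<union> W') x"
      unfolding p_def q_def by (intro E_Un[symmetric] m; use SS' in \<open>auto simp: U_def U'_def W_def W'_def\<close>)+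
    have dis: "(U \<union> U') \<inter> (W \<union> W') = {}" by (auto simp: U_def U'_def W_def W'_def)
    have x: "x = p + q"
      using E_Un[of "U \<union> U'" "W \<union> W'" x] m dis UW by (simp add: pq E_spec)
    have p: "E (U \<union> U') p = p" and q: "E (U \<union> U') q = 0"
      using m dis by (simp_all add: pq E_E)
    have mU: "U \<union> U' \<in> sets borel" using m by auto
    have ortho: "inner p q = 0" using self_adjointD[OF saE[OF mU], of p q] p q by simp
    have Tpq: "inner (T p) q = 0"
      using self_adjointD[OF saE[OF mU], of "T p" q] T_E[OF mU, of p] p q by simp
    have Tqp: "inner (T q) p = 0" using Tpq self_adjointD[OF sa, of q p] by (simp add: inner_commute)
    have far: "s \<in> U \<union> U' \<Longrightarrow> r \<le> 1 * (s - l)" "s \<in> W \<union> W' \<Longrightarrow> r \<le> (-1) * (s - l)" for s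
      using gap(1)[of s] spec[symmetric] by (auto simp: U_def U'_def W_def W'_def)
    have 1: "(r - \<delta>) * (norm p)\<^sup>2 \<le> 1 * (inner (T p) p - l * (norm p)\<^sup>2 + inner (V p) p)"
      unfolding p_def
    proof (rule offdiag_form_ge[OF V m(1,2) _ _ _ \<delta>])
      show "inner (V z) z = 0" if "E U z = z" for z
        by (rule form0[OF off(1) S(1) that m(1)]) (auto simp: U_def)
      show "inner (V z) z = 0" if "E U' z = z" for z
        by (rule form0[OF off(2) S(2) that m(2)]) (auto simp: U'_def)
    qed (use far sep m in \<open>auto simp: E_E U_def U'_def\<close>)
    have 2: "(r - \<delta>) * (norm q)\<^sup>2 \<le> (-1) * (inner (T q) q - l * (norm q)\<^sup>2 + inner (V q) q)"
      unfolding q_def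
    proof (rule offdiag_form_ge[OF V m(3,4) _ _ _ \<delta>])
      show "inner (V z) z = 0" if "E W z = z" for z
        by (rule form0[OF off(1) S(1) that m(3)]) (auto simp: W_def)
      show "inner (V z) z = 0" if "E W' z = z" for z
        by (rule form0[OF off(2) S(2) that m(4)]) (auto simp: W'_def)
    qed (use far sep m in \<open>auto simp: E_E W_def W'_def\<close>)
    have nx: "(norm x)\<^sup>2 = (norm p)\<^sup>2 + (norm q)\<^sup>2" "(norm (p - q))\<^sup>2 = (norm p)\<^sup>2 + (norm q)\<^sup>2"
      using ortho by (simp_all add: x power2_norm_eq_inner inner_add_left inner_add_right inner_diff_left
          inner_diff_right inner_commute)
    have Vpq: "inner (V p) q = inner (V q) p"
      using self_adjointD[OF V(1), of p q] by (simp add: inner_commute)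
    have "inner ((T + V) x - l *\<^sub>R x) (p - q) =
        (inner (T p) p - l * (norm p)\<^sup>2 + inner (V p) p) - (inner (T q) q - l * (norm q)\<^sup>2 + inner (V q) q)"
      using Tpq Tqp ortho Vpq
      by (simp add: x blinfun.bilinear_simps inner_add_left inner_diff_left inner_diff_right
          inner_add_right power2_norm_eq_inner inner_commute algebra_simps)
    then have "(r - \<delta>) * (norm x)\<^sup>2 \<le> inner ((T + V) x - l *\<^sub>R x) (p - q)"
      using 1 2 by (simp add: nx(1) distrib_left)
    also have "\<dots> \<le> norm ((T + V) x - l *\<^sub>R x) * norm (p - q)" by (rule norm_cauchy_schwarz)
    also have "norm (p - q) = norm x" using nx by (metis norm_ge_zero power2_eq_iff_nonneg)
    finally have le: "((r - \<delta>) * norm x) * norm x \<le> norm ((T + V) x - l *\<^sub>R x) * norm x"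
      by (simp add: power2_eq_square mult.assoc)
    show ?thesis
    proof (cases "x = 0")
      case True
      then show ?thesis by (simp add: blinfun.bilinear_simps)
    next
      case False
      then show ?thesis by (intro mult_right_le_imp_le[OF le]) simp
    qed
  qed
  then show ?thesis
    unfolding not_in_spec_iff[OF self_adjoint_add[OF sa V(1)]]
    using gap(2) by (intro exI[of _ "r - \<delta>"]) auto
qed

end

text \<open>P - Q = P (1 - Q) - (1 - P) Q: the two terms have orthogonal ranges and act on
  orthogonal parts of x, so Pythagoras on both sides keeps the constant c.\<close>

lemma projection_diff_norm_le:
  fixes P Q :: "'a::real_inner \<Rightarrow>\<^sub>L 'a"
  assumes P: "self_adjoint P" "P o\<^sub>L P = P" and Q: "self_adjoint Q" "Q o\<^sub>L Q = Q" and c: "0 \<le> c"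
    and 1: "\<And>x. norm (P (x - Q x)) \<le> c * norm (x - Q x)"
    and 2: "\<And>x. norm (Q x - P (Q x)) \<le> c * norm (Q x)"
  shows "norm (P - Q) \<le> c"
proof (rule norm_blinfun_bound[OF c])
  fix x
  define y where "y = P (x - Q x)"
  define z where "z = Q x - P (Q x)"
  have PP: "P (P w) = P w" for w using P(2) by (metis blinfun_apply_blinfun_compose)
  have e: "(P - Q) x = y - z" by (simp add: y_def z_def blinfun.bilinear_simps)
  have "P z = 0" by (simp add: z_def blinfun.bilinear_simps PP)
  then have "inner y z = 0" using self_adjointD[OF P(1), of "x - Q x" z] by (simp add: y_def)
  then have "(norm ((P - Q) x))\<^sup>2 = (norm y)\<^sup>2 + (norm z)\<^sup>2"
    unfolding e by (simp add: power2_norm_eq_inner inner_diff_left inner_diff_right inner_commute)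
  also have "\<dots> \<le> (c * norm (x - Q x))\<^sup>2 + (c * norm (Q x))\<^sup>2"
    unfolding y_def z_def by (intro add_mono power_mono 1 2) auto
  also have "\<dots> = (c * norm x)\<^sup>2"
    using projection_pythagoras[OF Q, of x] by (simp add: power_mult_distrib algebra_simps)
  finally show "norm ((P - Q) x) \<le> c * norm x"
    by (rule power2_le_imp_le) (use c in auto)
qed

text \<open>For u = tan (\<theta>/2) and tan \<theta> = 2 v / d, the double-angle formula gives v (1
  - u^2) = d u. Multiplied by v, this is the quadratic equation for \<delta> = v u.\<close>

lemma half_angle_shift:
  fixes v d :: real
  assumes v: "0 \<le> v" and d: "0 < d" and \<delta>: "\<delta> = v * tan (arctan (2 * v / d) / 2)"
  shows "0 \<le> \<delta>" "\<delta> * (\<delta> + d) = v\<^sup>2"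
proof -
  define \<theta> where "\<theta> = arctan (2 * v / d)"
  define u where "u = tan (\<theta> / 2)"
  have th: "0 \<le> \<theta>" "\<theta> < pi / 2" using v d arctan_ubound by (auto simp: \<theta>_def)
  have u: "0 \<le> u" unfolding u_def
    using th by (cases "\<theta> = 0") (auto intro!: less_imp_le tan_gt_zero)
  show "0 \<le> \<delta>" using u v by (simp add: \<delta> u_def \<theta>_def)
  show "\<delta> * (\<delta> + d) = v\<^sup>2"
  proof (cases "v = 0")
    case True
    then show ?thesis by (simp add: \<delta>)
  next
    case False
    have "cos (\<theta> / 2) \<noteq> 0" "cos (2 * (\<theta> / 2)) \<noteq> 0"
      using th cos_gt_zero[of "\<theta> / 2"] cos_gt_zero[of \<theta>] by (cases "\<theta> = 0"; force)+
    from tan_double[OF this] have "tan \<theta> = 2 * u / (1 - u\<^sup>2)" by (simp add: u_def)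
    then have e: "2 * v / d = 2 * u / (1 - u\<^sup>2)" by (simp only: \<theta>_def tan_arctan)
    then have "1 - u\<^sup>2 \<noteq> 0" using False d by auto
    with e have "v * (1 - u\<^sup>2) = d * u" using d by (simp add: field_simps)
    then have "v * (v * (1 - u\<^sup>2)) = v * (d * u)" by simp
    moreover have "\<delta> = v * u" by (simp add: \<delta> u_def \<theta>_def)
    ultimately show ?thesis by (simp add: power2_eq_square algebra_simps)
  qed
qed

text \<open>The map t \<mapsto> t (t + d) increases for t \<ge> 0, so bounds on \<delta> follow
  without solving its equation.\<close>

lemma shift_lessI:
  fixes \<delta> d v w :: real
  assumes "0 \<le> \<delta>" "0 < d" "\<delta> * (\<delta> + d) = v\<^sup>2" "0 \<le> w" "v\<^sup>2 < w * (w + d)"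
  shows "\<delta> < w"
proof (rule ccontr)
  assume "\<not> ?thesis"
  then have "w * (w + d) \<le> \<delta> * (\<delta> + d)" using assms by (intro mult_mono) auto
  then show False using assms by simp
qed

text \<open>Setting w = d - pi/2 * v, the condition v^2 < w (w + d) reads (pi^2 - 4) v^2 - 6 pi v d
  + 8 d^2 > 0. The constant in the hypothesis is the smaller root of this quadratic in v/d.\<close>

lemma shift_bound:
  fixes \<delta> d v :: real
  assumes \<delta>: "0 \<le> \<delta>" "0 < d" "\<delta> * (\<delta> + d) = v\<^sup>2" and v: "0 \<le> v"
    and less: "v < (3 * pi - sqrt (pi\<^sup>2 + 32)) / (pi\<^sup>2 - 4) * d"
  shows "\<delta> < d - pi / 2 * v"
proof -
  define s where "s = sqrt (pi\<^sup>2 + 32)"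
  have s: "0 \<le> s" "s\<^sup>2 = pi\<^sup>2 + 32" by (simp_all add: s_def)
  have pi: "pi > 2" using pi_gt3 by simp
  then have "2\<^sup>2 < pi\<^sup>2" by (intro power_strict_mono) auto
  then have k: "pi\<^sup>2 - 4 > 0" by simp
  have X: "(pi\<^sup>2 - 4) * v < (3 * pi - s) * d"
    using less k unfolding s_def[symmetric] by (simp add: field_simps)
  \<comment> \<open>Nonnegativity of w: the constant is at most 2/pi, which after squaring amounts
    to (pi^2 + 8)^2 \<le> pi^2 (pi^2 + 32).\<close>
  have "pi * v \<le> 2 * d"
  proof -
    have "(pi\<^sup>2 + 8)\<^sup>2 \<le> (pi * s)\<^sup>2"
      unfolding power_mult_distrib s(2) using \<open>2\<^sup>2 < pi\<^sup>2\<close> by (simp add: power2_eq_square algebra_simps)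
    then have "pi\<^sup>2 + 8 \<le> pi * s" by (rule power2_le_imp_le) (use s pi in auto)
    then have a: "pi * (3 * pi - s) \<le> 2 * (pi\<^sup>2 - 4)" by (simp add: power2_eq_square algebra_simps)
    have "(pi\<^sup>2 - 4) * (pi * v) \<le> pi * ((3 * pi - s) * d)"
      using mult_left_mono[OF less_imp_le[OF X], of pi] by (simp add: mult_ac)
    also have "\<dots> \<le> (2 * (pi\<^sup>2 - 4)) * d"
      using mult_right_mono[OF a, of d] \<delta>(2) by (simp add: mult_ac)
    finally have "(pi\<^sup>2 - 4) * (pi * v) \<le> (pi\<^sup>2 - 4) * (2 * d)" by (simp add: mult_ac)
    then show ?thesis using k by simp
  qed
  then have w: "0 \<le> d - pi / 2 * v" by simp
  have "s * d < 3 * pi * d - (pi\<^sup>2 - 4) * v" using X by (simp add: algebra_simps)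
  then have "(s * d)\<^sup>2 < (3 * pi * d - (pi\<^sup>2 - 4) * v)\<^sup>2"
    using s \<delta>(2) by (intro power_strict_mono) auto
  then have "0 < (pi\<^sup>2 - 4) * ((pi\<^sup>2 - 4) * v\<^sup>2 - 6 * pi * v * d + 8 * d\<^sup>2)"
    unfolding power_mult_distrib s(2) by (simp add: power2_eq_square algebra_simps)
  then have "0 < (pi\<^sup>2 - 4) * v\<^sup>2 - 6 * pi * v * d + 8 * d\<^sup>2"
    using k by (simp add: zero_less_mult_iff)
  then have "v\<^sup>2 < (d - pi / 2 * v) * ((d - pi / 2 * v) + d)"
    by (simp add: power2_eq_square algebra_simps)
  from shift_lessI[OF \<delta> w this] show ?thesis .
qed

theorem theorem1:
  fixes A V B :: "'a::{real_inner,complete_space} \<Rightarrow>\<^sub>L 'a"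
    and \<sigma> \<Sigma> :: "real set" and d \<delta>V :: real
  assumes sep: "separable_space TYPE('a)"
    and sa_A: "self_adjoint A" and sa_V: "self_adjoint V"
    and B_def: "B = A + V"
    and sub: "\<sigma> \<subseteq> spec A"
    and Sig_def: "\<Sigma> = spec A - \<sigma>"
    and d_def: "d = setdist \<sigma> \<Sigma>" and d_pos: "d > 0"
    and offdiag: "spectral_proj A \<sigma> o\<^sub>L V o\<^sub>L spectral_proj A \<sigma> = 0"
                 "spectral_proj A \<Sigma> o\<^sub>L V o\<^sub>L spectral_proj A \<Sigma> = 0"
    and delta_def: "\<delta>V = norm V * tan (arctan (2 * norm V / d) / 2)"
    and small: "norm V < sqrt 3 / 2 * d"
  shows "(\<exists>\<epsilon>>0. \<forall>x\<in>spec B \<inter> open_nbhd (d/2) \<sigma>. \<forall>y\<in>spec B - open_nbhd (d/2) \<sigma>.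
             \<epsilon> \<le> dist x y)
       \<and> spec B \<inter> open_nbhd (d/2) \<sigma> = spec B \<inter> closed_nbhd \<delta>V \<sigma>
       \<and> spec B \<inter> open_nbhd (d/2) \<sigma> \<noteq> {}
       \<and> closed (spec B \<inter> open_nbhd (d/2) \<sigma>)
       \<and> (norm V < (3 * pi - sqrt (pi\<^sup>2 + 32)) / (pi\<^sup>2 - 4) * d \<longrightarrow>
            norm (spectral_proj A \<sigma> - spectral_proj B (open_nbhd (d/2) \<sigma>))
              \<le> pi / 2 * (norm V / (d - \<delta>V))
          \<and> pi / 2 * (norm V / (d - \<delta>V)) < 1)"
proof -
  define v where "v = norm V"
  define \<delta> where "\<delta> = \<delta>V"
  have v: "0 \<le> v" by (simp add: v_def)
  have \<delta>: "0 \<le> \<delta>" "0 < d" "\<delta> * (\<delta> + d) = v\<^sup>2"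
    using half_angle_shift[OF v d_pos, of \<delta>] d_pos by (simp_all add: delta_def v_def \<delta>_def)
  have \<delta>_half: "\<delta> < d / 2"
  proof (rule shift_lessI[OF \<delta>])
    have "v\<^sup>2 < (sqrt 3 / 2 * d)\<^sup>2" using small v by (intro power_strict_mono) (auto simp: v_def)
    then show "v\<^sup>2 < d / 2 * (d / 2 + d)" 
      by (simp add: power_mult_distrib power_divide) (simp add: power2_eq_square)
  qed (use d_pos in simp)
  \<comment> \<open>\<open>setdist\<close> has the default value 0 for an empty set, so d > 0 forces
    both parts to be nonempty. \<open>infdist\<close> has the same default, so the distances below
    depend on this.\<close>
  have ne: "\<sigma> \<noteq> {}" "\<Sigma> \<noteq> {}" using d_def d_pos by auto
  have sepd: "d \<le> dist s s'" if "s \<in> \<sigma>" "s' \<in> \<Sigma>" for s s'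
    unfolding d_def using that by (rule setdist_le_dist)
  have idsum: "d \<le> infdist l \<sigma> + infdist l \<Sigma>" for l
  proof -
    have "d - infdist l \<Sigma> \<le> infdist l \<sigma>"
      unfolding infdist_notempty[OF ne(1)]
    proof (rule cINF_greatest[OF ne(1)])
      fix s assume s: "s \<in> \<sigma>"
      have "d - dist l s \<le> infdist l \<Sigma>"
        unfolding infdist_notempty[OF ne(2)]
      proof (rule cINF_greatest[OF ne(2)])
        fix s' assume "s' \<in> \<Sigma>"
        then show "d - dist l s \<le> dist l s'"
          using sepd[OF s] dist_triangle[of s s' l] by (force simp: dist_commute)
      qed
      then show "d - infdist l \<Sigma> \<le> dist l s" by simp
    qed
    then show ?thesis by simp
  qed
  interpret A: spectral_measure A "spectral_proj A"
    using sa_A spectral_measure_exists by unfold_locales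
  \<comment> \<open>Measurability of \<sigma> comes from the gap: a point of the spectrum at
    distance 0 from \<sigma> cannot lie in \<Sigma>, so \<sigma> is closed.\<close>
  have sigma_eq: "\<sigma> = spec A \<inter> {x. infdist x \<sigma> \<le> 0}"
  proof -
    have "x \<in> \<sigma>" if "x \<in> spec A" "infdist x \<sigma> \<le> 0" for x
    proof (rule ccontr)
      assume "x \<notin> \<sigma>"
      then have "infdist x \<Sigma> = 0" using that Sig_def by simp
      then show False using idsum[of x] that d_pos by simp
    qed
    then show ?thesis using sub by auto
  qed
  have cl_nbhd: "closed (closed_nbhd c \<sigma>)" for c
    unfolding closed_nbhd_def by (intro closed_Collect_le continuous_intros)
  have op_nbhd: "open (open_nbhd c \<sigma>)" for c
    unfolding open_nbhd_def by (intro open_Collect_less continuous_intros)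
  have b\<sigma>: "\<sigma> \<in> sets borel"
    using closed_Int[OF closed_spec[OF sa_A] cl_nbhd[of 0]] sigma_eq by (simp add: closed_nbhd_def)
  have b\<Sigma>: "\<Sigma> \<in> sets borel" unfolding Sig_def using b\<sigma> A.spec_borel by auto
  \<comment> \<open>The path from A at 0 to B at 1. Along it the perturbation stays off-diagonal
    with norm at most v, so one \<delta> serves for all t.\<close>
  define Bt where "Bt t = A + t *\<^sub>R V" for t
  have saB: "self_adjoint (Bt t)" for t
    unfolding Bt_def by (intro self_adjoint_add self_adjoint_scaleR sa_A sa_V)
  have incl: "infdist l \<sigma> \<le> \<delta> \<or> infdist l \<Sigma> \<le> \<delta>" if "l \<in> spec (Bt t)" "0 \<le> t" "t \<le> 1" for l t
  proof (rule ccontr)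
    assume *: "\<not> ?thesis"
    define r where "r = min (infdist l \<sigma>) (infdist l \<Sigma>)"
    have scale: "X o\<^sub>L t *\<^sub>R V o\<^sub>L X = t *\<^sub>R (X o\<^sub>L V o\<^sub>L X)" for X :: "'a \<Rightarrow>\<^sub>L 'a"
      by (rule blinfun_eqI) (simp add: blinfun.bilinear_simps)
    have "l \<notin> spec (A + t *\<^sub>R V)"
    proof (rule A.offdiag_not_in_spec[OF _ _ b\<sigma> b\<Sigma> _ _ _ _ \<delta>, where r = r])
      show "self_adjoint (t *\<^sub>R V)" by (intro self_adjoint_scaleR sa_V)
      show "norm (t *\<^sub>R V) \<le> v" using that v by (simp add: v_def mult_left_le_one_le)
      show "\<sigma> \<union> \<Sigma> = spec A" using sub Sig_def by auto
      show "d \<le> \<bar>s - s'\<bar>" if "s \<in> \<sigma>" "s' \<in> \<Sigma>" for s s'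
        using sepd[OF that] by (simp add: dist_real_def)
      show "spectral_proj A \<sigma> o\<^sub>L t *\<^sub>R V o\<^sub>L spectral_proj A \<sigma> = 0"
        by (simp only: scale offdiag(1)) simp
      show "spectral_proj A \<Sigma> o\<^sub>L t *\<^sub>R V o\<^sub>L spectral_proj A \<Sigma> = 0"
        by (simp only: scale offdiag(2)) simp
      show "r \<le> \<bar>s - l\<bar>" if "s \<in> spec A" for s
      proof (cases "s \<in> \<sigma>")
        case True
        then have "infdist l \<sigma> \<le> dist l s" by (rule infdist_le)
        then show ?thesis by (simp add: r_def dist_real_def abs_minus_commute)
      next
        case False
        then have "infdist l \<Sigma> \<le> dist l s" using that Sig_def by (intro infdist_le) auto
        then show ?thesis by (simp add: r_def dist_real_def abs_minus_commute)
      qed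
      show "\<delta> < r" using * by (simp add: r_def)
    qed
    then show False using that by (simp add: Bt_def)
  qed
  \<comment> \<open>Closeness to \<Sigma> is impossible here: two distances below d/2 would add up
    to less than d, against \<open>idsum\<close>.\<close>
  have near: "infdist l \<sigma> \<le> \<delta>" if "l \<in> spec (Bt t)" "0 \<le> t" "t \<le> 1" "l \<in> open_nbhd (d/2) \<sigma>" for l t
    using incl[OF that(1-3)] that(4) idsum[of l] \<delta>_half by (auto simp: open_nbhd_def)
  have away: "infdist l \<Sigma> \<le> \<delta>" if "l \<in> spec (Bt t)" "0 \<le> t" "t \<le> 1" "l \<notin> open_nbhd (d/2) \<sigma>" for l t
    using incl[OF that(1-3)] that(4) \<delta>_half by (auto simp: open_nbhd_def)
  have B1: "B = Bt 1" by (simp add: Bt_def B_def)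
  have eq: "spec B \<inter> open_nbhd (d/2) \<sigma> = spec B \<inter> closed_nbhd \<delta>V \<sigma>"
    using near[of _ 1] \<delta>_half by (auto simp: B1 open_nbhd_def closed_nbhd_def \<delta>_def)
  have closed: "closed (spec B \<inter> open_nbhd (d/2) \<sigma>)"
    unfolding eq unfolding B1 by (intro closed_Int closed_spec saB cl_nbhd)
  have separated: "\<exists>\<epsilon>>0. \<forall>x\<in>spec B \<inter> open_nbhd (d/2) \<sigma>. \<forall>y\<in>spec B - open_nbhd (d/2) \<sigma>. \<epsilon> \<le> dist x y"
  proof (intro exI[of _ "d / 2 - \<delta>"] conjI ballI)
    show "0 < d / 2 - \<delta>" using \<delta>_half by simp
    fix x y assume xy: "x \<in> spec B \<inter> open_nbhd (d/2) \<sigma>" "y \<in> spec B - open_nbhd (d/2) \<sigma>"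
    have "infdist x \<sigma> \<le> \<delta>" using near[of x 1] xy by (simp add: B1)
    moreover have "d / 2 \<le> infdist y \<sigma>" using xy by (simp add: open_nbhd_def)
    ultimately show "d / 2 - \<delta> \<le> dist x y"
      using infdist_triangle[of y \<sigma> x] by (simp add: dist_commute)
  qed
  have nonempty: "spec B \<inter> open_nbhd (d/2) \<sigma> \<noteq> {}"
  proof
    assume empty: "spec B \<inter> open_nbhd (d/2) \<sigma> = {}"
    \<comment> \<open>If no spectrum is near \<sigma> at t, all of it is at distance at least d -
      \<delta> from \<sigma>, while spectrum near \<sigma> at s would be within \<delta>. A step of
      size below d - 2 \<delta> cannot bridge this.\<close>
    have step: "spec (Bt s) \<inter> open_nbhd (d/2) \<sigma> = {}"
      if e: "spec (Bt t) \<inter> open_nbhd (d/2) \<sigma> = {}" and st: "0 \<le> s" "s \<le> 1" "0 \<le> t" "t \<le> 1"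
        and c: "\<bar>s - t\<bar> * v < d - 2 * \<delta>" for s t
    proof (rule ccontr)
      assume "\<not> ?thesis"
      then obtain l where l: "l \<in> spec (Bt s)" "l \<in> open_nbhd (d/2) \<sigma>" by blast
      have nl: "infdist l \<sigma> \<le> \<delta>" by (rule near[OF l(1) st(1,2) l(2)])
      have "l \<notin> spec (Bt s)"
      proof (rule spec_perturbation[OF saB saB])
        fix b assume b: "b \<in> spec (Bt t)"
        then have "b \<notin> open_nbhd (d/2) \<sigma>" using e by blast
        then have "infdist b \<Sigma> \<le> \<delta>" by (rule away[OF b st(3,4)])
        then have "d - \<delta> \<le> infdist b \<sigma>" using idsum[of b] by simp
        then show "d - 2 * \<delta> \<le> \<bar>b - l\<bar>"
          using infdist_triangle[of b \<sigma> l] nl by (simp add: dist_real_def)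
      next
        have "Bt s - Bt t = (s - t) *\<^sub>R V" by (simp add: Bt_def scaleR_left_diff_distrib)
        then show "norm (Bt s - Bt t) < d - 2 * \<delta>" using c by (simp add: v_def)
      qed
      then show False using l(1) by simp
    qed
    \<comment> \<open>With n steps from t = 1 down to t = 0, each perturbation has norm v/n < d - 2
      \<delta>; at t = 0 the points of \<sigma> themselves give the contradiction.\<close>
    obtain n :: nat where n: "v / (d - 2 * \<delta>) < real n" using reals_Archimedean2 by blast
    have gap: "d - 2 * \<delta> > 0" using \<delta>_half by simp
    then have n0: "real n > 0" using n v by (meson divide_nonneg_pos le_less_trans)
    have "spec (Bt (1 - real k / real n)) \<inter> open_nbhd (d/2) \<sigma> = {}" if "k \<le> n" for k
      using that
    proof (induction k)
      case 0
      then show ?case using empty by (simp add: B1)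
    next
      case (Suc k)
      have "\<bar>(1 - real (Suc k) / real n) - (1 - real k / real n)\<bar> = 1 / real n"
        using n0 by (simp add: field_simps)
      moreover have "1 / real n * v < d - 2 * \<delta>"
        using n n0 gap by (simp add: field_simps)
      moreover have "0 \<le> 1 - real (Suc k) / real n" "0 \<le> 1 - real k / real n"
        using n0 Suc.prems by (auto simp: field_simps)
      ultimately show ?case
        using Suc by (intro step[where t = "1 - real k / real n" and s = "1 - real (Suc k) / real n"]; simp)
    qed
    from this[of n] have "spec A \<inter> open_nbhd (d/2) \<sigma> = {}" using n0 by (simp add: Bt_def)
    moreover obtain s where "s \<in> \<sigma>" using ne by blast
    ultimately show False using sub d_pos by (auto simp: open_nbhd_def)
  qed
  have subspaces: "norm (spectral_proj A \<sigma> - spectral_proj B (open_nbhd (d/2) \<sigma>)) \<le> pi / 2 * (norm V / (d - \<delta>V))"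
  proof -
    define U where "U = open_nbhd (d/2) \<sigma>"
    have saB': "self_adjoint B" unfolding B1 by (rule saB)
    interpret B: spectral_measure B "spectral_proj B"
      using saB' spectral_measure_exists by unfold_locales
    have bU: "U \<in> sets borel" using op_nbhd by (simp add: U_def)
    \<comment> \<open>Only spectral points of B are known to be at distance d - \<delta> from
      \<sigma> or \<Sigma>; \<open>E_Int_spec\<close> allows the restriction to them.\<close>
    have bS: "U \<inter> spec B \<in> sets borel" "- U \<inter> spec B \<in> sets borel" using bU B.spec_borel by auto
    let ?P = "spectral_proj A \<sigma>" and ?Q = "spectral_proj B U"
    have r: "d - \<delta> > 0" using \<delta>_half d_pos by simp
    have AB: "norm (A - B) = v" by (simp add: B_def v_def)
    have n1: "norm (?P (spectral_proj B (- U \<inter> spec B) x)) \<le> pi / 2 * (norm (A - B) / (d - \<delta>)) * norm x" for x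
    proof (rule separated_projections_norm_le[OF A.spectral_measure_axioms B.spectral_measure_axioms b\<sigma> bS(2) _ r])
      fix s s' assume s: "s \<in> \<sigma>" "s' \<in> - U \<inter> spec B"
      have "infdist s' \<Sigma> \<le> \<delta>" using away[of s' 1] s by (simp add: B1 U_def)
      then have "d - \<delta> \<le> infdist s' \<sigma>" using idsum[of s'] by simp
      also have "\<dots> \<le> dist s' s" by (rule infdist_le[OF s(1)])
      finally show "d - \<delta> \<le> \<bar>s - s'\<bar>" by (simp add: dist_real_def abs_minus_commute)
    qed
    have n2: "norm (spectral_proj A \<Sigma> (spectral_proj B (U \<inter> spec B) x)) \<le> pi / 2 * (norm (A - B) / (d - \<delta>)) * norm x" for x
    proof (rule separated_projections_norm_le[OF A.spectral_measure_axioms B.spectral_measure_axioms b\<Sigma> bS(1) _ r])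
      fix s s' assume s: "s \<in> \<Sigma>" "s' \<in> U \<inter> spec B"
      have "infdist s' \<sigma> \<le> \<delta>" using near[of s' 1] s by (simp add: B1 U_def)
      then have "d - \<delta> \<le> infdist s' \<Sigma>" using idsum[of s'] by simp
      also have "\<dots> \<le> dist s' s" by (rule infdist_le[OF s(1)])
      finally show "d - \<delta> \<le> \<bar>s - s'\<bar>" by (simp add: dist_real_def abs_minus_commute)
    qed
    have P': "spectral_proj A \<Sigma> x = x - ?P x" for x
    proof -
      have "spectral_proj A (\<sigma> \<union> \<Sigma>) x = ?P x + spectral_proj A \<Sigma> x"
        by (rule A.E_Un[OF b\<sigma> b\<Sigma>]) (auto simp: Sig_def)
      moreover have "\<sigma> \<union> \<Sigma> = spec A" using sub Sig_def by auto
      ultimately show ?thesis by (simp add: A.E_spec eq_diff_eq add.commute)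
    qed
    have "norm (?P - ?Q) \<le> pi / 2 * (v / (d - \<delta>))"
    proof (rule projection_diff_norm_le[OF A.saE A.E_idem B.saE B.E_idem])
      fix x
      have x1: "x - ?Q x = spectral_proj B (- U) x" using B.E_compl[OF bU] by simp
      have "spectral_proj B (- U) (spectral_proj B (- U) x) = spectral_proj B (- U) x"
        using bU by (simp add: B.E_E)
      then show "norm (?P (x - ?Q x)) \<le> pi / 2 * (v / (d - \<delta>)) * norm (x - ?Q x)"
        using n1[of "x - ?Q x"] bU by (simp add: AB x1 B.E_Int_spec)
      have "?Q (?Q x) = ?Q x" using bU by (simp add: B.E_E)
      then show "norm (?Q x - ?P (?Q x)) \<le> pi / 2 * (v / (d - \<delta>)) * norm (?Q x)"
        using n2[of "?Q x"] bU by (simp add: AB P' B.E_Int_spec)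
    qed (use b\<sigma> bU v r in auto)
    then show ?thesis by (simp add: U_def v_def \<delta>_def)
  qed
  have "pi / 2 * (norm V / (d - \<delta>V)) < 1" if "norm V < (3 * pi - sqrt (pi\<^sup>2 + 32)) / (pi\<^sup>2 - 4) * d"
  proof -
    have "\<delta> < d - pi / 2 * v" by (rule shift_bound[OF \<delta> v]) (use that in \<open>simp add: v_def\<close>)
    then have "pi / 2 * v < d - \<delta>" by simp
    moreover have "0 < d - \<delta>" using \<delta>_half d_pos by simp
    ultimately show ?thesis by (simp add: v_def \<delta>_def field_simps)
  qed
  then show ?thesis using separated eq nonempty closed subspaces by blast
qed

end
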